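(* Let $E\to M$ be an exact Courant algebroid, $d=\dim M\ge2$, with (semi-Riemannian) generalised metric $\mathcal G$ and divergence operator $\mathrm{div}=\mathrm{div}^{\mathcal G}-\langle e,\cdot\rangle$, $e\in\Gamma(E)$. The generalised scalar curvature is given by $$\mathcal{S}c(\mathcal G,\mathrm{div})=\mathrm{Sc}-\frac{|H|^2}{12}+\mathrm{div}^{\mathcal G}(e_+-e_-)-\frac12|e|^2_{\mathcal G}.$$
   Context: **Setting.** $(E,\pi,\langle\cdot,\cdot\rangle,[\cdot,\cdot])$ is an exact Courant algebroid over $M$: the bracket is the Dorfman bracket and $0\to T^*M\to E\xrightarrow{\pi}TM\to0$ is exact. A (semi-Riemannian) generalised metric is a nondegenerate symmetric bilinear form $\mathcal G$ on $E$ such that the endomorphism $\mathcal G^{\mathrm{End}}$ defined by $\langle\mathcal G^{\mathrm{End}}u,v\rangle=\mathcal G(u,v)$ is an involution and $\mathcal G|_{T^*M}$ is nondegenerate. $E_\pm$ are the $\pm1$-eigenbundles of $\mathcal G^{\mathrm{End}}$, so $E=E_+\oplus E_-$ orthogonally and $\mathcal G=\pm\langle\cdot,\cdot\rangle$ on $E_\pm$. The maps $\pi_\pm=\pi|_{E_\pm}:E_\pm\to TM$ are isomorphisms, and $g$ is the semi-Riemannian metric on $M$ with $(\pi_\pm)^*g=\mathcal G|_{E_\pm\times E_\pm}$. $\nabla$ is the Levi-Civita connection of $g$. The map $\phi:E\to\mathbb TM=TM\oplus T^*M$, $\phi|_{E_\pm}=(1\pm g)\circ\pi_\pm$, is an isomorphism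 of Courant algebroids onto $\mathbb TM$ with anchor the projection to $TM$, scalar product $\langle X+\xi,Y+\zeta\rangle=\frac12(\xi(Y)+\zeta(X))$ and bracket $[X+\xi,Y+\zeta]_H=\mathcal L_XY+\mathcal L_X\zeta-\iota_Yd\xi+H(X,Y,\cdot)$, where $H$ is a closed three-form on $M$ determined in this way. **Generalised connections.** A generalised connection is an $\mathbb R$-bilinear map $D:\Gamma(E)\times\Gamma(E)\to\Gamma(E)$, $(u,v)\mapsto D_uv$, $C^\infty(M)$-linear in $u$, with $D_u(fv)=(\pi(u)f)v+fD_uv$ and $\pi(u)\langle v,w\rangle=\langle D_uv,w\rangle+\langle v,D_uw\rangle$. Its torsion is $T(u,v,w)=\langle D_uv-D_vu-[u,v],w\rangle+\langle D_wu,v\rangle$. It is metric if $D\mathcal G=0$ (equivalently $D$ preserves $E_\pm$); a generalised Levi-Civita connection is a torsion-free metric generalised connection. A divergence operator is an $\mathbb R$-linear map $\mathrm{div}:\Gamma(E)\to C^\infty(M)$ with $\mathrm{div}(fv)=\pi(v)f+f\,\mathrm{div}(v)$; $D$ has divergence $\mathrm{div}^D(v)=\mathrm{tr}(u\mapsto D_uv)$. The metric divergence is $\mathrm{div}^{\mathcal G}=\mathrm{div}^g\circ\pi$, with $\mathrm{div}^g$ the divergence of $g$ on vector fields. **Canonical generalised Levi-Civita connection.** Let $\widetilde D$ be the generalised connection with $\widetilde D_u=\pi_\pm^{-1}\circ\nabla_{\pi(u)}\circ\pi_\pm$ on $\Gamma(E_\pm)$ for $u\in\Gamma(E_\pm)$,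 and $\widetilde D_u=[u,\cdot]_\mp$ on $\Gamma(E_\mp)$ for $u\in\Gamma(E_\pm)$ (subscripts on brackets denote projection to $E_\mp$). Its torsion $\widetilde T$ is totally skew; $D^0$ is defined by $\langle D^0_uv,w\rangle=\langle\widetilde D_uv,w\rangle-\frac13\widetilde T(u,v,w)$; it is a generalised Levi-Civita connection with divergence $\mathrm{div}^{\mathcal G}$. Let $\mathfrak{so}(E)_{\mathcal G}^{\langle1\rangle}$ be the bundle of $S\in E^*\otimes\mathfrak{so}(E)$, $S_u$ preserving $E_\pm$, with $\sum_{\mathrm{cycl}}\langle S_uv,w\rangle=0$; put $\mathrm{tr}(S)(v)=\mathrm{tr}(u\mapsto S_uv)$. $D=D^{\mathcal G,\mathrm{div}}$ is the unique generalised Levi-Civita connection with divergence $\mathrm{div}$ such that $D^{\mathcal G,\mathrm{div}}-D^0$ is pointwise orthogonal, with respect to the scalar product induced by $\langle\cdot,\cdot\rangle$, to $\ker(\mathrm{tr}:\mathfrak{so}(E)_{\mathcal G}^{\langle1\rangle}\to E^* )$. (Explicitly, $D^{\mathcal G,\mathrm{div}}-D^0=\frac1{d-1}(\chi_+^{e_+}+\chi_-^{e_-})$ with $\chi_\pm^{e_\pm}(a,b)=\langle a,b\rangle e_\pm-\langle e_\pm,b\rangle a$ for $a,b\in E_\pm$, extended by zero.) **Curvature.** With $D^2_{v,w}=D_vD_w-D_{D_vw}$ the generalised Riemann tensor is the section of $\mathrm{Sym}^2\Lambda^2E^*$ $$\mathcal{R}m^D(a,b,v,w)=\tfrac12\Big\{\langle(D^2_{v,w}-D^2_{w,v})b,a\rangle+\langle(D^2_{b,a}-D^2_{a,b})v,w\rangle-\mathrm{tr}_E(\langle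 Dv,w\rangle\langle Db,a\rangle)\Big\},$$ where $\mathrm{tr}_E$ is the trace with respect to $\langle\cdot,\cdot\rangle$ in the dotted slots: $\mathrm{tr}_E\,B=\sum_IB(e_I,e^I)$ for a local frame $(e_I)$ of $E$ and the frame $(e^I)$ with $\langle e^I,e_J\rangle=\delta^I_J$. The full generalised Ricci tensor is $\overline{\mathcal{R}c}^D(a,b)=\mathrm{tr}_E\,\mathcal{R}m^D(\cdot,a,\cdot,b)$ for $a,b\in\Gamma(E)$. The generalised scalar curvature is $\mathcal{S}c(\mathcal G,\mathrm{div})=\frac12\mathrm{tr}_{\mathcal G}\,\overline{\mathcal{R}c}^D$, where $\mathrm{tr}_{\mathcal G}$ is the trace over $E$ with respect to $\mathcal G$. **Notation.** $e_\pm$ are the projections of $e$ to $E_\pm$; $|e|^2_{\mathcal G}=\mathcal G(e,e)$; $\mathrm{Sc}$ is the scalar curvature of $g$; $|H|^2=H_{\mu\nu\rho}H^{\mu\nu\rho}$ (indices raised with $g$). *)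

theory Defs
  imports "HOL-Analysis.Analysis"
begin

section \<open>Smooth manifolds and vector bundles\<close>

primrec Ck_on :: "nat \<Rightarrow> 'a::real_normed_vector set \<Rightarrow> ('a \<Rightarrow> 'b::real_normed_vector) \<Rightarrow> bool" where
  "Ck_on 0 S f \<longleftrightarrow> continuous_on S f"
| "Ck_on (Suc k) S f \<longleftrightarrow> (\<forall>x\<in>S. f differentiable (at x)) \<and>
     (\<forall>v. Ck_on k S (\<lambda>x. frechet_derivative f (at x) v))"

text \<open>Only used for open \<open>S\<close>.\<close>

definition smooth_on :: "'a::real_normed_vector set \<Rightarrow> ('a \<Rightarrow> 'b::real_normed_vector) \<Rightarrow> bool" where
  "smooth_on S f \<longleftrightarrow> (\<forall>k. Ck_on k S f)"

text \<open>The manifold is a whole Hausdorff second countable type \<open>'m\<close>, with \<open>d = CARD('n)\<close>.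
  A chart is a pair of its domain and its coordinate map.\<close>

type_synonym ('m, 'n) chart = "'m set \<times> ('m \<Rightarrow> real ^ 'n)"
type_synonym ('m, 'n) atlas = "('m, 'n) chart set"

definition smooth_atlas ::
  "('m::{t2_space,second_countable_topology}, 'n::finite) atlas \<Rightarrow> bool" where
  "smooth_atlas A \<longleftrightarrow>
     (\<forall>(U, \<phi>)\<in>A. open U \<and> open (\<phi> ` U) \<and> (\<exists>\<psi>. homeomorphism U (\<phi> ` U) \<phi> \<psi>)) \<and>
     (\<Union>(U, \<phi>)\<in>A. U) = UNIV \<and>
     (\<forall>(U, \<phi>)\<in>A. \<forall>(V, \<psi>)\<in>A. smooth_on (\<phi> ` (U \<inter> V)) (\<psi> \<circ> inv_into U \<phi>))"

definition smooth_map_on ::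
  "('m, 'n::finite) atlas \<Rightarrow> 'm set \<Rightarrow> ('m \<Rightarrow> 'b::real_normed_vector) \<Rightarrow> bool" where
  "smooth_map_on A W f \<longleftrightarrow> (\<forall>(U, \<phi>)\<in>A. smooth_on (\<phi> ` (U \<inter> W)) (f \<circ> inv_into U \<phi>))"

abbreviation smooth_fun :: "('m, 'n::finite) atlas \<Rightarrow> ('m \<Rightarrow> real) \<Rightarrow> bool" where
  "smooth_fun A f \<equiv> smooth_map_on A UNIV f"

text \<open>A vector bundle over \<open>'m\<close> has as its fibre over \<open>x\<close> a copy of the vector space \<open>'v\<close>, so that
  its sections are functions \<open>'m \<Rightarrow> 'v\<close>. These copies are unrelated to each other: the topology
  and smooth structure of the total space are those given by the trivialisations \<open>(U, \<Phi>)\<close>, where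
  \<open>\<Phi> x\<close>, for \<open>x \<in> U\<close>, is a linear isomorphism of the fibre over \<open>x\<close> with the model space \<open>'v\<close>. No
  regularity of \<open>\<Phi>\<close> in \<open>x\<close> is asked, only that the transition functions be smooth. Every smooth
  vector bundle takes this form after choosing a linear isomorphism of each of its fibres with
  \<open>'v\<close>, and the bundle need not be trivial. The Euclidean structure of \<open>'v\<close> is used only through
  \<open>Basis\<close>, as one basis of each fibre.\<close>

type_synonym ('m, 'v) trivs = "('m set \<times> ('m \<Rightarrow> 'v \<Rightarrow> 'v)) set"

definition vector_bundle ::
  "('m::topological_space, 'n::finite) atlas \<Rightarrow> ('m, 'v::euclidean_space) trivs \<Rightarrow> bool" where
  "vector_bundle A T \<longleftrightarrow>
     (\<forall>(U, \<Phi>)\<in>T. open U \<and> (\<forall>x\<in>U. linear (\<Phi> x) \<and> bij (\<Phi> x))) \<and>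
     (\<Union>(U, \<Phi>)\<in>T. U) = UNIV \<and>
     (\<forall>(U, \<Phi>)\<in>T. \<forall>(V, \<Psi>)\<in>T. \<forall>a. smooth_map_on A (U \<inter> V) (\<lambda>x. \<Psi> x (inv (\<Phi> x) a)))"

definition smooth_section ::
  "('m, 'n::finite) atlas \<Rightarrow> ('m, 'v::euclidean_space) trivs \<Rightarrow> ('m \<Rightarrow> 'v) \<Rightarrow> bool" where
  "smooth_section A T s \<longleftrightarrow> (\<forall>(U, \<Phi>)\<in>T. smooth_map_on A U (\<lambda>x. \<Phi> x (s x)))"

text \<open>A smooth section through the vector \<open>p\<close> over \<open>x\<close>. It serves to evaluate at \<open>x\<close> expressions
  which are \<open>C\<^sup>\<infinity>\<close>-linear in a section, and hence depend only on the value of that section at \<open>x\<close>.\<close>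

definition ext ::
  "('m, 'n::finite) atlas \<Rightarrow> ('m, 'v::euclidean_space) trivs \<Rightarrow> 'm \<Rightarrow> 'v \<Rightarrow> 'm \<Rightarrow> 'v" where
  "ext A T x p = (SOME s. smooth_section A T s \<and> s x = p)"

definition nondegenerate :: "('v::real_vector \<Rightarrow> 'v \<Rightarrow> real) \<Rightarrow> bool" where
  "nondegenerate m \<longleftrightarrow> (\<forall>u. (\<forall>v. m u v = 0) \<longrightarrow> u = 0)"

definition fibre_metric ::
  "('m, 'n::finite) atlas \<Rightarrow> ('m, 'v::euclidean_space) trivs \<Rightarrow> ('m \<Rightarrow> 'v \<Rightarrow> 'v \<Rightarrow> real) \<Rightarrow> bool"
  where
  "fibre_metric A T m \<longleftrightarrow>
     (\<forall>x. bilinear (m x) \<and> (\<forall>u v. m x u v = m x v u) \<and> nondegenerate (m x)) \<and>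
     (\<forall>s t. smooth_section A T s \<and> smooth_section A T t \<longrightarrow> smooth_fun A (\<lambda>x. m x (s x) (t x)))"

definition endo_trace :: "('v::euclidean_space \<Rightarrow> 'v) \<Rightarrow> real" where
  "endo_trace L = (\<Sum>b\<in>Basis. L b \<bullet> b)"

text \<open>For \<open>b \<in> Basis\<close>, \<open>dual_vec m b\<close> is the corresponding member of the \<open>m\<close>-dual basis.\<close>

definition dual_vec :: "('v::euclidean_space \<Rightarrow> 'v \<Rightarrow> real) \<Rightarrow> 'v \<Rightarrow> 'v" where
  "dual_vec m b = (THE w. \<forall>c\<in>Basis. m w c = (if c = b then 1 else 0))"

definition metric_trace :: "('v::euclidean_space \<Rightarrow> 'v \<Rightarrow> real) \<Rightarrow> ('v \<Rightarrow> 'v \<Rightarrow> real) \<Rightarrow> real" where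
  "metric_trace m B = (\<Sum>b\<in>Basis. B b (dual_vec m b))"

section \<open>Tangent bundle and tensor calculus on the base\<close>

text \<open>The tangent space at \<open>x\<close> is \<open>\<real>\<^sup>d\<close>, a tangent vector being given by its components in a
  chart chosen around \<open>x\<close>. With this identification \<open>tderiv A x \<xi> f\<close> is the derivative \<open>df\<^sub>x(\<xi>)\<close>,
  and a chart trivialises the tangent bundle by its differential.\<close>

definition chart_at :: "('m, 'n::finite) atlas \<Rightarrow> 'm \<Rightarrow> ('m, 'n) chart" where
  "chart_at A x = (SOME c. c \<in> A \<and> x \<in> fst c)"

definition tderiv ::
  "('m, 'n::finite) atlas \<Rightarrow> 'm \<Rightarrow> real ^ 'n \<Rightarrow> ('m \<Rightarrow> 'b::real_normed_vector) \<Rightarrow> 'b" where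
  "tderiv A x \<xi> f =
     (let (U, \<phi>) = chart_at A x in frechet_derivative (f \<circ> inv_into U \<phi>) (at (\<phi> x)) \<xi>)"

definition tangent_trivs :: "('m, 'n::finite) atlas \<Rightarrow> ('m, real ^ 'n) trivs" where
  "tangent_trivs A = (\<lambda>(U, \<phi>). (U, \<lambda>x \<xi>. tderiv A x \<xi> \<phi>)) ` A"

abbreviation vector_field :: "('m, 'n::finite) atlas \<Rightarrow> ('m \<Rightarrow> real ^ 'n) \<Rightarrow> bool" where
  "vector_field A \<equiv> smooth_section A (tangent_trivs A)"

abbreviation vext :: "('m, 'n::finite) atlas \<Rightarrow> 'm \<Rightarrow> real ^ 'n \<Rightarrow> 'm \<Rightarrow> real ^ 'n" where
  "vext A \<equiv> ext A (tangent_trivs A)"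

definition vapply ::
  "('m, 'n::finite) atlas \<Rightarrow> ('m \<Rightarrow> real ^ 'n) \<Rightarrow> ('m \<Rightarrow> real) \<Rightarrow> 'm \<Rightarrow> real" where
  "vapply A X f x = tderiv A x (X x) f"

definition lie_bracket ::
  "('m, 'n::finite) atlas \<Rightarrow> ('m \<Rightarrow> real ^ 'n) \<Rightarrow> ('m \<Rightarrow> real ^ 'n) \<Rightarrow> 'm \<Rightarrow> real ^ 'n" where
  "lie_bracket A X Y x =
     (THE \<xi>. \<forall>f. smooth_fun A f \<longrightarrow>
        tderiv A x \<xi> f = vapply A X (vapply A Y f) x - vapply A Y (vapply A X f) x)"

definition lie_deriv_form ::
  "('m, 'n::finite) atlas \<Rightarrow> ('m \<Rightarrow> real ^ 'n) \<Rightarrow> ('m \<Rightarrow> real ^ 'n \<Rightarrow> real) \<Rightarrow>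
     'm \<Rightarrow> real ^ 'n \<Rightarrow> real" where
  "lie_deriv_form A X \<beta> x \<zeta> =
     (let Z = vext A x \<zeta> in
        vapply A X (\<lambda>y. \<beta> y (Z y)) x - \<beta> x (lie_bracket A X Z x))"

definition ext_deriv1 ::
  "('m, 'n::finite) atlas \<Rightarrow> ('m \<Rightarrow> real ^ 'n \<Rightarrow> real) \<Rightarrow> 'm \<Rightarrow> real ^ 'n \<Rightarrow> real ^ 'n \<Rightarrow> real" where
  "ext_deriv1 A \<alpha> x \<eta> \<zeta> =
     (let Y = vext A x \<eta>; Z = vext A x \<zeta> in
        vapply A Y (\<lambda>y. \<alpha> y (Z y)) x - vapply A Z (\<lambda>y. \<alpha> y (Y y)) x
          - \<alpha> x (lie_bracket A Y Z x))"

definition three_form ::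
  "('m, 'n::finite) atlas \<Rightarrow> ('m \<Rightarrow> real ^ 'n \<Rightarrow> real ^ 'n \<Rightarrow> real ^ 'n \<Rightarrow> real) \<Rightarrow> bool" where
  "three_form A H \<longleftrightarrow>
     (\<forall>x a b. linear (\<lambda>c. H x a b c) \<and> linear (\<lambda>c. H x a c b) \<and> linear (\<lambda>c. H x c a b)) \<and>
     (\<forall>x a b. H x a a b = 0 \<and> H x a b b = 0 \<and> H x a b a = 0) \<and>
     (\<forall>X Y Z. vector_field A X \<and> vector_field A Y \<and> vector_field A Z \<longrightarrow>
        smooth_fun A (\<lambda>x. H x (X x) (Y x) (Z x)))"

definition closed_three_form ::
  "('m, 'n::finite) atlas \<Rightarrow> ('m \<Rightarrow> real ^ 'n \<Rightarrow> real ^ 'n \<Rightarrow> real ^ 'n \<Rightarrow> real) \<Rightarrow> bool" where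
  "closed_three_form A H \<longleftrightarrow> three_form A H \<and>
     (\<forall>W X Y Z x. vector_field A W \<and> vector_field A X \<and> vector_field A Y \<and> vector_field A Z \<longrightarrow>
        vapply A W (\<lambda>y. H y (X y) (Y y) (Z y)) x - vapply A X (\<lambda>y. H y (W y) (Y y) (Z y)) x
        + vapply A Y (\<lambda>y. H y (W y) (X y) (Z y)) x - vapply A Z (\<lambda>y. H y (W y) (X y) (Y y)) x
        - H x (lie_bracket A W X x) (Y x) (Z x) + H x (lie_bracket A W Y x) (X x) (Z x)
        - H x (lie_bracket A W Z x) (X x) (Y x) - H x (lie_bracket A X Y x) (W x) (Z x)
        + H x (lie_bracket A X Z x) (W x) (Y x) - H x (lie_bracket A Y Z x) (W x) (X x) = 0)"

definition form_norm2 ::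
  "('m \<Rightarrow> real ^ 'n \<Rightarrow> real ^ 'n \<Rightarrow> real) \<Rightarrow>
     ('m \<Rightarrow> real ^ 'n \<Rightarrow> real ^ 'n \<Rightarrow> real ^ 'n \<Rightarrow> real) \<Rightarrow> 'm \<Rightarrow> real" where
  "form_norm2 g H x =
     (\<Sum>a\<in>Basis. \<Sum>b\<in>Basis. \<Sum>c\<in>Basis.
        H x a b c * H x (dual_vec (g x) a) (dual_vec (g x) b) (dual_vec (g x) c))"

definition levi_civita ::
  "('m, 'n::finite) atlas \<Rightarrow> ('m \<Rightarrow> real ^ 'n \<Rightarrow> real ^ 'n \<Rightarrow> real) \<Rightarrow>
     (('m \<Rightarrow> real ^ 'n) \<Rightarrow> ('m \<Rightarrow> real ^ 'n) \<Rightarrow> 'm \<Rightarrow> real ^ 'n) \<Rightarrow> bool" where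
  "levi_civita A g nabla \<longleftrightarrow>
     (\<forall>X Y. vector_field A X \<and> vector_field A Y \<longrightarrow> vector_field A (nabla X Y)) \<and>
     (\<forall>X X' Y. vector_field A X \<and> vector_field A X' \<and> vector_field A Y \<longrightarrow>
        nabla (\<lambda>x. X x + X' x) Y = (\<lambda>x. nabla X Y x + nabla X' Y x) \<and>
        nabla Y (\<lambda>x. X x + X' x) = (\<lambda>x. nabla Y X x + nabla Y X' x)) \<and>
     (\<forall>f X Y. smooth_fun A f \<and> vector_field A X \<and> vector_field A Y \<longrightarrow>
        nabla (\<lambda>x. f x *\<^sub>R X x) Y = (\<lambda>x. f x *\<^sub>R nabla X Y x) \<and>
        nabla X (\<lambda>x. f x *\<^sub>R Y x) = (\<lambda>x. vapply A X f x *\<^sub>R Y x + f x *\<^sub>R nabla X Y x)) \<and>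
     (\<forall>X Y. vector_field A X \<and> vector_field A Y \<longrightarrow>
        (\<lambda>x. nabla X Y x - nabla Y X x) = lie_bracket A X Y) \<and>
     (\<forall>X Y Z. vector_field A X \<and> vector_field A Y \<and> vector_field A Z \<longrightarrow>
        vapply A X (\<lambda>x. g x (Y x) (Z x)) =
          (\<lambda>x. g x (nabla X Y x) (Z x) + g x (Y x) (nabla X Z x)))"

definition vdiv ::
  "('m, 'n::finite) atlas \<Rightarrow> (('m \<Rightarrow> real ^ 'n) \<Rightarrow> ('m \<Rightarrow> real ^ 'n) \<Rightarrow> 'm \<Rightarrow> real ^ 'n) \<Rightarrow>
     ('m \<Rightarrow> real ^ 'n) \<Rightarrow> 'm \<Rightarrow> real" where
  "vdiv A nabla X x = endo_trace (\<lambda>\<eta>. nabla (vext A x \<eta>) X x)"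

definition riemann ::
  "('m, 'n::finite) atlas \<Rightarrow> (('m \<Rightarrow> real ^ 'n) \<Rightarrow> ('m \<Rightarrow> real ^ 'n) \<Rightarrow> 'm \<Rightarrow> real ^ 'n) \<Rightarrow>
     ('m \<Rightarrow> real ^ 'n) \<Rightarrow> ('m \<Rightarrow> real ^ 'n) \<Rightarrow> ('m \<Rightarrow> real ^ 'n) \<Rightarrow> 'm \<Rightarrow> real ^ 'n" where
  "riemann A nabla X Y Z x =
     nabla X (nabla Y Z) x - nabla Y (nabla X Z) x - nabla (lie_bracket A X Y) Z x"

definition ricci ::
  "('m, 'n::finite) atlas \<Rightarrow> (('m \<Rightarrow> real ^ 'n) \<Rightarrow> ('m \<Rightarrow> real ^ 'n) \<Rightarrow> 'm \<Rightarrow> real ^ 'n) \<Rightarrow>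
     ('m \<Rightarrow> real ^ 'n) \<Rightarrow> ('m \<Rightarrow> real ^ 'n) \<Rightarrow> 'm \<Rightarrow> real" where
  "ricci A nabla Y Z x = endo_trace (\<lambda>\<xi>. riemann A nabla (vext A x \<xi>) Y Z x)"

definition scalar_curvature ::
  "('m, 'n::finite) atlas \<Rightarrow> ('m \<Rightarrow> real ^ 'n \<Rightarrow> real ^ 'n \<Rightarrow> real) \<Rightarrow>
     (('m \<Rightarrow> real ^ 'n) \<Rightarrow> ('m \<Rightarrow> real ^ 'n) \<Rightarrow> 'm \<Rightarrow> real ^ 'n) \<Rightarrow> 'm \<Rightarrow> real" where
  "scalar_curvature A g nabla x =
     metric_trace (g x) (\<lambda>\<eta> \<zeta>. ricci A nabla (vext A x \<eta>) (vext A x \<zeta>) x)"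

section \<open>Exact Courant algebroids\<close>

record ('m, 'n::finite, 'v) courant =
  atlas :: "('m, 'n) atlas"
  trivs :: "('m, 'v) trivs"
  pairing :: "'m \<Rightarrow> 'v \<Rightarrow> 'v \<Rightarrow> real"
  anchor :: "'m \<Rightarrow> 'v \<Rightarrow> real ^ 'n"
  bracket :: "('m \<Rightarrow> 'v) \<Rightarrow> ('m \<Rightarrow> 'v) \<Rightarrow> 'm \<Rightarrow> 'v"

abbreviation sec :: "('m, 'n::finite, 'v::euclidean_space) courant \<Rightarrow> ('m \<Rightarrow> 'v) \<Rightarrow> bool" where
  "sec C \<equiv> smooth_section (atlas C) (trivs C)"

abbreviation sext ::
  "('m, 'n::finite, 'v::euclidean_space) courant \<Rightarrow> 'm \<Rightarrow> 'v \<Rightarrow> 'm \<Rightarrow> 'v" where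
  "sext C \<equiv> ext (atlas C) (trivs C)"

abbreviation ip ::
  "('m, 'n::finite, 'v) courant \<Rightarrow> ('m \<Rightarrow> 'v) \<Rightarrow> ('m \<Rightarrow> 'v) \<Rightarrow> 'm \<Rightarrow> real" where
  "ip C u v \<equiv> (\<lambda>x. pairing C x (u x) (v x))"

abbreviation anc :: "('m, 'n::finite, 'v) courant \<Rightarrow> ('m \<Rightarrow> 'v) \<Rightarrow> 'm \<Rightarrow> real ^ 'n" where
  "anc C u \<equiv> (\<lambda>x. anchor C x (u x))"

text \<open>The anchor \<open>\<pi>\<close> acting on functions: \<open>\<pi>(u) f\<close>.\<close>

abbreviation act ::
  "('m, 'n::finite, 'v) courant \<Rightarrow> ('m \<Rightarrow> 'v) \<Rightarrow> ('m \<Rightarrow> real) \<Rightarrow> 'm \<Rightarrow> real" where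
  "act C u \<equiv> vapply (atlas C) (anc C u)"

definition courant_algebroid ::
  "('m::{t2_space,second_countable_topology}, 'n::finite, 'v::euclidean_space) courant \<Rightarrow> bool"
  where
  "courant_algebroid C \<longleftrightarrow>
     smooth_atlas (atlas C) \<and> vector_bundle (atlas C) (trivs C) \<and>
     fibre_metric (atlas C) (trivs C) (pairing C) \<and>
     (\<forall>x. linear (anchor C x)) \<and>
     (\<forall>u. sec C u \<longrightarrow> vector_field (atlas C) (anc C u)) \<and>
     (\<forall>u v. sec C u \<and> sec C v \<longrightarrow> sec C (bracket C u v)) \<and>
     (\<forall>u v w. sec C u \<and> sec C v \<and> sec C w \<longrightarrow>
        bracket C (\<lambda>x. u x + v x) w = (\<lambda>x. bracket C u w x + bracket C v w x) \<and>
        bracket C w (\<lambda>x. u x + v x) = (\<lambda>x. bracket C w u x + bracket C w v x)) \<and>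
     (\<forall>r u v. sec C u \<and> sec C v \<longrightarrow>
        bracket C (\<lambda>x. r *\<^sub>R u x) v = (\<lambda>x. r *\<^sub>R bracket C u v x) \<and>
        bracket C u (\<lambda>x. r *\<^sub>R v x) = (\<lambda>x. r *\<^sub>R bracket C u v x)) \<and>
     (\<forall>u v w. sec C u \<and> sec C v \<and> sec C w \<longrightarrow>
        bracket C u (bracket C v w) =
          (\<lambda>x. bracket C (bracket C u v) w x + bracket C v (bracket C u w) x)) \<and>
     (\<forall>u v. sec C u \<and> sec C v \<longrightarrow>
        anc C (bracket C u v) = lie_bracket (atlas C) (anc C u) (anc C v)) \<and>
     (\<forall>f u v. smooth_fun (atlas C) f \<and> sec C u \<and> sec C v \<longrightarrow>
        bracket C u (\<lambda>x. f x *\<^sub>R v x) =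
          (\<lambda>x. act C u f x *\<^sub>R v x + f x *\<^sub>R bracket C u v x)) \<and>
     (\<forall>u v w. sec C u \<and> sec C v \<and> sec C w \<longrightarrow>
        act C u (ip C v w) = (\<lambda>x. ip C (bracket C u v) w x + ip C v (bracket C u w) x)) \<and>
     (\<forall>u v w. sec C u \<and> sec C v \<and> sec C w \<longrightarrow>
        act C w (ip C u v) = (\<lambda>x. ip C (bracket C u v) w x + ip C (bracket C v u) w x))"

text \<open>The inclusion \<open>T\<^sup>*M \<rightarrow> E\<close> is normalised as in \<open>TM \<oplus> T\<^sup>*M\<close> with scalar product
  \<open>\<langle>X + \<xi>, Y + \<zeta>\<rangle> = (\<xi>(Y) + \<zeta>(X)) / 2\<close>.\<close>

definition cotangent_incl ::
  "('m, 'n::finite, 'v::euclidean_space) courant \<Rightarrow> 'm \<Rightarrow> (real ^ 'n \<Rightarrow> real) \<Rightarrow> 'v" where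
  "cotangent_incl C x \<alpha> = (THE a. \<forall>v. pairing C x a v = \<alpha> (anchor C x v) / 2)"

definition exact_courant_algebroid ::
  "('m::{t2_space,second_countable_topology}, 'n::finite, 'v::euclidean_space) courant \<Rightarrow> bool"
  where
  "exact_courant_algebroid C \<longleftrightarrow> courant_algebroid C \<and>
     (\<forall>x. inj_on (cotangent_incl C x) {\<alpha>. linear \<alpha>} \<and>
          cotangent_incl C x ` {\<alpha>. linear \<alpha>} = {a. anchor C x a = 0} \<and>
          surj (anchor C x))"

section \<open>Generalised metrics\<close>

definition gEnd ::
  "('m, 'n::finite, 'v::euclidean_space) courant \<Rightarrow> ('m \<Rightarrow> 'v \<Rightarrow> 'v \<Rightarrow> real) \<Rightarrow> 'm \<Rightarrow> 'v \<Rightarrow> 'v" where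
  "gEnd C G x u = (THE w. \<forall>v. pairing C x w v = G x u v)"

text \<open>By exactness the image of \<open>T\<^sup>*M\<close> in \<open>E\<close> is the kernel of the anchor.\<close>

definition generalised_metric ::
  "('m, 'n::finite, 'v::euclidean_space) courant \<Rightarrow> ('m \<Rightarrow> 'v \<Rightarrow> 'v \<Rightarrow> real) \<Rightarrow> bool" where
  "generalised_metric C G \<longleftrightarrow> fibre_metric (atlas C) (trivs C) G \<and>
     (\<forall>x u. gEnd C G x (gEnd C G x u) = u) \<and>
     (\<forall>x a. anchor C x a = 0 \<and> (\<forall>b. anchor C x b = 0 \<longrightarrow> G x a b = 0) \<longrightarrow> a = 0)"

text \<open>The sign \<open>\<sigma>\<close> is \<open>1\<close> or \<open>-1\<close>: \<open>eigenbundle C G \<sigma> x\<close> is the fibre of \<open>E\<^sub>+\<close> or \<open>E\<^sub>-\<close>,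
  \<open>gproj C G \<sigma>\<close> the projection onto it, and \<open>lift C G \<sigma>\<close> the inverse of the restriction
  of the anchor to it.\<close>

definition eigenbundle ::
  "('m, 'n::finite, 'v::euclidean_space) courant \<Rightarrow> ('m \<Rightarrow> 'v \<Rightarrow> 'v \<Rightarrow> real) \<Rightarrow>
     real \<Rightarrow> 'm \<Rightarrow> 'v set" where
  "eigenbundle C G \<sigma> x = {u. gEnd C G x u = \<sigma> *\<^sub>R u}"

definition gproj ::
  "('m, 'n::finite, 'v::euclidean_space) courant \<Rightarrow> ('m \<Rightarrow> 'v \<Rightarrow> 'v \<Rightarrow> real) \<Rightarrow>
     real \<Rightarrow> ('m \<Rightarrow> 'v) \<Rightarrow> 'm \<Rightarrow> 'v" where
  "gproj C G \<sigma> u x = (1 / 2) *\<^sub>R (u x + \<sigma> *\<^sub>R gEnd C G x (u x))"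

definition lift ::
  "('m, 'n::finite, 'v::euclidean_space) courant \<Rightarrow> ('m \<Rightarrow> 'v \<Rightarrow> 'v \<Rightarrow> real) \<Rightarrow>
     real \<Rightarrow> ('m \<Rightarrow> real ^ 'n) \<Rightarrow> 'm \<Rightarrow> 'v" where
  "lift C G \<sigma> X x = inv_into (eigenbundle C G \<sigma> x) (anchor C x) (X x)"

definition induced_metric ::
  "('m, 'n::finite, 'v::euclidean_space) courant \<Rightarrow> ('m \<Rightarrow> 'v \<Rightarrow> 'v \<Rightarrow> real) \<Rightarrow>
     ('m \<Rightarrow> real ^ 'n \<Rightarrow> real ^ 'n \<Rightarrow> real) \<Rightarrow> bool" where
  "induced_metric C G g \<longleftrightarrow> fibre_metric (atlas C) (tangent_trivs (atlas C)) g \<and>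
     (\<forall>x. \<forall>\<sigma>\<in>{1, -1}. \<forall>u\<in>eigenbundle C G \<sigma> x. \<forall>v\<in>eigenbundle C G \<sigma> x.
        g x (anchor C x u) (anchor C x v) = G x u v)"

text \<open>Sections of \<open>TM \<oplus> T\<^sup>*M\<close> are represented by functions into pairs of a vector and a covector;
  \<open>phi\<close> is the isomorphism \<open>\<phi>\<close> of \<open>E\<close> onto \<open>TM \<oplus> T\<^sup>*M\<close> that is \<open>(1 \<plusminus> g) \<circ> \<pi>\<close> on \<open>E\<^sub>\<plusminus>\<close>.\<close>

definition phi ::
  "('m, 'n::finite, 'v::euclidean_space) courant \<Rightarrow> ('m \<Rightarrow> 'v \<Rightarrow> 'v \<Rightarrow> real) \<Rightarrow>
     ('m \<Rightarrow> real ^ 'n \<Rightarrow> real ^ 'n \<Rightarrow> real) \<Rightarrow> ('m \<Rightarrow> 'v) \<Rightarrow>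
     'm \<Rightarrow> (real ^ 'n) \<times> (real ^ 'n \<Rightarrow> real)" where
  "phi C G g u x =
     (anc C u x, \<lambda>\<zeta>. g x (anc C (gproj C G 1 u) x) \<zeta> - g x (anc C (gproj C G (-1) u) x) \<zeta>)"

definition twisted_bracket ::
  "('m, 'n::finite) atlas \<Rightarrow> ('m \<Rightarrow> real ^ 'n \<Rightarrow> real ^ 'n \<Rightarrow> real ^ 'n \<Rightarrow> real) \<Rightarrow>
     ('m \<Rightarrow> (real ^ 'n) \<times> (real ^ 'n \<Rightarrow> real)) \<Rightarrow> ('m \<Rightarrow> (real ^ 'n) \<times> (real ^ 'n \<Rightarrow> real)) \<Rightarrow>
     'm \<Rightarrow> (real ^ 'n) \<times> (real ^ 'n \<Rightarrow> real)" where
  "twisted_bracket A H U V x =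
     (let X = fst \<circ> U; \<alpha> = snd \<circ> U; Y = fst \<circ> V; \<beta> = snd \<circ> V in
      (lie_bracket A X Y x,
       \<lambda>\<zeta>. lie_deriv_form A X \<beta> x \<zeta> - ext_deriv1 A \<alpha> x (Y x) \<zeta> + H x (X x) (Y x) \<zeta>))"

text \<open>The closed three-form \<open>H\<close> for which \<open>\<phi>\<close> is an isomorphism onto \<open>TM \<oplus> T\<^sup>*M\<close> with the
  \<open>H\<close>-twisted bracket. It is uniquely determined by this; that \<open>\<phi>\<close> is bijective and respects
  anchors and scalar products follows from its definition.\<close>

definition courant_three_form ::
  "('m, 'n::finite, 'v::euclidean_space) courant \<Rightarrow> ('m \<Rightarrow> 'v \<Rightarrow> 'v \<Rightarrow> real) \<Rightarrow>
     ('m \<Rightarrow> real ^ 'n \<Rightarrow> real ^ 'n \<Rightarrow> real) \<Rightarrow>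
     ('m \<Rightarrow> real ^ 'n \<Rightarrow> real ^ 'n \<Rightarrow> real ^ 'n \<Rightarrow> real) \<Rightarrow> bool" where
  "courant_three_form C G g H \<longleftrightarrow> closed_three_form (atlas C) H \<and>
     (\<forall>u v. sec C u \<and> sec C v \<longrightarrow>
        phi C G g (bracket C u v) = twisted_bracket (atlas C) H (phi C G g u) (phi C G g v))"

section \<open>Generalised connections and divergence operators\<close>

type_synonym ('m, 'v) gconn = "('m \<Rightarrow> 'v) \<Rightarrow> ('m \<Rightarrow> 'v) \<Rightarrow> 'm \<Rightarrow> 'v"

definition generalised_connection ::
  "('m, 'n::finite, 'v::euclidean_space) courant \<Rightarrow> ('m, 'v) gconn \<Rightarrow> bool" where
  "generalised_connection C D \<longleftrightarrow>
     (\<forall>u v. sec C u \<and> sec C v \<longrightarrow> sec C (D u v)) \<and>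
     (\<forall>u v w. sec C u \<and> sec C v \<and> sec C w \<longrightarrow>
        D (\<lambda>x. u x + v x) w = (\<lambda>x. D u w x + D v w x) \<and>
        D w (\<lambda>x. u x + v x) = (\<lambda>x. D w u x + D w v x)) \<and>
     (\<forall>f u v. smooth_fun (atlas C) f \<and> sec C u \<and> sec C v \<longrightarrow>
        D (\<lambda>x. f x *\<^sub>R u x) v = (\<lambda>x. f x *\<^sub>R D u v x) \<and>
        D u (\<lambda>x. f x *\<^sub>R v x) = (\<lambda>x. act C u f x *\<^sub>R v x + f x *\<^sub>R D u v x)) \<and>
     (\<forall>u v w. sec C u \<and> sec C v \<and> sec C w \<longrightarrow>
        act C u (ip C v w) = (\<lambda>x. ip C (D u v) w x + ip C v (D u w) x))"

definition torsion ::
  "('m, 'n::finite, 'v::euclidean_space) courant \<Rightarrow> ('m, 'v) gconn \<Rightarrow>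
     ('m \<Rightarrow> 'v) \<Rightarrow> ('m \<Rightarrow> 'v) \<Rightarrow> ('m \<Rightarrow> 'v) \<Rightarrow> 'm \<Rightarrow> real" where
  "torsion C D u v w x =
     ip C (\<lambda>y. D u v y - D v u y - bracket C u v y) w x + ip C (D w u) v x"

definition generalised_levi_civita ::
  "('m, 'n::finite, 'v::euclidean_space) courant \<Rightarrow> ('m \<Rightarrow> 'v \<Rightarrow> 'v \<Rightarrow> real) \<Rightarrow>
     ('m, 'v) gconn \<Rightarrow> bool" where
  "generalised_levi_civita C G D \<longleftrightarrow> generalised_connection C D \<and>
     (\<forall>u v w. sec C u \<and> sec C v \<and> sec C w \<longrightarrow>
        act C u (\<lambda>x. G x (v x) (w x)) = (\<lambda>x. G x (D u v x) (w x) + G x (v x) (D u w x))) \<and>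
     (\<forall>u v w x. sec C u \<and> sec C v \<and> sec C w \<longrightarrow> torsion C D u v w x = 0)"

definition divergence_operator ::
  "('m, 'n::finite, 'v::euclidean_space) courant \<Rightarrow> (('m \<Rightarrow> 'v) \<Rightarrow> 'm \<Rightarrow> real) \<Rightarrow> bool" where
  "divergence_operator C dv \<longleftrightarrow>
     (\<forall>v. sec C v \<longrightarrow> smooth_fun (atlas C) (dv v)) \<and>
     (\<forall>v w. sec C v \<and> sec C w \<longrightarrow> dv (\<lambda>x. v x + w x) = (\<lambda>x. dv v x + dv w x)) \<and>
     (\<forall>r v. sec C v \<longrightarrow> dv (\<lambda>x. r *\<^sub>R v x) = (\<lambda>x. r * dv v x)) \<and>
     (\<forall>f v. smooth_fun (atlas C) f \<and> sec C v \<longrightarrow>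
        dv (\<lambda>x. f x *\<^sub>R v x) = (\<lambda>x. act C v f x + f x * dv v x))"

definition conn_div ::
  "('m, 'n::finite, 'v::euclidean_space) courant \<Rightarrow> ('m, 'v) gconn \<Rightarrow> ('m \<Rightarrow> 'v) \<Rightarrow> 'm \<Rightarrow> real"
  where
  "conn_div C D v x = endo_trace (\<lambda>p. D (sext C x p) v x)"

definition metric_div ::
  "('m, 'n::finite, 'v) courant \<Rightarrow> (('m \<Rightarrow> real ^ 'n) \<Rightarrow> ('m \<Rightarrow> real ^ 'n) \<Rightarrow> 'm \<Rightarrow> real ^ 'n) \<Rightarrow>
     ('m \<Rightarrow> 'v) \<Rightarrow> 'm \<Rightarrow> real" where
  "metric_div C nabla v = vdiv (atlas C) nabla (anc C v)"

section \<open>The canonical generalised Levi-Civita connection\<close>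

definition Dtilde ::
  "('m, 'n::finite, 'v::euclidean_space) courant \<Rightarrow> ('m \<Rightarrow> 'v \<Rightarrow> 'v \<Rightarrow> real) \<Rightarrow>
     (('m \<Rightarrow> real ^ 'n) \<Rightarrow> ('m \<Rightarrow> real ^ 'n) \<Rightarrow> 'm \<Rightarrow> real ^ 'n) \<Rightarrow> ('m, 'v) gconn" where
  "Dtilde C G nabla u v x =
     (\<Sum>\<sigma>\<in>{1, -1}.
        lift C G \<sigma> (nabla (anc C (gproj C G \<sigma> u)) (anc C (gproj C G \<sigma> v))) x +
        gproj C G \<sigma> (bracket C (gproj C G (- \<sigma>) u) (gproj C G \<sigma> v)) x)"

definition Dzero ::
  "('m, 'n::finite, 'v::euclidean_space) courant \<Rightarrow> ('m \<Rightarrow> 'v \<Rightarrow> 'v \<Rightarrow> real) \<Rightarrow>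
     (('m \<Rightarrow> real ^ 'n) \<Rightarrow> ('m \<Rightarrow> real ^ 'n) \<Rightarrow> 'm \<Rightarrow> real ^ 'n) \<Rightarrow> ('m, 'v) gconn" where
  "Dzero C G nabla u v x =
     (THE a. \<forall>w. sec C w \<longrightarrow>
        pairing C x a (w x) =
          ip C (Dtilde C G nabla u v) w x - torsion C (Dtilde C G nabla) u v w x / 3)"

text \<open>The fibre over \<open>x\<close> of the kernel of the trace map on the bundle of those \<open>S \<in> E\<^sup>* \<otimes> so(E)\<close> which
  preserve \<open>E\<^sub>\<plusminus>\<close> and have vanishing cyclic sum; \<open>S a b\<close> stands for \<open>S\<^sub>a b\<close>.\<close>

definition trace_kernel ::
  "('m, 'n::finite, 'v::euclidean_space) courant \<Rightarrow> ('m \<Rightarrow> 'v \<Rightarrow> 'v \<Rightarrow> real) \<Rightarrow> 'm \<Rightarrow>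
     ('v \<Rightarrow> 'v \<Rightarrow> 'v) set" where
  "trace_kernel C G x =
     {S. bilinear S \<and>
         (\<forall>a b c. pairing C x (S a b) c + pairing C x b (S a c) = 0) \<and>
         (\<forall>a. \<forall>\<sigma>\<in>{1, -1}. S a ` eigenbundle C G \<sigma> x \<subseteq> eigenbundle C G \<sigma> x) \<and>
         (\<forall>a b c. pairing C x (S a b) c + pairing C x (S b c) a + pairing C x (S c a) b = 0) \<and>
         (\<forall>b. endo_trace (\<lambda>a. S a b) = 0)}"

definition tensor_ip ::
  "('v::euclidean_space \<Rightarrow> 'v \<Rightarrow> real) \<Rightarrow> ('v \<Rightarrow> 'v \<Rightarrow> 'v) \<Rightarrow> ('v \<Rightarrow> 'v \<Rightarrow> 'v) \<Rightarrow> real" where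
  "tensor_ip m S S' =
     (\<Sum>a\<in>Basis. \<Sum>b\<in>Basis. m (S a b) (S' (dual_vec m a) (dual_vec m b)))"

definition canonical_connection ::
  "('m, 'n::finite, 'v::euclidean_space) courant \<Rightarrow> ('m \<Rightarrow> 'v \<Rightarrow> 'v \<Rightarrow> real) \<Rightarrow>
     (('m \<Rightarrow> real ^ 'n) \<Rightarrow> ('m \<Rightarrow> real ^ 'n) \<Rightarrow> 'm \<Rightarrow> real ^ 'n) \<Rightarrow>
     (('m \<Rightarrow> 'v) \<Rightarrow> 'm \<Rightarrow> real) \<Rightarrow> ('m, 'v) gconn \<Rightarrow> bool" where
  "canonical_connection C G nabla dv D \<longleftrightarrow>
     generalised_levi_civita C G D \<and>
     (\<forall>v. sec C v \<longrightarrow> conn_div C D v = dv v) \<and>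
     (\<forall>x. \<forall>S\<in>trace_kernel C G x.
        tensor_ip (pairing C x)
          (\<lambda>a b. D (sext C x a) (sext C x b) x - Dzero C G nabla (sext C x a) (sext C x b) x) S = 0)"

section \<open>Generalised curvature\<close>

definition D2 ::
  "('m, 'v) gconn \<Rightarrow> ('m \<Rightarrow> 'v) \<Rightarrow> ('m \<Rightarrow> 'v) \<Rightarrow> ('m \<Rightarrow> 'v) \<Rightarrow> 'm \<Rightarrow> 'v::euclidean_space" where
  "D2 D v w b x = D v (D w b) x - D (D v w) b x"

definition gen_riemann ::
  "('m, 'n::finite, 'v::euclidean_space) courant \<Rightarrow> ('m, 'v) gconn \<Rightarrow>
     ('m \<Rightarrow> 'v) \<Rightarrow> ('m \<Rightarrow> 'v) \<Rightarrow> ('m \<Rightarrow> 'v) \<Rightarrow> ('m \<Rightarrow> 'v) \<Rightarrow> 'm \<Rightarrow> real" where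
  "gen_riemann C D a b v w x =
     (1 / 2) *
     (pairing C x (D2 D v w b x - D2 D w v b x) (a x)
      + pairing C x (D2 D b a v x - D2 D a b v x) (w x)
      - metric_trace (pairing C x)
          (\<lambda>p q. ip C (D (sext C x p) v) w x * ip C (D (sext C x q) b) a x))"

definition gen_ricci ::
  "('m, 'n::finite, 'v::euclidean_space) courant \<Rightarrow> ('m, 'v) gconn \<Rightarrow>
     ('m \<Rightarrow> 'v) \<Rightarrow> ('m \<Rightarrow> 'v) \<Rightarrow> 'm \<Rightarrow> real" where
  "gen_ricci C D a b x =
     metric_trace (pairing C x) (\<lambda>p q. gen_riemann C D (sext C x p) a (sext C x q) b x)"

definition gen_scalar ::
  "('m, 'n::finite, 'v::euclidean_space) courant \<Rightarrow> ('m \<Rightarrow> 'v \<Rightarrow> 'v \<Rightarrow> real) \<Rightarrow>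
     ('m, 'v) gconn \<Rightarrow> 'm \<Rightarrow> real" where
  "gen_scalar C G D x =
     (1 / 2) * metric_trace (G x) (\<lambda>p q. gen_ricci C D (sext C x p) (sext C x q) x)"

end

theory Submission
  imports Defs
begin

text \<open>The anchor identifies each eigenbundle \<open>E\<^sub>\<sigma>\<close> of a generalised metric with \<open>TM\<close>. Since a generalised
  Levi-Civita connection \<open>D\<close> preserves \<open>E\<^sub>+\<close> and \<open>E\<^sub>-\<close>, the generalised Riemann tensor vanishes on
  arguments \<open>(E\<^sub>+, E\<^sub>-, E\<^sub>+, E\<^sub>-)\<close>, and the generalised scalar curvature is half the difference of the
  double traces of that tensor over \<open>E\<^sub>+\<close> and over \<open>E\<^sub>-\<close>. Along \<open>E\<^sub>\<sigma>\<close> the connection acts on \<open>E\<^sub>\<sigma>\<close> as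
  \<open>\<nabla> + S\<close>, where \<open>S\<close> is skew and, by vanishing torsion, has cyclic sum \<open>h = \<sigma> H / 2\<close>; along the other
  eigenbundle it acts on \<open>E\<^sub>\<sigma>\<close> as \<open>\<nabla> + h\<close>. In twice the double trace the derivatives of \<open>S\<close> contribute \<open>4\<close> times
  the divergence of the trace \<open>\<tau>\<close> of \<open>S\<close>, and the quadratic terms are \<open>- 2 |\<tau>|\<^sup>2\<close> together with
  \<open>|S|\<^sup>2 + 2 \<langle>S, S'\<rangle> - |h|\<^sup>2\<close>, where \<open>S'\<close> is \<open>S\<close> with its arguments rotated. As
  \<open>|h|\<^sup>2 = 3 |S|\<^sup>2 + 6 \<langle>S, S'\<rangle>\<close>, the latter is \<open>- 2/3 |h|\<^sup>2\<close>. Finally the divergence of \<open>D\<close>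
  prescribes \<open>\<tau> = \<sigma> \<pi> e\<^sub>\<sigma>\<close>.\<close>

section \<open>Smooth functions on Euclidean space\<close>

text \<open>The fibres over distinct points are unrelated copies of one vector space, and a tensor
  is evaluated on vectors through arbitrarily chosen sections, so every pointwise statement passes
  through tensoriality. For the generalised Riemann tensor this is delicate: neither the commutator
  of second derivatives nor the trace term is tensorial alone; vanishing torsion makes their defects
  cancel. The same mechanism drives the curvature computation. The trace over \<open>E\<close>
  enters with opposite signs on the two eigenbundles, so products of two \<nabla> terms drop out,
  and the products of \<nabla> with \<open>S - h\<close> cancel the derivatives along
  \<open>S V W - S W V\<close> left by the second derivatives. Only derivatives of \<open>S\<close>
  and algebra in \<open>S\<close> and \<open>h\<close> remain. The metrics may be indefinite, so
  frames come as smooth dual pairs, obtained by inverting a Gram matrix, and not as orthonormal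
  frames. Constants: the factor 1/2 in the Riemann tensor turns -2/3 |h|^2 into -1/3 |h|^2, which is
  -|H|^2/12 because |h|^2 = |H|^2/4. Half the sum over both signs then keeps Sc and this term, and
  leaves coefficient 1 at each div \<tau> and -1/2 at each |\<tau>|^2.\<close>

lemma Ck_on_cong:
  assumes "open S" "\<And>x. x \<in> S \<Longrightarrow> f x = g x" "Ck_on k S f"
  shows "Ck_on k S g"
  using assms(2,3)
proof (induction k arbitrary: f g)
  case 0
  then show ?case by (auto intro: continuous_on_eq)
next
  case (Suc k)
  have d: "g differentiable (at x)" if "x \<in> S" for x
  proof -
    have "f differentiable (at x)" using Suc.prems(2) that by simp
    then obtain f' where "(f has_derivative f') (at x)" by (auto simp: differentiable_def)
    then have "(g has_derivative f') (at x)"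
      by (rule has_derivative_transform_within_open[OF _ assms(1) that]) (use Suc.prems in auto)
    then show ?thesis by (auto simp: differentiable_def)
  qed
  have e: "frechet_derivative f (at x) = frechet_derivative g (at x)" if "x \<in> S" for x
    by (rule frechet_derivative_transform_within_open[OF _ assms(1) that])
      (use Suc.prems that in auto)
  show ?case
    using d e Suc.prems Suc.IH[of "\<lambda>x. frechet_derivative f (at x) v"
        "\<lambda>x. frechet_derivative g (at x) v" for v] by auto
qed

lemma Ck_on_subset: "Ck_on k S f \<Longrightarrow> T \<subseteq> S \<Longrightarrow> Ck_on k T f"
  by (induction k arbitrary: f) (auto intro: continuous_on_subset)

lemma Ck_on_SucD: "Ck_on (Suc k) S f \<Longrightarrow> Ck_on k S f"
proof (induction k arbitrary: f)
  case 0
  then show ?case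
    by (auto intro!: continuous_at_imp_continuous_on differentiable_imp_continuous_within)
next
  case (Suc k)
  then show ?case by (metis Ck_on.simps(2))
qed

lemma Ck_on_local:
  assumes "\<And>x. x \<in> S \<Longrightarrow> \<exists>T. open T \<and> x \<in> T \<and> Ck_on k T f"
  shows "Ck_on k S f"
  using assms
proof (induction k arbitrary: f)
  case 0
  show ?case
    unfolding Ck_on.simps
  proof (rule continuous_at_imp_continuous_on, rule ballI)
    fix x assume "x \<in> S"
    then obtain T where "open T" "x \<in> T" "continuous_on T f" using 0 by force
    then show "isCont f x" by (simp add: continuous_on_eq_continuous_at)
  qed
next
  case (Suc k)
  have "\<exists>T. open T \<and> x \<in> T \<and> Ck_on k T (\<lambda>x. frechet_derivative f (at x) v)" if "x \<in> S" for x v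
    using Suc.prems[OF that] by auto
  then have "Ck_on k S (\<lambda>x. frechet_derivative f (at x) v)" for v
    by (intro Suc.IH)
  moreover have "f differentiable (at x)" if "x \<in> S" for x
    using Suc.prems[OF that] by auto
  ultimately show ?case by simp
qed

lemma Ck_on_const: "Ck_on k S (\<lambda>_. c)"
  by (induction k arbitrary: c) (auto simp: frechet_derivative_const)

lemma Ck_on_linear:
  assumes L: "bounded_linear L" and "open S" "Ck_on k S f"
  shows "Ck_on k S (\<lambda>x. L (f x))"
  using assms(3)
proof (induction k arbitrary: f)
  case 0
  then show ?case by (auto intro: bounded_linear.continuous_on[OF L])
next
  case (Suc k)
  have h: "((\<lambda>x. L (f x)) has_derivative (\<lambda>v. L (frechet_derivative f (at x) v))) (at x)"
    if "x \<in> S" for x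
    using Suc.prems that frechet_derivative_works bounded_linear.has_derivative[OF L]
    by (metis Ck_on.simps(2))
  have "Ck_on k S (\<lambda>x. frechet_derivative (\<lambda>x. L (f x)) (at x) v)" for v
    by (rule Ck_on_cong[OF \<open>open S\<close> _ Suc.IH[of "\<lambda>x. frechet_derivative f (at x) v"]])
      (use h[THEN frechet_derivative_at] Suc.prems in \<open>auto dest: fun_cong\<close>)
  then show ?case using h by (auto simp: differentiable_def)
qed

lemma Ck_on_add:
  assumes "open S" "Ck_on k S f" "Ck_on k S g"
  shows "Ck_on k S (\<lambda>x. f x + g x)"
  using assms(2,3)
proof (induction k arbitrary: f g)
  case 0
  then show ?case by (auto intro: continuous_intros)
next
  case (Suc k)
  have h: "((\<lambda>x. f x + g x) has_derivative
      (\<lambda>v. frechet_derivative f (at x) v + frechet_derivative g (at x) v)) (at x)"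
    if "x \<in> S" for x
    using Suc.prems that by (auto intro!: has_derivative_add simp: frechet_derivative_works[symmetric])
  have "Ck_on k S (\<lambda>x. frechet_derivative (\<lambda>x. f x + g x) (at x) v)" for v
    by (rule Ck_on_cong[OF \<open>open S\<close> _ Suc.IH[of "\<lambda>x. frechet_derivative f (at x) v"
            "\<lambda>x. frechet_derivative g (at x) v"]])
      (use h[THEN frechet_derivative_at] Suc.prems in \<open>auto dest: fun_cong\<close>)
  then show ?case using h by (auto simp: differentiable_def)
qed

lemma Ck_on_sum:
  assumes "open S" "\<And>i. i \<in> I \<Longrightarrow> Ck_on k S (f i)"
  shows "Ck_on k S (\<lambda>x. \<Sum>i\<in>I. f i x)"
  using assms(2)
  by (induction I rule: infinite_finite_induct) (auto intro: Ck_on_const Ck_on_add[OF assms(1)])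

lemma Ck_on_bilinear:
  assumes p: "bounded_bilinear p" and "open S" "Ck_on k S f" "Ck_on k S g"
  shows "Ck_on k S (\<lambda>x. p (f x) (g x))"
  using assms(3,4)
proof (induction k arbitrary: f g)
  case 0
  then show ?case by (auto intro: bounded_bilinear.continuous_on[OF p])
next
  case (Suc k)
  have h: "((\<lambda>x. p (f x) (g x)) has_derivative
      (\<lambda>v. p (f x) (frechet_derivative g (at x) v) + p (frechet_derivative f (at x) v) (g x))) (at x)"
    if "x \<in> S" for x
    using Suc.prems that
    by (auto intro!: bounded_bilinear.FDERIV[OF p] simp: frechet_derivative_works[symmetric])
  have "Ck_on k S (\<lambda>x. frechet_derivative (\<lambda>x. p (f x) (g x)) (at x) v)" for v
    by (rule Ck_on_cong[OF \<open>open S\<close> _ Ck_on_add[OF \<open>open S\<close>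
            Suc.IH[of f "\<lambda>x. frechet_derivative g (at x) v"]
            Suc.IH[of "\<lambda>x. frechet_derivative f (at x) v" g]]])
      (use h[THEN frechet_derivative_at] Suc.prems Ck_on_SucD in \<open>auto dest: fun_cong\<close>)
  then show ?case using h by (auto simp: differentiable_def)
qed

text \<open>The chain rule yields a varying linear map applied to a varying vector. Expanding that
  vector in \<open>Basis\<close> turns it into a sum of products of a scalar with a composite of the
  original shape, to which the induction hypothesis and the product rule apply; hence the Euclidean
  domain of \<open>f\<close>.\<close>

lemma Ck_on_compose:
  fixes f :: "'b::euclidean_space \<Rightarrow> 'c::real_normed_vector"
  assumes "open S" "open T" "g ` S \<subseteq> T" "Ck_on k T f" "Ck_on k S g"
  shows "Ck_on k S (\<lambda>x. f (g x))"
  using assms(4,5)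
proof (induction k arbitrary: f)
  case 0
  then show ?case using assms(3) by (auto intro: continuous_on_compose2)
next
  case (Suc k)
  have hf: "(f has_derivative frechet_derivative f (at (g x))) (at (g x))" if "x \<in> S" for x
    using Suc.prems that assms(3) by (auto simp: frechet_derivative_works[symmetric])
  have hg: "(g has_derivative frechet_derivative g (at x)) (at x)" if "x \<in> S" for x
    using Suc.prems that assms(3) by (auto simp: frechet_derivative_works[symmetric])
  have h: "((\<lambda>x. f (g x)) has_derivative
      (\<lambda>v. frechet_derivative f (at (g x)) (frechet_derivative g (at x) v))) (at x)"
    if "x \<in> S" for x
    by (rule has_derivative_compose[OF hg hf]) (use that in auto)
  have e: "frechet_derivative (\<lambda>x. f (g x)) (at x) v =
     (\<Sum>b\<in>Basis. (frechet_derivative g (at x) v \<bullet> b) *\<^sub>R frechet_derivative f (at (g x)) b)"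
    if "x \<in> S" for x v
  proof -
    interpret linear "frechet_derivative f (at (g x))"
      using hf[OF that] has_derivative_linear by blast
    have "frechet_derivative (\<lambda>x. f (g x)) (at x) v =
        frechet_derivative f (at (g x)) (frechet_derivative g (at x) v)"
      by (rule fun_cong[OF h[OF that, THEN frechet_derivative_at, symmetric]])
    also have "\<dots> = frechet_derivative f (at (g x))
        (\<Sum>b\<in>Basis. (frechet_derivative g (at x) v \<bullet> b) *\<^sub>R b)"
      by (simp add: euclidean_representation)
    finally show ?thesis by (simp add: sum scale)
  qed
  have "Ck_on k S (\<lambda>x. frechet_derivative (\<lambda>x. f (g x)) (at x) v)" for v
  proof (rule Ck_on_cong[OF \<open>open S\<close> e[symmetric]])
    show "Ck_on k S (\<lambda>x. \<Sum>b\<in>Basis. (frechet_derivative g (at x) v \<bullet> b) *\<^sub>R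
        frechet_derivative f (at (g x)) b)"
    proof (intro Ck_on_sum[OF \<open>open S\<close>] Ck_on_bilinear[OF bounded_bilinear_scaleR \<open>open S\<close>])
      fix b :: 'b
      show "Ck_on k S (\<lambda>x. frechet_derivative g (at x) v \<bullet> b)"
        by (rule Ck_on_linear[OF bounded_linear_inner_left \<open>open S\<close>]) (use Suc.prems in auto)
      show "Ck_on k S (\<lambda>x. frechet_derivative f (at (g x)) b)"
        by (rule Suc.IH) (use Suc.prems Ck_on_SucD in auto)
    qed
  qed
  then show ?case using h by (auto simp: differentiable_def)
qed

text \<open>The derivative of \<open>inverse f\<close> is a product of the derivative of
  \<open>f\<close> with two copies of \<open>inverse f\<close>, so one order of smoothness of
  \<open>inverse f\<close> yields the next.\<close>

lemma Ck_on_inverse: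
  fixes f :: "'a::real_normed_vector \<Rightarrow> real"
  assumes "open S" "\<And>x. x \<in> S \<Longrightarrow> f x \<noteq> 0" "Ck_on k S f"
  shows "Ck_on k S (\<lambda>x. inverse (f x))"
  using assms(3)
proof (induction k)
  case 0
  then show ?case using assms(2) by (auto intro: continuous_on_inverse)
next
  case (Suc k)
  have h: "((\<lambda>x. inverse (f x)) has_derivative
      (\<lambda>v. - (inverse (f x) * frechet_derivative f (at x) v * inverse (f x)))) (at x)"
    if "x \<in> S" for x
    using Suc.prems that assms(2)
    by (intro Deriv.has_derivative_inverse) (auto simp: frechet_derivative_works[symmetric])
  have i: "Ck_on k S (\<lambda>x. inverse (f x))" by (rule Suc.IH[OF Ck_on_SucD[OF Suc.prems]])
  have "Ck_on k S (\<lambda>x. frechet_derivative (\<lambda>x. inverse (f x)) (at x) v)" for v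
  proof (rule Ck_on_cong[OF \<open>open S\<close>])
    show "Ck_on k S (\<lambda>x. - (inverse (f x) * frechet_derivative f (at x) v * inverse (f x)))"
      by (intro Ck_on_linear[OF bounded_linear_minus[OF bounded_linear_ident] \<open>open S\<close>]
          Ck_on_bilinear[OF bounded_bilinear_mult \<open>open S\<close>] i) (use Suc.prems in auto)
  qed (use h[THEN frechet_derivative_at] in \<open>auto dest: fun_cong\<close>)
  then show ?case using h by (auto simp: differentiable_def)
qed

lemma smooth_on_cong:
  "open S \<Longrightarrow> (\<And>x. x \<in> S \<Longrightarrow> f x = g x) \<Longrightarrow> smooth_on S f \<Longrightarrow> smooth_on S g"
  by (auto simp: smooth_on_def intro: Ck_on_cong)

lemma smooth_on_subset: "smooth_on S f \<Longrightarrow> T \<subseteq> S \<Longrightarrow> smooth_on T f"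
  by (auto simp: smooth_on_def intro: Ck_on_subset)

lemma smooth_on_local:
  assumes "\<And>x. x \<in> S \<Longrightarrow> \<exists>T. open T \<and> x \<in> T \<and> smooth_on T f"
  shows "smooth_on S f"
  using assms Ck_on_local unfolding smooth_on_def by metis

lemma smooth_on_const: "smooth_on S (\<lambda>_. c)"
  by (simp add: smooth_on_def Ck_on_const)

lemma smooth_on_linear:
  "bounded_linear L \<Longrightarrow> open S \<Longrightarrow> smooth_on S f \<Longrightarrow> smooth_on S (\<lambda>x. L (f x))"
  by (simp add: smooth_on_def Ck_on_linear)

lemma smooth_on_add:
  "open S \<Longrightarrow> smooth_on S f \<Longrightarrow> smooth_on S g \<Longrightarrow> smooth_on S (\<lambda>x. f x + g x)"
  by (simp add: smooth_on_def Ck_on_add)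

lemma smooth_on_bilinear:
  "bounded_bilinear p \<Longrightarrow> open S \<Longrightarrow> smooth_on S f \<Longrightarrow> smooth_on S g \<Longrightarrow>
    smooth_on S (\<lambda>x. p (f x) (g x))"
  by (simp add: smooth_on_def Ck_on_bilinear)

lemma smooth_on_compose:
  fixes f :: "'b::euclidean_space \<Rightarrow> 'c::real_normed_vector"
  shows "open S \<Longrightarrow> open T \<Longrightarrow> g ` S \<subseteq> T \<Longrightarrow> smooth_on T f \<Longrightarrow> smooth_on S g \<Longrightarrow>
    smooth_on S (\<lambda>x. f (g x))"
  by (auto simp: smooth_on_def intro: Ck_on_compose)

lemma smooth_on_inverse:
  fixes f :: "'a::real_normed_vector \<Rightarrow> real"
  shows "open S \<Longrightarrow> (\<And>x. x \<in> S \<Longrightarrow> f x \<noteq> 0) \<Longrightarrow> smooth_on S f \<Longrightarrow>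
    smooth_on S (\<lambda>x. inverse (f x))"
  by (simp add: smooth_on_def Ck_on_inverse)

lemma smooth_on_frechet_derivative:
  "smooth_on S f \<Longrightarrow> smooth_on S (\<lambda>x. frechet_derivative f (at x) v)"
  unfolding smooth_on_def by (metis Ck_on.simps(2))

lemma smooth_on_differentiable: "smooth_on S f \<Longrightarrow> x \<in> S \<Longrightarrow> f differentiable (at x)"
  unfolding smooth_on_def by (metis Ck_on.simps(2))

lemma smooth_on_has_derivative:
  "smooth_on S f \<Longrightarrow> x \<in> S \<Longrightarrow> (f has_derivative frechet_derivative f (at x)) (at x)"
  by (simp add: smooth_on_differentiable frechet_derivative_works[symmetric])

lemma smooth_on_id: "smooth_on S (\<lambda>x. x)"
proof -
  have "Ck_on k S (\<lambda>x. x)" for k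
  proof (cases k)
    case (Suc j)
    have "frechet_derivative (\<lambda>x. x) (at x) v = v" for x v :: 'a
      using frechet_derivative_at[OF has_derivative_ident] by metis
    then show ?thesis by (simp add: Suc Ck_on_const)
  qed simp
  then show ?thesis by (simp add: smooth_on_def)
qed

section \<open>Bump functions on Euclidean space\<close>

definition flat :: "nat \<Rightarrow> real \<Rightarrow> real" where
  "flat m t = (if t > 0 then (1 / t) ^ m * exp (- (1 / t)) else 0)"

text \<open>From the right, substituting the reciprocal of \<open>t\<close> compares a power with an
  exponential at infinity; from the left the function is zero.\<close>

lemma flat_tendsto_0: "(flat m \<longlongrightarrow> 0) (at 0)"
proof -
  have "((\<lambda>t::real. inverse t ^ m / exp (inverse t)) \<longlongrightarrow> 0) (at_right 0)"
    by (rule filterlim_compose[OF tendsto_power_div_exp_0 filterlim_inverse_at_top_right])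
  then have r: "(flat m \<longlongrightarrow> 0) (at_right 0)"
    by (rule Lim_transform_eventually)
      (auto simp: eventually_at_right_less flat_def exp_minus divide_simps
        intro!: eventually_mono[OF eventually_at_right_less])
  have l: "(flat m \<longlongrightarrow> 0) (at_left 0)"
    by (rule Lim_transform_eventually[OF tendsto_const])
      (auto simp: flat_def eventually_at_left_field intro!: exI[of _ "-1"])
  show ?thesis using l r by (simp add: filterlim_split_at)
qed

text \<open>The powers of \<open>1 / t\<close> are carried in \<open>flat\<close> so that the family
  is closed under differentiation; smoothness of all its members then follows by one
  induction.\<close>

lemma flat_has_derivative:
  "(flat m has_real_derivative flat (m + 2) t - real m * flat (m + 1) t) (at t)"
proof -
  consider "t > 0" | "t < 0" | "t = 0" by linarith
  then show ?thesis
  proof cases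
    case 1
    have "((\<lambda>t. (1 / t) ^ m * exp (- (1 / t))) has_real_derivative
        flat (m + 2) t - real m * flat (m + 1) t) (at t)"
    proof (cases m)
      case 0
      then show ?thesis using 1
        by (auto intro!: derivative_eq_intros simp: flat_def field_simps power2_eq_square)
    next
      case (Suc j)
      have e: "exp (- (1 / t)) \<noteq> 0" by simp
      show ?thesis using 1 unfolding Suc
        by (auto intro!: derivative_eq_intros simp: flat_def power2_eq_square divide_simps)
          (cases j; simp add: algebra_simps)
    qed
    then show ?thesis
      by (rule has_field_derivative_transform_within_open[of _ _ _ "{0<..}"])
        (use 1 in \<open>auto simp: flat_def\<close>)
  next
    case 2
    have "((\<lambda>t. 0) has_real_derivative 0) (at t)" by simp
    then have "(flat m has_real_derivative 0) (at t)"
      by (rule has_field_derivative_transform_within_open[of _ _ _ "{..<0}"])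
        (use 2 in \<open>auto simp: flat_def\<close>)
    then show ?thesis using 2 by (simp add: flat_def)
  next
    case 3
    \<comment> \<open>Dividing by \<open>h\<close> adds one power, so the difference quotient at 0
      is \<open>flat (Suc m)\<close>, which tends to 0.\<close>
    have "((\<lambda>h. (flat m (0 + h) - flat m 0) / h) \<longlongrightarrow> 0) (at 0)"
      by (rule Lim_transform_eventually[OF flat_tendsto_0[of "Suc m"]])
        (auto simp: flat_def eventually_at_filter)
    then have "(flat m has_real_derivative 0) (at 0)" by (simp add: DERIV_def)
    then show ?thesis using 3 by (simp add: flat_def)
  qed
qed

lemma smooth_on_flat: "smooth_on UNIV (flat m)"
proof -
  have d: "(flat m has_derivative (\<lambda>v. v * (flat (m + 2) t - real m * flat (m + 1) t))) (at t)"
    for m t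
    using flat_has_derivative[of m t] by (simp add: has_field_derivative_def mult_commute_abs)
  have "Ck_on k UNIV (flat m)" for k m
  proof (induction k arbitrary: m)
    case 0
    show ?case
      unfolding Ck_on.simps
      by (intro continuous_at_imp_continuous_on ballI) (rule has_derivative_continuous[OF d])
  next
    case (Suc k)
    have "Ck_on k UNIV (\<lambda>t. v * (flat (m + 2) t + (- real m) * flat (m + 1) t))" for v
      by (intro Ck_on_linear[OF bounded_linear_mult_right] Ck_on_add open_UNIV Suc.IH)
    moreover have "flat m differentiable (at x)" for x
      using d by (rule differentiableI)
    ultimately show ?case using d[THEN frechet_derivative_at, symmetric] by simp
  qed
  then show ?thesis by (simp add: smooth_on_def)
qed

text \<open>The bump is \<open>n / (n + p)\<close>, with \<open>n\<close> positive exactly inside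
  radius \<open>r\<close> and \<open>p\<close> positive exactly outside radius \<open>r / 2\<close>.
  The two never vanish together, which keeps the quotient smooth. The squared distance is used
  because it is smooth at the centre as well.\<close>

lemma smooth_bump:
  fixes y0 :: "'a::euclidean_space"
  assumes "r > 0"
  obtains \<beta> :: "'a \<Rightarrow> real" where "smooth_on UNIV \<beta>"
    "\<And>y. dist y0 y \<le> r / 2 \<Longrightarrow> \<beta> y = 1" "\<And>y. dist y0 y \<ge> r \<Longrightarrow> \<beta> y = 0"
proof -
  define q where "q y = (y - y0) \<bullet> (y - y0)" for y
  have q: "q y = (dist y0 y)\<^sup>2" for y
    by (simp add: q_def dist_norm power2_norm_eq_inner norm_minus_commute[of y0])
  define n where "n y = flat 0 (r\<^sup>2 - q y)" for y
  define p where "p y = flat 0 (q y - (r / 2)\<^sup>2)" for y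
  have pos: "n y + p y > 0" for y
  proof (cases "q y < r\<^sup>2")
    case True
    then show ?thesis by (simp add: n_def p_def flat_def add_pos_nonneg)
  next
    case False
    have "(r / 2)\<^sup>2 < r\<^sup>2" using assms by (simp add: power_divide)
    then show ?thesis using False by (simp add: n_def p_def flat_def)
  qed
  have diff: "smooth_on UNIV (\<lambda>y::'a. y - y0)"
    using smooth_on_add[OF open_UNIV smooth_on_id smooth_on_const[of UNIV "- y0"]] by simp
  have sq: "smooth_on UNIV q"
    unfolding q_def by (rule smooth_on_bilinear[OF bounded_bilinear_inner open_UNIV diff diff])
  have sn: "smooth_on UNIV n"
  proof -
    have "smooth_on UNIV (\<lambda>y. r\<^sup>2 + (- 1) * q y)"
      by (intro smooth_on_add smooth_on_const smooth_on_linear[OF bounded_linear_mult_right] sq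
          open_UNIV)
    then show ?thesis unfolding n_def
      by (intro smooth_on_compose[OF open_UNIV open_UNIV _ smooth_on_flat]) auto
  qed
  have sp: "smooth_on UNIV p"
  proof -
    have "smooth_on UNIV (\<lambda>y. q y + (- ((r / 2)\<^sup>2)))"
      by (intro smooth_on_add smooth_on_const sq open_UNIV)
    then show ?thesis unfolding p_def
      by (intro smooth_on_compose[OF open_UNIV open_UNIV _ smooth_on_flat]) auto
  qed
  show ?thesis
  proof
    show "smooth_on UNIV (\<lambda>y. n y * inverse (n y + p y))"
      using pos
      by (intro smooth_on_bilinear[OF bounded_bilinear_mult open_UNIV sn] smooth_on_inverse
          smooth_on_add open_UNIV sn sp) (metis less_irrefl)
  next
    fix y assume "dist y0 y \<le> r / 2"
    then have "q y \<le> (r / 2)\<^sup>2" by (simp add: q power_mono)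
    then have "p y = 0" by (simp add: p_def flat_def)
    then show "n y * inverse (n y + p y) = 1" using pos[of y] by simp
  next
    fix y assume "dist y0 y \<ge> r"
    then have "q y \<ge> r\<^sup>2" using assms by (simp add: q power_mono)
    then show "n y * inverse (n y + p y) = 0" by (simp add: n_def flat_def)
  qed
qed

section \<open>Calculus on a manifold\<close>

locale smooth_manifold =
  fixes A :: "('m::{t2_space,second_countable_topology}, 'n::finite) atlas"
  assumes smooth_atlas: "smooth_atlas A"
begin

lemma
  assumes "(U, \<phi>) \<in> A"
  shows chart_open: "open U" and chart_range_open: "open (\<phi> ` U)" and chart_inj: "inj_on \<phi> U"
    and chart_continuous: "continuous_on U \<phi>"
    and chart_inv_continuous: "continuous_on (\<phi> ` U) (inv_into U \<phi>)"
proof -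
  obtain \<psi> where o: "open U" "open (\<phi> ` U)" and h: "homeomorphism U (\<phi> ` U) \<phi> \<psi>"
  proof -
    have "case (U, \<phi>) of (U, \<phi>) \<Rightarrow>
        open U \<and> open (\<phi> ` U) \<and> (\<exists>\<psi>. homeomorphism U (\<phi> ` U) \<phi> \<psi>)"
      using smooth_atlas assms unfolding smooth_atlas_def by (elim conjE) (rule bspec)
    then show ?thesis using that by auto
  qed
  show "open U" "open (\<phi> ` U)" by (fact o)+
  show i: "inj_on \<phi> U" 
    by (rule inj_on_inverseI[of _ \<psi>]) (use h in \<open>simp add: homeomorphism_def\<close>)
  show "continuous_on U \<phi>" using h by (simp add: homeomorphism_def)
  \<comment> \<open>The atlas supplies some continuous inverse, whereas all later statements use
    \<open>inv_into\<close>; injectivity identifies the two on the image.\<close>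
  have "continuous_on (\<phi> ` U) \<psi>" using h by (simp add: homeomorphism_def)
  then show "continuous_on (\<phi> ` U) (inv_into U \<phi>)"
  proof (rule continuous_on_eq)
    fix y assume "y \<in> \<phi> ` U"
    then show "\<psi> y = inv_into U \<phi> y" using h i by (auto simp: homeomorphism_def)
  qed
qed

lemma chart_image_open:
  assumes "(U, \<phi>) \<in> A" "open W"
  shows "open (\<phi> ` (U \<inter> W))"
proof -
  have "\<phi> ` (U \<inter> W) = \<phi> ` U \<inter> inv_into U \<phi> -` W"
    using chart_inj[OF assms(1)] by (auto simp: inj_on_image_mem_iff)
  then show ?thesis
    using continuous_open_preimage[OF chart_inv_continuous[OF assms(1)]
        chart_range_open[OF assms(1)] assms(2)] by simp
qed

lemma chart_cover: obtains U \<phi> where "(U, \<phi>) \<in> A" "x \<in> U"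
proof -
  have "x \<in> (\<Union>(U, \<phi>)\<in>A. U)" using smooth_atlas unfolding smooth_atlas_def by simp
  then show ?thesis using that by auto
qed

lemma transition_smooth:
  "(U, \<phi>) \<in> A \<Longrightarrow> (V, \<psi>) \<in> A \<Longrightarrow> smooth_on (\<phi> ` (U \<inter> V)) (\<psi> \<circ> inv_into U \<phi>)"
  using smooth_atlas unfolding smooth_atlas_def by (elim conjE) fast

lemma smooth_map_onD:
  "smooth_map_on A W f \<Longrightarrow> (U, \<phi>) \<in> A \<Longrightarrow> smooth_on (\<phi> ` (U \<inter> W)) (f \<circ> inv_into U \<phi>)"
  unfolding smooth_map_on_def by blast

lemma smooth_map_onI:
  "(\<And>U \<phi>. (U, \<phi>) \<in> A \<Longrightarrow> smooth_on (\<phi> ` (U \<inter> W)) (\<lambda>y. f (inv_into U \<phi> y))) \<Longrightarrow>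
    smooth_map_on A W f"
  unfolding smooth_map_on_def o_def by blast

lemma smooth_map_on_subset: "smooth_map_on A W f \<Longrightarrow> W' \<subseteq> W \<Longrightarrow> smooth_map_on A W' f"
  unfolding smooth_map_on_def by (blast intro: smooth_on_subset)

lemma smooth_map_on_cong:
  assumes "open W" "\<And>x. x \<in> W \<Longrightarrow> f x = g x" "smooth_map_on A W f"
  shows "smooth_map_on A W g"
  unfolding smooth_map_on_def
proof (safe)
  fix U \<phi> assume c: "(U, \<phi>) \<in> A"
  show "smooth_on (\<phi> ` (U \<inter> W)) (g \<circ> inv_into U \<phi>)"
    by (rule smooth_on_cong[OF chart_image_open[OF c assms(1)] _ smooth_map_onD[OF assms(3) c]])
      (use assms(2) chart_inj[OF c] in auto)
qed

text \<open>This is the gluing principle behind every construction made in a chart or with a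
  cutoff.\<close>

lemma smooth_map_on_local:
  assumes "\<And>x. x \<in> W \<Longrightarrow> \<exists>W'. open W' \<and> x \<in> W' \<and> smooth_map_on A W' f"
  shows "smooth_map_on A W f"
  unfolding smooth_map_on_def
proof (safe)
  fix U \<phi> assume c: "(U, \<phi>) \<in> A"
  show "smooth_on (\<phi> ` (U \<inter> W)) (f \<circ> inv_into U \<phi>)"
  proof (rule smooth_on_local)
    fix y assume "y \<in> \<phi> ` (U \<inter> W)"
    then obtain x where x: "x \<in> U" "x \<in> W" "y = \<phi> x" by auto
    obtain W' where "open W'" "x \<in> W'" "smooth_map_on A W' f" using assms x by blast
    then show "\<exists>T. open T \<and> y \<in> T \<and> smooth_on T (f \<circ> inv_into U \<phi>)"
      using x c by (intro exI[of _ "\<phi> ` (U \<inter> W')"]) (auto intro: chart_image_open smooth_map_onD)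
  qed
qed

lemma smooth_map_on_const: "smooth_map_on A W (\<lambda>_. c)"
  by (rule smooth_map_onI, rule smooth_on_const)

lemma smooth_map_on_add:
  "open W \<Longrightarrow> smooth_map_on A W f \<Longrightarrow> smooth_map_on A W g \<Longrightarrow> smooth_map_on A W (\<lambda>x. f x + g x)"
  by (rule smooth_map_onI, rule smooth_on_add)
    (auto dest: smooth_map_onD chart_image_open simp: o_def)

lemma smooth_map_on_linear:
  "bounded_linear L \<Longrightarrow> open W \<Longrightarrow> smooth_map_on A W f \<Longrightarrow> smooth_map_on A W (\<lambda>x. L (f x))"
  by (rule smooth_map_onI, rule smooth_on_linear)
    (auto dest: smooth_map_onD chart_image_open simp: o_def)

lemma smooth_map_on_bilinear:
  "bounded_bilinear p \<Longrightarrow> open W \<Longrightarrow> smooth_map_on A W f \<Longrightarrow> smooth_map_on A W g \<Longrightarrow>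
    smooth_map_on A W (\<lambda>x. p (f x) (g x))"
  by (rule smooth_map_onI, rule smooth_on_bilinear)
    (auto dest: smooth_map_onD chart_image_open simp: o_def)

lemmas smooth_map_on_mult = smooth_map_on_bilinear[OF bounded_bilinear_mult]
lemmas smooth_map_on_scaleR = smooth_map_on_bilinear[OF bounded_bilinear_scaleR]

lemma smooth_map_on_sum:
  "open W \<Longrightarrow> (\<And>i. i \<in> I \<Longrightarrow> smooth_map_on A W (f i)) \<Longrightarrow> smooth_map_on A W (\<lambda>x. \<Sum>i\<in>I. f i x)"
  by (induction I rule: infinite_finite_induct) (auto intro: smooth_map_on_const smooth_map_on_add)

lemma smooth_map_on_prod:
  fixes f :: "'i \<Rightarrow> 'm \<Rightarrow> real"
  shows "open W \<Longrightarrow> (\<And>i. i \<in> I \<Longrightarrow> smooth_map_on A W (f i)) \<Longrightarrow>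
    smooth_map_on A W (\<lambda>x. \<Prod>i\<in>I. f i x)"
  by (induction I rule: infinite_finite_induct) (auto intro: smooth_map_on_const smooth_map_on_mult)

lemma smooth_map_on_inverse:
  fixes f :: "'m \<Rightarrow> real"
  assumes "open W" "\<And>x. x \<in> W \<Longrightarrow> f x \<noteq> 0" "smooth_map_on A W f"
  shows "smooth_map_on A W (\<lambda>x. inverse (f x))"
  unfolding smooth_map_on_def o_def
proof (safe)
  fix U \<phi> assume c: "(U, \<phi>) \<in> A"
  show "smooth_on (\<phi> ` (U \<inter> W)) (\<lambda>x. inverse (f (inv_into U \<phi> x)))"
    using smooth_map_onD[OF assms(3) c] assms(2) chart_inj[OF c]
    by (intro smooth_on_inverse chart_image_open[OF c assms(1)]) (auto simp: o_def)
qed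

lemma smooth_map_on_compose:
  fixes h :: "'b::euclidean_space \<Rightarrow> 'c::real_normed_vector"
  assumes "open W" "open T" "f ` W \<subseteq> T" "smooth_on T h" "smooth_map_on A W f"
  shows "smooth_map_on A W (\<lambda>x. h (f x))"
  unfolding smooth_map_on_def o_def
proof (safe)
  fix U \<phi> assume c: "(U, \<phi>) \<in> A"
  show "smooth_on (\<phi> ` (U \<inter> W)) (\<lambda>x. h (f (inv_into U \<phi> x)))"
    using smooth_map_onD[OF assms(5) c] assms(3) chart_inj[OF c]
    by (intro smooth_on_compose[OF _ assms(2) _ assms(4)] chart_image_open[OF c assms(1)])
      (auto simp: o_def image_subset_iff)
qed

lemma smooth_map_on_chart: "(V, \<psi>) \<in> A \<Longrightarrow> smooth_map_on A V \<psi>"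
  unfolding smooth_map_on_def using transition_smooth by blast

section \<open>Derivatives along tangent vectors\<close>

lemma chart_at: "chart_at A x \<in> A" "x \<in> fst (chart_at A x)"
proof -
  obtain U \<phi> where "(U, \<phi>) \<in> A" "x \<in> U" by (rule chart_cover)
  then have "\<exists>c. c \<in> A \<and> x \<in> fst c" by (intro exI[of _ "(U, \<phi>)"]) simp
  then have "chart_at A x \<in> A \<and> x \<in> fst (chart_at A x)"
    unfolding chart_at_def by (rule someI_ex)
  then show "chart_at A x \<in> A" "x \<in> fst (chart_at A x)" by auto
qed

lemma tderiv_eq:
  "chart_at A x = (U, \<phi>) \<Longrightarrow>
    tderiv A x \<xi> f = frechet_derivative (f \<circ> inv_into U \<phi>) (at (\<phi> x)) \<xi>"
  by (simp add: tderiv_def)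

lemma smooth_map_on_has_derivative:
  assumes "smooth_map_on A W f" "x \<in> W" "(U, \<phi>) \<in> A" "x \<in> U"
  shows "(f \<circ> inv_into U \<phi> has_derivative frechet_derivative (f \<circ> inv_into U \<phi>) (at (\<phi> x)))
    (at (\<phi> x))"
  by (rule smooth_on_has_derivative[OF smooth_map_onD[OF assms(1,3)]]) (use assms in auto)

lemma tderiv_cong:
  assumes "open W" "x \<in> W" "\<And>y. y \<in> W \<Longrightarrow> f y = g y" "smooth_map_on A W f"
  shows "tderiv A x \<xi> f = tderiv A x \<xi> g"
proof -
  obtain U \<phi> where c: "chart_at A x = (U, \<phi>)" by force
  then have u: "(U, \<phi>) \<in> A" "x \<in> U" using chart_at[of x] by auto
  have "frechet_derivative (f \<circ> inv_into U \<phi>) (at (\<phi> x)) =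
      frechet_derivative (g \<circ> inv_into U \<phi>) (at (\<phi> x))"
    by (rule frechet_derivative_transform_within_open[OF _ chart_image_open[OF u(1) assms(1)]])
      (use u assms chart_inj[OF u(1)] smooth_map_on_has_derivative[OF assms(4,2) u]
        in \<open>auto simp: differentiable_def\<close>)
  then show ?thesis by (simp add: tderiv_eq[OF c])
qed

text \<open>A tangent vector is stored by its components in the chart chosen at its base point, and
  that chart may change abruptly with the point. The chain rule re-expresses its action in any fixed
  chart around the point.\<close>

lemma tderiv_chart:
  assumes "smooth_map_on A W f" "open W" "x \<in> W" "(V, \<psi>) \<in> A" "x \<in> V"
  shows "tderiv A x \<xi> f =
    frechet_derivative (f \<circ> inv_into V \<psi>) (at (\<psi> x)) (tderiv A x \<xi> \<psi>)"
proof -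
  obtain U \<phi> where c: "chart_at A x = (U, \<phi>)" by force
  then have u: "(U, \<phi>) \<in> A" "x \<in> U" using chart_at[of x] by auto
  have i: "inv_into U \<phi> (\<phi> x) = x" using chart_inj[OF u(1)] u by simp
  have "(f \<circ> inv_into V \<psi> has_derivative frechet_derivative (f \<circ> inv_into V \<psi>) (at (\<psi> x)))
      (at ((\<psi> \<circ> inv_into U \<phi>) (\<phi> x)))"
    using smooth_map_on_has_derivative[OF assms(1,3,4,5)] by (simp add: i)
  from diff_chain_at[OF smooth_map_on_has_derivative[OF smooth_map_on_chart[OF assms(4)] assms(5) u] this]
  have "(f \<circ> inv_into V \<psi> \<circ> (\<psi> \<circ> inv_into U \<phi>) has_derivative
      frechet_derivative (f \<circ> inv_into V \<psi>) (at (\<psi> x)) \<circ>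
      frechet_derivative (\<psi> \<circ> inv_into U \<phi>) (at (\<phi> x))) (at (\<phi> x))" .
  then have "(f \<circ> inv_into U \<phi> has_derivative
      frechet_derivative (f \<circ> inv_into V \<psi>) (at (\<psi> x)) \<circ>
      frechet_derivative (\<psi> \<circ> inv_into U \<phi>) (at (\<phi> x))) (at (\<phi> x))"
  proof (rule has_derivative_transform_within_open[OF _
          chart_image_open[OF u(1) chart_open[OF assms(4)]]])
    show "\<phi> x \<in> \<phi> ` (U \<inter> V)" using u assms(5) by blast
  next
    fix y assume "y \<in> \<phi> ` (U \<inter> V)"
    then show "(f \<circ> inv_into V \<psi> \<circ> (\<psi> \<circ> inv_into U \<phi>)) y = (f \<circ> inv_into U \<phi>) y"
      by (clarsimp simp: inv_into_f_f[OF chart_inj[OF u(1)]] inv_into_f_f[OF chart_inj[OF assms(4)]])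
  qed
  from fun_cong[OF frechet_derivative_at[OF this], of \<xi>] show ?thesis
    by (simp add: tderiv_eq[OF c])
qed

lemma tderiv_linear:
  assumes "smooth_map_on A W f" "x \<in> W"
  shows "linear (\<lambda>\<xi>. tderiv A x \<xi> f)"
proof -
  obtain U \<phi> where c: "chart_at A x = (U, \<phi>)" by force
  then have u: "(U, \<phi>) \<in> A" "x \<in> U" using chart_at[of x] by auto
  show ?thesis
    unfolding tderiv_eq[OF c]
    using smooth_map_on_has_derivative[OF assms u, THEN has_derivative_linear] .
qed

lemma tderiv_bilinear:
  assumes p: "bounded_bilinear p" and "smooth_map_on A W f" "smooth_map_on A W g" "x \<in> W"
  shows "tderiv A x \<xi> (\<lambda>y. p (f y) (g y)) = p (f x) (tderiv A x \<xi> g) + p (tderiv A x \<xi> f) (g x)"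
proof -
  obtain U \<phi> where c: "chart_at A x = (U, \<phi>)" by force
  then have u: "(U, \<phi>) \<in> A" "x \<in> U" using chart_at[of x] by auto
  have i: "inv_into U \<phi> (\<phi> x) = x" using chart_inj[OF u(1)] u by simp
  from fun_cong[OF frechet_derivative_at[OF bounded_bilinear.FDERIV[OF p
        smooth_map_on_has_derivative[OF assms(2,4) u]
        smooth_map_on_has_derivative[OF assms(3,4) u]]], of \<xi>]
  show ?thesis 
    by (simp add: tderiv_eq[OF c] i o_def)
qed

lemmas tderiv_mult = tderiv_bilinear[OF bounded_bilinear_mult]

lemma tderiv_const: "tderiv A x \<xi> (\<lambda>_. c) = 0"
proof -
  obtain U \<phi> where "chart_at A x = (U, \<phi>)" by force
  then show ?thesis by (simp add: tderiv_eq o_def)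
qed

text \<open>In one fixed chart the derivative is a sum of components of \<open>X\<close>, smooth by
  the definition of a vector field, times partial derivatives of the coordinate expression of
  \<open>f\<close>.\<close>

lemma smooth_map_on_tderiv:
  assumes "vector_field A X" "open W" "smooth_map_on A W f"
  shows "smooth_map_on A W (\<lambda>x. tderiv A x (X x) f)"
proof (rule smooth_map_on_local)
  fix x assume x: "x \<in> W"
  obtain V \<psi> where v: "(V, \<psi>) \<in> A" "x \<in> V" using chart_cover .
  have o: "open (V \<inter> W)" using chart_open[OF v(1)] assms(2) by auto
  have oi: "open (\<psi> ` (V \<inter> W))" by (rule chart_image_open[OF v(1) assms(2)])
  have sX: "smooth_map_on A (V \<inter> W) (\<lambda>x. tderiv A x (X x) \<psi>)"
    using assms(1) v(1) unfolding smooth_section_def tangent_trivs_def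
    by (force intro: smooth_map_on_subset)
  have s\<psi>: "smooth_map_on A (V \<inter> W) \<psi>"
    using smooth_map_on_chart[OF v(1)] by (rule smooth_map_on_subset) auto
  have sf: "smooth_map_on A (V \<inter> W)
      (\<lambda>x. frechet_derivative (f \<circ> inv_into V \<psi>) (at (\<psi> x)) b)" for b
    by (rule smooth_map_on_compose[OF o oi _
          smooth_on_frechet_derivative[OF smooth_map_onD[OF assms(3) v(1)]] s\<psi>]) auto
  have "smooth_map_on A (V \<inter> W) (\<lambda>x. \<Sum>b\<in>Basis. (tderiv A x (X x) \<psi> \<bullet> b) *\<^sub>R
      frechet_derivative (f \<circ> inv_into V \<psi>) (at (\<psi> x)) b)"
    by (intro smooth_map_on_sum smooth_map_on_scaleR o sf
        smooth_map_on_linear[OF bounded_linear_inner_left] sX)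
  then have "smooth_map_on A (V \<inter> W) (\<lambda>x. tderiv A x (X x) f)"
  proof (rule smooth_map_on_cong[OF o, rotated])
    fix y assume y: "y \<in> V \<inter> W"
    then have yy: "y \<in> V" "y \<in> W" by auto
    interpret linear "frechet_derivative (f \<circ> inv_into V \<psi>) (at (\<psi> y))"
      using smooth_map_on_has_derivative[OF assms(3) yy(2) v(1) yy(1)]
      by (rule has_derivative_linear)
    have "frechet_derivative (f \<circ> inv_into V \<psi>) (at (\<psi> y)) (tderiv A y (X y) \<psi>)
      = frechet_derivative (f \<circ> inv_into V \<psi>) (at (\<psi> y))
          (\<Sum>b\<in>Basis. (tderiv A y (X y) \<psi> \<bullet> b) *\<^sub>R b)"
      by (simp add: euclidean_representation)
    also have "\<dots> = (\<Sum>b\<in>Basis. (tderiv A y (X y) \<psi> \<bullet> b) *\<^sub>R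
      frechet_derivative (f \<circ> inv_into V \<psi>) (at (\<psi> y)) b)"
      by (simp only: sum scale)
    finally show "(\<Sum>b\<in>Basis. (tderiv A y (X y) \<psi> \<bullet> b) *\<^sub>R
      frechet_derivative (f \<circ> inv_into V \<psi>) (at (\<psi> y)) b) = tderiv A y (X y) f"
      by (simp add: tderiv_chart[OF assms(3,2) yy(2) v(1) yy(1)])
  qed
  then show "\<exists>W'. open W' \<and> x \<in> W' \<and> smooth_map_on A W' (\<lambda>x. tderiv A x (X x) f)"
    using o v x by blast
qed

text \<open>The transition functions are the Jacobians of the coordinate changes. That the
  differential of a chart is invertible comes from comparison with the chart chosen at the
  point.\<close>

lemma tangent_bundle: "vector_bundle A (tangent_trivs A)"
proof -
  have lin: "linear (\<lambda>\<xi>. tderiv A x \<xi> \<phi>)" if "(U, \<phi>) \<in> A" "x \<in> U" for U \<phi> x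
    by (rule tderiv_linear[OF smooth_map_on_chart[OF that(1)] that(2)])
  have change: "tderiv A x \<xi> \<psi> = frechet_derivative (\<psi> \<circ> inv_into U \<phi>) (at (\<phi> x)) (tderiv A x \<xi> \<phi>)"
    if "(U, \<phi>) \<in> A" "x \<in> U" "(V, \<psi>) \<in> A" "x \<in> V" for U \<phi> V \<psi> x \<xi>
    by (rule tderiv_chart[OF smooth_map_on_chart[OF that(3)] chart_open[OF that(3)] that(4,1,2)])
  have bij: "bij (\<lambda>\<xi>. tderiv A x \<xi> \<phi>)" if c: "(U, \<phi>) \<in> A" "x \<in> U" for U \<phi> x
  proof -
    obtain V \<psi> where v: "chart_at A x = (V, \<psi>)" by force
    then have vv: "(V, \<psi>) \<in> A" "x \<in> V" using chart_at[of x] by auto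
    \<comment> \<open>In the chosen chart the differential is the identity, and it factors through
      the differential of any other chart. The latter is therefore injective, hence bijective by
      equality of dimensions.\<close>
    have id: "tderiv A x \<xi> \<psi> = \<xi>" for \<xi>
    proof -
      have "((\<lambda>y. y) has_derivative (\<lambda>y. y)) (at (\<psi> x))" by (rule has_derivative_ident)
      then have "(\<psi> \<circ> inv_into V \<psi> has_derivative (\<lambda>y. y)) (at (\<psi> x))"
        by (rule has_derivative_transform_within_open[OF _ chart_range_open[OF vv(1)]])
          (use vv in \<open>auto simp: f_inv_into_f\<close>)
      from fun_cong[OF frechet_derivative_at[OF this], of \<xi>] show ?thesis
    by (simp add: tderiv_eq[OF v])
    qed
    have "inj (\<lambda>\<xi>. tderiv A x \<xi> \<phi>)"
      by (rule injI) (metis change[OF c vv] id)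
    with linear_injective_imp_surjective[OF lin[OF c]] show ?thesis by (simp add: bij_def)
  qed
  have trans: "smooth_map_on A (U \<inter> V) (\<lambda>x. tderiv A x (inv (\<lambda>\<xi>. tderiv A x \<xi> \<phi>) a) \<psi>)"
    if u: "(U, \<phi>) \<in> A" and v: "(V, \<psi>) \<in> A" for U \<phi> V \<psi> a
  proof -
    have o: "open (U \<inter> V)" using chart_open u v by auto
    have "smooth_map_on A (U \<inter> V) (\<lambda>x. frechet_derivative (\<psi> \<circ> inv_into U \<phi>) (at (\<phi> x)) a)"
      by (rule smooth_map_on_compose[OF o chart_image_open[OF u chart_open[OF v]] _
            smooth_on_frechet_derivative[OF transition_smooth[OF u v]]
            smooth_map_on_subset[OF smooth_map_on_chart[OF u]]]) auto
    then show ?thesis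
    proof (rule smooth_map_on_cong[OF o, rotated])
      fix x assume "x \<in> U \<inter> V"
      then have x: "x \<in> U" "x \<in> V" by auto
      show "frechet_derivative (\<psi> \<circ> inv_into U \<phi>) (at (\<phi> x)) a =
          tderiv A x (inv (\<lambda>\<xi>. tderiv A x \<xi> \<phi>) a) \<psi>"
        unfolding change[OF u x(1) v x(2)]
        using surj_f_inv_f[OF bij_is_surj[OF bij[OF u x(1)]], of a] by simp
    qed
  qed
  show ?thesis
    unfolding vector_bundle_def
  proof (intro conjI)
    show "\<forall>(U, \<Phi>)\<in>tangent_trivs A. open U \<and> (\<forall>x\<in>U. linear (\<Phi> x) \<and> bij (\<Phi> x))"
      using lin bij chart_open unfolding tangent_trivs_def by auto
    show "(\<Union>(U, \<Phi>)\<in>tangent_trivs A. U) = UNIV"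
      using chart_cover unfolding tangent_trivs_def by (auto simp: split_beta) (metis fst_conv)
    show "\<forall>(U, \<Phi>)\<in>tangent_trivs A. \<forall>(V, \<Psi>)\<in>tangent_trivs A.
        \<forall>a. smooth_map_on A (U \<inter> V) (\<lambda>x. \<Psi> x (inv (\<Phi> x) a))"
      using trans unfolding tangent_trivs_def by auto
  qed
qed

section \<open>Cutoff functions and extension by zero\<close>

lemma smooth_bump_function:
  assumes "open W" "x \<in> W"
  obtains \<rho> W' K where "smooth_fun A \<rho>" "open W'" "x \<in> W'" "W' \<subseteq> W" "\<And>y. y \<in> W' \<Longrightarrow> \<rho> y = 1"
    "closed K" "K \<subseteq> W" "\<And>y. y \<notin> K \<Longrightarrow> \<rho> y = 0"
proof -
  obtain U \<phi> where u: "(U, \<phi>) \<in> A" "x \<in> U" using chart_cover .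
  have "open (\<phi> ` (U \<inter> W))" "\<phi> x \<in> \<phi> ` (U \<inter> W)" using chart_image_open[OF u(1)] assms u by auto
  then obtain r where r: "r > 0" "cball (\<phi> x) r \<subseteq> \<phi> ` (U \<inter> W)"
    using open_contains_cball by blast
  obtain \<beta> :: "real ^ 'n \<Rightarrow> real" where b: "smooth_on UNIV \<beta>" "\<And>y. dist (\<phi> x) y \<le> r / 2 \<Longrightarrow> \<beta> y = 1"
    "\<And>y. dist (\<phi> x) y \<ge> r \<Longrightarrow> \<beta> y = 0"
    by (rule smooth_bump[OF r(1), of "\<phi> x"]) blast
  define \<rho> where "\<rho> y = (if y \<in> U then \<beta> (\<phi> y) else 0)" for y
  define K where "K = inv_into U \<phi> ` cball (\<phi> x) r"
  define W' where "W' = U \<inter> \<phi> -` ball (\<phi> x) (r / 2)"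
  \<comment> \<open>The image of a closed ball under the inverse chart is compact, so the Hausdorff
    property makes it closed in the whole manifold and not merely in the chart domain. This is what
    makes the extension by zero smooth at the boundary of the chart.\<close>
  have cK: "closed K" unfolding K_def
    by (intro compact_imp_closed compact_continuous_image compact_cball
        continuous_on_subset[OF chart_inv_continuous[OF u(1)]]) (use r in auto)
  have "K \<subseteq> inv_into U \<phi> ` \<phi> ` (U \<inter> W)" unfolding K_def using r(2) by (rule image_mono)
  also have "\<dots> = U \<inter> W" by (rule inv_into_image_cancel[OF chart_inj[OF u(1)]]) simp
  finally have KW: "K \<subseteq> W" and KU: "K \<subseteq> U" by auto
  have \<rho>0: "\<rho> y = 0" if "y \<notin> K" for y
  proof (cases "y \<in> U")
    case True
    then have "\<phi> y \<notin> cball (\<phi> x) r"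
      using that chart_inj[OF u(1)] unfolding K_def by (metis image_eqI inv_into_f_f)
    then show ?thesis using True b(3)[of "\<phi> y"] by (simp add: \<rho>_def)
  qed (simp add: \<rho>_def)
  have "smooth_fun A \<rho>"
  proof (rule smooth_map_on_local)
    fix y
    show "\<exists>W'. open W' \<and> y \<in> W' \<and> smooth_map_on A W' \<rho>"
    proof (cases "y \<in> U")
      case True
      have "smooth_map_on A U (\<lambda>y. \<beta> (\<phi> y))"
        by (rule smooth_map_on_compose[OF chart_open[OF u(1)] open_UNIV _ b(1)
              smooth_map_on_chart[OF u(1)]]) auto
      then have "smooth_map_on A U \<rho>"
        by (rule smooth_map_on_cong[OF chart_open[OF u(1)], rotated]) (simp add: \<rho>_def)
      then show ?thesis using True chart_open[OF u(1)] by blast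
    next
      case False
      have "y \<notin> K" using False KU by blast
      moreover have "smooth_map_on A (- K) \<rho>"
        by (rule smooth_map_on_cong[OF _ _ smooth_map_on_const[of _ 0]]) (use cK \<rho>0 in auto)
      ultimately show ?thesis using cK by (intro exI[of _ "- K"]) auto
    qed
  qed
  moreover have "open W'" unfolding W'_def
    by (rule continuous_open_preimage[OF chart_continuous[OF u(1)] chart_open[OF u(1)]]) simp
  moreover have "x \<in> W'" using u r by (simp add: W'_def)
  moreover have "W' \<subseteq> W"
  proof
    fix y assume "y \<in> W'"
    then have y: "y \<in> U" "\<phi> y \<in> cball (\<phi> x) r" using r(1) by (auto simp: W'_def)
    then obtain z where "z \<in> U" "z \<in> W" "\<phi> y = \<phi> z" using r(2) by auto
    then show "y \<in> W" using chart_inj[OF u(1)] y by (auto dest: inj_onD)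
  qed
  moreover have "\<rho> y = 1" if "y \<in> W'" for y
    using that b(2)[of "\<phi> y"] by (simp add: W'_def \<rho>_def)
  ultimately show ?thesis using that cK KW \<rho>0 by blast
qed

text \<open>The open sets \<open>W\<close> and \<open>- K\<close> cover everything: on the first
  both factors are smooth, on the second the product is zero whatever values \<open>f\<close>
  takes.\<close>

lemma smooth_map_on_extend:
  assumes "open W" "closed K" "K \<subseteq> W" "\<And>y. y \<notin> K \<Longrightarrow> \<rho> y = 0" "smooth_fun A \<rho>"
    and "open V" "smooth_map_on A (V \<inter> W) f"
  shows "smooth_map_on A V (\<lambda>y. \<rho> y *\<^sub>R f y)"
proof (rule smooth_map_on_local)
  fix y assume y: "y \<in> V"
  show "\<exists>W'. open W' \<and> y \<in> W' \<and> smooth_map_on A W' (\<lambda>y. \<rho> y *\<^sub>R f y)"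
  proof (cases "y \<in> W")
    case True
    have "smooth_map_on A (V \<inter> W) (\<lambda>y. \<rho> y *\<^sub>R f y)"
      by (intro smooth_map_on_scaleR open_Int assms smooth_map_on_subset[OF assms(5)]) auto
    then show ?thesis using True y assms by blast
  next
    case False
    have "smooth_map_on A (- K) (\<lambda>y. \<rho> y *\<^sub>R f y)"
      by (rule smooth_map_on_cong[OF _ _ smooth_map_on_const[of _ 0]]) (use assms in auto)
    then show ?thesis using False assms by (intro exI[of _ "- K"]) auto
  qed
qed

end

section \<open>Traces and dual frames\<close>

lemma bilinear_right: "bilinear m \<Longrightarrow> linear (m u)"
  by (simp add: bilinear_def)

lemma bilinear_left: "bilinear m \<Longrightarrow> linear (\<lambda>u. m u v)"
  by (simp add: bilinear_def)

lemma bilinear_sum_left: "bilinear m \<Longrightarrow> m (\<Sum>i\<in>I. f i) v = (\<Sum>i\<in>I. m (f i) v)"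
  using linear_sum[OF bilinear_left] .

lemma bilinear_sum_right: "bilinear m \<Longrightarrow> m u (\<Sum>i\<in>I. f i) = (\<Sum>i\<in>I. m u (f i))"
  using linear_sum[OF bilinear_right] .

lemma nondegenerate_eqI:
  assumes "bilinear m" "nondegenerate m" "\<And>v. m u v = m w v"
  shows "u = w"
proof -
  have "m (u - w) v = 0" for v using assms by (simp add: bilinear_lsub)
  then have "u - w = 0" using assms(2) unfolding nondegenerate_def by blast
  then show ?thesis by simp
qed

text \<open>Recording the values on \<open>Basis\<close> turns the map from a vector to its
  functional into an endomorphism \<open>L\<close>. Nondegeneracy makes it injective, finite
  dimension makes it surjective.\<close>

lemma nondegenerate_represent:
  fixes m :: "'v::euclidean_space \<Rightarrow> 'v \<Rightarrow> real"
  assumes "bilinear m" "nondegenerate m" "linear \<alpha>"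
  shows "\<exists>!w. \<forall>v. m w v = \<alpha> v"
proof -
  define L where "L u = (\<Sum>b\<in>Basis. m u b *\<^sub>R b)" for u
  have Lb: "L u \<bullet> b = m u b" if "b \<in> Basis" for u b
    using that by (simp add: L_def)
  have lin: "linear L" unfolding L_def
    by (rule linearI)
      (simp_all add: bilinear_ladd[OF assms(1)] bilinear_lmul[OF assms(1)] algebra_simps
        sum.distrib scaleR_sum_right)
  have ext: "m u v = \<beta> v" if "linear \<beta>" "\<And>b. b \<in> Basis \<Longrightarrow> m u b = \<beta> b" for u v \<beta>
    using linear_eq_on_span[OF bilinear_right[OF assms(1)] that(1), of Basis] that(2) by auto
  have "inj L"
  proof (rule injI)
    fix u w assume "L u = L w"
    then have e: "m u b = m w b" if "b \<in> Basis" for b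
      using Lb[OF that, of u] Lb[OF that, of w] by simp
    show "u = w"
      by (rule nondegenerate_eqI[OF assms(1,2)], rule ext[OF bilinear_right[OF assms(1)] e])
  qed
  then obtain w where w: "L w = (\<Sum>b\<in>Basis. \<alpha> b *\<^sub>R b)"
    using linear_injective_imp_surjective[OF lin] by (metis surjD)
  have "m w b = \<alpha> b" if "b \<in> Basis" for b
    using Lb[OF that, of w] that by (simp add: w)
  then have "\<forall>v. m w v = \<alpha> v" using ext[OF assms(3)] by blast
  then show ?thesis using nondegenerate_eqI[OF assms(1,2)] by (intro ex1I[of _ w]) auto
qed

lemma dual_vec:
  fixes m :: "'v::euclidean_space \<Rightarrow> 'v \<Rightarrow> real"
  assumes "bilinear m" "nondegenerate m" "b \<in> Basis"
  shows "m (dual_vec m b) v = v \<bullet> b"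
proof -
  have ext: "(\<forall>c\<in>Basis. m w c = (if c = b then 1 else 0)) \<longleftrightarrow> (\<forall>v. m w v = v \<bullet> b)" for w
  proof
    assume a: "\<forall>c\<in>Basis. m w c = (if c = b then 1 else 0)"
    show "\<forall>v. m w v = v \<bullet> b"
      using linear_eq_on_span[OF bilinear_right[OF assms(1)]
          bounded_linear.linear[OF bounded_linear_inner_left], of Basis w b] a
      by (auto simp: inner_Basis assms(3))
  qed (auto simp: inner_Basis assms(3))
  have "\<exists>!w. \<forall>c\<in>Basis. m w c = (if c = b then 1 else 0)"
    unfolding ext by (rule nondegenerate_represent[OF assms(1,2)
        bounded_linear.linear[OF bounded_linear_inner_left]])
  from theI'[OF this] have "\<forall>v. m (dual_vec m b) v = v \<bullet> b"
    unfolding dual_vec_def[symmetric] by (rule ext[THEN iffD1])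
  then show ?thesis by blast
qed

lemma dual_vec_expand:
  fixes m :: "'v::euclidean_space \<Rightarrow> 'v \<Rightarrow> real"
  assumes m: "bilinear m" "nondegenerate m" "\<And>u v. m u v = m v u"
  shows "w = (\<Sum>b\<in>Basis. m w b *\<^sub>R dual_vec m b)"
proof (rule nondegenerate_eqI[OF m(1,2)])
  fix v
  have "m (\<Sum>b\<in>Basis. m w b *\<^sub>R dual_vec m b) v = (\<Sum>b\<in>Basis. (v \<bullet> b) * m w b)"
    by (simp add: bilinear_sum_left[OF m(1)] bilinear_lmul[OF m(1)] dual_vec[OF m(1,2)] mult.commute)
  also have "\<dots> = m w (\<Sum>b\<in>Basis. (v \<bullet> b) *\<^sub>R b)"
    by (simp add: bilinear_sum_right[OF m(1)] bilinear_rmul[OF m(1)])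
  finally show "m w v = m (\<Sum>b\<in>Basis. m w b *\<^sub>R dual_vec m b) v"
    by (simp add: euclidean_representation)
qed

text \<open>The reproducing formula is the only property asked of the frame, and the index set is
  free. This admits frames of \<open>E\<close> assembled from both eigenbundles and indexed by
  pairs.\<close>

lemma metric_trace_frame:
  fixes m :: "'v::euclidean_space \<Rightarrow> 'v \<Rightarrow> real"
  assumes m: "bilinear m" "nondegenerate m" "\<And>u v. m u v = m v u" and B: "bilinear B"
    and f: "\<And>v. v = (\<Sum>i\<in>I. m v (f' i) *\<^sub>R f i)"
  shows "metric_trace m B = (\<Sum>i\<in>I. B (f i) (f' i))"
proof -
  have B1: "B v w = (\<Sum>i\<in>I. m v (f' i) * B (f i) w)" for v w
    by (subst f[of v]) (simp add: bilinear_sum_left[OF B] bilinear_lmul[OF B])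
  have D: "(\<Sum>b\<in>Basis. m b w *\<^sub>R dual_vec m b) = w" for w
    using dual_vec_expand[OF m(1-3), of w] by (simp add: m(3)[of _ w])
  have "metric_trace m B = (\<Sum>b\<in>Basis. \<Sum>i\<in>I. m b (f' i) * B (f i) (dual_vec m b))"
    unfolding metric_trace_def by (subst B1) simp
  also have "\<dots> = (\<Sum>i\<in>I. B (f i) (\<Sum>b\<in>Basis. m b (f' i) *\<^sub>R dual_vec m b))"
    by (subst sum.swap) (simp add: bilinear_sum_right[OF B] bilinear_rmul[OF B])
  finally show ?thesis by (simp add: D)
qed

lemma metric_trace_swap:
  fixes m :: "'v::euclidean_space \<Rightarrow> 'v \<Rightarrow> real"
  assumes m: "bilinear m" "nondegenerate m" "\<And>u v. m u v = m v u" and B: "bilinear B"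
  shows "metric_trace m B = metric_trace m (\<lambda>p q. B q p)"
  using metric_trace_frame[OF m B dual_vec_expand[OF m]] by (simp add: metric_trace_def)

lemma bilinear_mult:
  fixes L L' :: "'v::real_vector \<Rightarrow> real"
  shows "linear L \<Longrightarrow> linear L' \<Longrightarrow> bilinear (\<lambda>p q. L p * L' q)"
  unfolding bilinear_def
  by (auto intro!: linearI simp: linear_add linear_cmul algebra_simps)

text \<open>Tracing against the functional of \<open>w\<close> evaluates the other factor at
  \<open>w\<close>. This is how a gradient inside a trace becomes an argument of a connection
  term.\<close>

lemma metric_trace_represent:
  fixes m :: "'v::euclidean_space \<Rightarrow> 'v \<Rightarrow> real"
  assumes m: "bilinear m" "nondegenerate m" "\<And>u v. m u v = m v u" and L: "linear L"
  shows "metric_trace m (\<lambda>p q. L p * m w q) = (L w :: real)"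
proof -
  have "metric_trace m (\<lambda>p q. L p * m w q) = (\<Sum>b\<in>Basis. L b * (w \<bullet> b))"
    unfolding metric_trace_def by (simp add: m(3)[of w] dual_vec[OF m(1,2)])
  also have "\<dots> = L (\<Sum>b\<in>Basis. (w \<bullet> b) *\<^sub>R b)"
    by (simp add: linear_sum[OF L] linear_cmul[OF L] mult.commute)
  finally show ?thesis by (simp add: euclidean_representation)
qed

lemma metric_trace_add:
  "metric_trace m (\<lambda>p q. B p q + B' p q) = metric_trace m B + metric_trace m B'"
  by (simp add: metric_trace_def sum.distrib)

lemma metric_trace_cmult: "metric_trace m (\<lambda>p q. r * B p q) = r * metric_trace m B"
  by (simp add: metric_trace_def sum_distrib_left)

text \<open>The trace of an endomorphism does not depend on the basis, so the Euclidean product in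
  its definition can be traded for the metric.\<close>

lemma endo_trace_frame:
  fixes m :: "'v::euclidean_space \<Rightarrow> 'v \<Rightarrow> real"
  assumes m: "bilinear m" and L: "linear L"
    and f: "\<And>v. v = (\<Sum>i\<in>I. m v (f' i) *\<^sub>R f i)"
  shows "endo_trace L = (\<Sum>i\<in>I. m (L (f i)) (f' i))"
proof -
  have L1: "L v = (\<Sum>i\<in>I. m v (f' i) *\<^sub>R L (f i))" for v
    by (subst f[of v]) (simp add: linear_sum[OF L] linear_cmul[OF L])
  have "endo_trace L = (\<Sum>b\<in>Basis. \<Sum>i\<in>I. m b (f' i) * (L (f i) \<bullet> b))"
    unfolding endo_trace_def by (subst L1) (simp add: inner_sum_left)
  also have "\<dots> = (\<Sum>i\<in>I. m (\<Sum>b\<in>Basis. (L (f i) \<bullet> b) *\<^sub>R b) (f' i))"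
    by (subst sum.swap) (simp add: bilinear_sum_left[OF m] bilinear_lmul[OF m] mult.commute)
  finally show ?thesis by (simp add: euclidean_representation)
qed

text \<open>\<open>Basis\<close> serves here as an index set with as many elements as the dimension;
  the frame vectors themselves are unrelated to the Euclidean structure.\<close>

definition dual_frame :: "('v::euclidean_space \<Rightarrow> 'v \<Rightarrow> real) \<Rightarrow> ('v \<Rightarrow> 'v) \<Rightarrow> ('v \<Rightarrow> 'v) \<Rightarrow> bool"
  where "dual_frame m f f' \<longleftrightarrow>
    (\<forall>b\<in>Basis. \<forall>c\<in>Basis. m (f b) (f' c) = (if b = c then 1 else 0))"

lemma dual_frame_sym: "dual_frame m f f' \<Longrightarrow> (\<And>u v. m u v = m v u) \<Longrightarrow> dual_frame m f' f"
  unfolding dual_frame_def by metis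

text \<open>Biorthogonality recovers the coefficients of a linear combination, so the coordinate map
  is injective; by dimension it is surjective, and the frame spans.\<close>

lemma dual_frame_expand:
  fixes m :: "'v::euclidean_space \<Rightarrow> 'v \<Rightarrow> real"
  assumes m: "bilinear m" and d: "dual_frame m f f'"
  shows "v = (\<Sum>b\<in>Basis. m v (f' b) *\<^sub>R f b)"
proof -
  define L where "L c = (\<Sum>b\<in>Basis. (c \<bullet> b) *\<^sub>R f b)" for c
  have lin: "linear L" unfolding L_def
    by (rule linearI) (simp_all add: algebra_simps sum.distrib scaleR_sum_right)
  have Lb: "m (L c) (f' b) = c \<bullet> b" if "b \<in> Basis" for b c
  proof -
    have "m (L c) (f' b) = (\<Sum>a\<in>Basis. (c \<bullet> a) * (if a = b then 1 else 0))"
      using d that unfolding L_def dual_frame_def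
      by (simp add: bilinear_sum_left[OF m] bilinear_lmul[OF m])
    then show ?thesis using that by (simp add: if_distrib cong: if_cong)
  qed
  have "inj L" by (rule injI) (metis Lb euclidean_eqI)
  then obtain c where "v = L c" using linear_injective_imp_surjective[OF lin] by (metis surjD)
  then show ?thesis using Lb[of _ c] by (simp add: L_def[of c])
qed

text \<open>The determinants and Cramer's rule of the library need matrices indexed by a finite type.\<close>

typedef (overloaded) 'v basis_index = "Basis :: 'v::euclidean_space set"
  using nonempty_Basis by blast

lemma bij_Rep_basis_index: "bij_betw Rep_basis_index UNIV Basis"
  by (rule bij_betwI[of _ _ _ Abs_basis_index])
    (auto simp: Rep_basis_index Rep_basis_index_inverse Abs_basis_index_inverse)

instance basis_index :: (euclidean_space) finite
proof
  show "finite (UNIV :: 'a basis_index set)"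
    using bij_betw_finite[OF bij_Rep_basis_index] by simp
qed

lemma sum_basis_index: "(\<Sum>i\<in>UNIV. h (Rep_basis_index i)) = (\<Sum>b\<in>Basis. h b)"
  by (rule sum.reindex_bij_betw[OF bij_Rep_basis_index])

section \<open>Bundles with a fibre metric\<close>

locale metric_bundle = smooth_manifold A
  for A :: "('m::{t2_space,second_countable_topology}, 'n::finite) atlas" +
  fixes T :: "('m, 'v::euclidean_space) trivs" and m :: "'m \<Rightarrow> 'v \<Rightarrow> 'v \<Rightarrow> real"
  assumes vbundle: "vector_bundle A T" and metric: "fibre_metric A T m"
begin

abbreviation "is_sec \<equiv> smooth_section A T"

lemma m_bilinear: "bilinear (m x)" and m_sym: "m x u v = m x v u"
  and m_nondegenerate: "nondegenerate (m x)"
  and m_smooth: "is_sec s \<Longrightarrow> is_sec t \<Longrightarrow> smooth_fun A (\<lambda>x. m x (s x) (t x))"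
  using metric unfolding fibre_metric_def by blast+

lemma triv:
  assumes "(U, \<Phi>) \<in> T"
  shows triv_open: "open U" and triv_linear: "x \<in> U \<Longrightarrow> linear (\<Phi> x)"
    and triv_bij: "x \<in> U \<Longrightarrow> bij (\<Phi> x)"
  using vbundle assms unfolding vector_bundle_def by fast+

lemma triv_cover: obtains U \<Phi> where "(U, \<Phi>) \<in> T" "x \<in> U"
proof -
  have "x \<in> (\<Union>(U, \<Phi>)\<in>T. U)" using vbundle unfolding vector_bundle_def by simp
  then show ?thesis using that by auto
qed

lemma triv_transition:
  "(U, \<Phi>) \<in> T \<Longrightarrow> (V, \<Psi>) \<in> T \<Longrightarrow> smooth_map_on A (U \<inter> V) (\<lambda>x. \<Psi> x (inv (\<Phi> x) a))"
  using vbundle unfolding vector_bundle_def by (elim conjE) fast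

lemma is_secI:
  "(\<And>U \<Phi>. (U, \<Phi>) \<in> T \<Longrightarrow> smooth_map_on A U (\<lambda>x. \<Phi> x (s x))) \<Longrightarrow> is_sec s"
  unfolding smooth_section_def by blast

lemma is_secD: "is_sec s \<Longrightarrow> (U, \<Phi>) \<in> T \<Longrightarrow> smooth_map_on A U (\<lambda>x. \<Phi> x (s x))"
  unfolding smooth_section_def by blast

lemma sec_add:
  assumes "is_sec s" "is_sec t"
  shows "is_sec (\<lambda>x. s x + t x)"
proof (rule is_secI)
  fix U \<Phi> assume c: "(U, \<Phi>) \<in> T"
  show "smooth_map_on A U (\<lambda>x. \<Phi> x (s x + t x))"
    by (rule smooth_map_on_cong[OF triv_open[OF c] _ smooth_map_on_add[OF triv_open[OF c]
            is_secD[OF assms(1) c] is_secD[OF assms(2) c]]])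
      (simp add: linear_add[OF triv_linear[OF c]])
qed

lemma sec_scale:
  assumes "smooth_fun A f" "is_sec s"
  shows "is_sec (\<lambda>x. f x *\<^sub>R s x)"
proof (rule is_secI)
  fix U \<Phi> assume c: "(U, \<Phi>) \<in> T"
  show "smooth_map_on A U (\<lambda>x. \<Phi> x (f x *\<^sub>R s x))"
    by (rule smooth_map_on_cong[OF triv_open[OF c] _ smooth_map_on_scaleR[OF triv_open[OF c]
            smooth_map_on_subset[OF assms(1)] is_secD[OF assms(2) c]]])
      (simp_all add: linear_cmul[OF triv_linear[OF c]])
qed

lemma sec_scale_const: "is_sec s \<Longrightarrow> is_sec (\<lambda>x. r *\<^sub>R s x)"
  using sec_scale[OF smooth_map_on_const] .

lemma sec_zero: "is_sec (\<lambda>_. 0)"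
proof (rule is_secI)
  fix U \<Phi> assume c: "(U, \<Phi>) \<in> T"
  show "smooth_map_on A U (\<lambda>x. \<Phi> x 0)"
    by (rule smooth_map_on_cong[OF triv_open[OF c] _ smooth_map_on_const[of _ 0]])
      (simp add: linear_0[OF triv_linear[OF c]])
qed

lemma sec_diff: "is_sec s \<Longrightarrow> is_sec t \<Longrightarrow> is_sec (\<lambda>x. s x - t x)"
  using sec_add[OF _ sec_scale_const[of t "- 1"]] by simp

lemma sec_sum: "(\<And>i. i \<in> I \<Longrightarrow> is_sec (s i)) \<Longrightarrow> is_sec (\<lambda>x. \<Sum>i\<in>I. s i x)"
  by (induction I rule: infinite_finite_induct) (auto intro: sec_zero sec_add)

lemma sec_local:
  assumes "\<And>x. \<exists>W t. open W \<and> x \<in> W \<and> is_sec t \<and> (\<forall>y\<in>W. s y = t y)"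
  shows "is_sec s"
proof (rule is_secI, rule smooth_map_on_local)
  fix U \<Phi> x assume c: "(U, \<Phi>) \<in> T" and x: "x \<in> U"
  obtain W t where W: "open W" "x \<in> W" "is_sec t" "\<forall>y\<in>W. s y = t y" using assms by blast
  have "smooth_map_on A (U \<inter> W) (\<lambda>x. \<Phi> x (s x))"
    by (rule smooth_map_on_cong[OF _ _ smooth_map_on_subset[OF is_secD[OF W(3) c]]])
      (use W triv_open[OF c] in auto)
  then show "\<exists>W'. open W' \<and> x \<in> W' \<and> smooth_map_on A W' (\<lambda>x. \<Phi> x (s x))"
    using W x triv_open[OF c] by blast
qed

lemma sec_extend:
  assumes "(U, \<Phi>) \<in> T" "closed K" "K \<subseteq> U" "\<And>y. y \<notin> K \<Longrightarrow> \<rho> y = 0" "smooth_fun A \<rho>"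
  shows "is_sec (\<lambda>x. \<rho> x *\<^sub>R inv (\<Phi> x) a)"
proof (rule is_secI)
  fix V \<Psi> assume c: "(V, \<Psi>) \<in> T"
  have "smooth_map_on A V (\<lambda>x. \<rho> x *\<^sub>R \<Psi> x (inv (\<Phi> x) a))"
    by (rule smooth_map_on_extend[OF triv_open[OF assms(1)] assms(2-5) triv_open[OF c]
          smooth_map_on_subset[OF triv_transition[OF assms(1) c]]]) auto
  then show "smooth_map_on A V (\<lambda>x. \<Psi> x (\<rho> x *\<^sub>R inv (\<Phi> x) a))"
    by (rule smooth_map_on_cong[OF triv_open[OF c], rotated])
      (simp add: linear_cmul[OF triv_linear[OF c]])
qed

text \<open>The basis sections of a trivialisation are multiplied by a cutoff, so that they become
  global smooth sections, and remain untouched on the smaller set where the cutoff is 1.\<close>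

lemma local_frame:
  obtains W s where "open W" "x \<in> W" "\<And>b. is_sec (s b)"
    "\<And>y v. y \<in> W \<Longrightarrow> \<exists>c::'v. v = (\<Sum>b\<in>Basis. (c \<bullet> b) *\<^sub>R s b y)"
    "\<And>y c. y \<in> W \<Longrightarrow> (\<Sum>b\<in>Basis. (c \<bullet> b) *\<^sub>R s b y) = 0 \<Longrightarrow> (c::'v) = 0"
proof -
  obtain U \<Phi> where u: "(U, \<Phi>) \<in> T" "x \<in> U" by (rule triv_cover)
  obtain \<rho> W K where \<rho>: "smooth_fun A \<rho>" "open W" "x \<in> W" "W \<subseteq> U" "\<And>y. y \<in> W \<Longrightarrow> \<rho> y = 1"
    "closed K" "K \<subseteq> U" "\<And>y. y \<notin> K \<Longrightarrow> \<rho> y = 0"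
    using smooth_bump_function[OF triv_open[OF u(1)] u(2)] by metis
  define s where "s b y = \<rho> y *\<^sub>R inv (\<Phi> y) b" for b y
  have eq: "(\<Sum>b\<in>Basis. (c \<bullet> b) *\<^sub>R s b y) = inv (\<Phi> y) c" if "y \<in> W" for c y
  proof -
    have y: "y \<in> U" using that \<rho> by auto
    have "\<Phi> y (\<Sum>b\<in>Basis. (c \<bullet> b) *\<^sub>R s b y) = (\<Sum>b\<in>Basis. (c \<bullet> b) *\<^sub>R b)"
      using that \<rho>(5) surj_f_inv_f[OF bij_is_surj[OF triv_bij[OF u(1) y]]]
      by (simp add: linear_sum[OF triv_linear[OF u(1) y]] linear_cmul[OF triv_linear[OF u(1) y]] s_def)
    then show ?thesis
      using inv_f_f[OF bij_is_inj[OF triv_bij[OF u(1) y]]] by (metis euclidean_representation)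
  qed
  have "is_sec (s b)" for b
    unfolding s_def by (rule sec_extend[OF u(1) \<rho>(6-8,1)])
  moreover have "\<exists>c::'v. v = (\<Sum>b\<in>Basis. (c \<bullet> b) *\<^sub>R s b y)" if y: "y \<in> W" for y v
  proof -
    have "y \<in> U" using y \<rho> by auto
    then show ?thesis
      unfolding eq[OF y] using inv_f_f[OF bij_is_inj[OF triv_bij[OF u(1)]], of y v] by metis
  qed
  moreover have "c = 0" if y: "y \<in> W" and "(\<Sum>b\<in>Basis. (c \<bullet> b) *\<^sub>R s b y) = 0" for y c
  proof -
    have yU: "y \<in> U" using y \<rho> by auto
    show ?thesis
      using that(2) surj_f_inv_f[OF bij_is_surj[OF triv_bij[OF u(1) yU]], of c]
      unfolding eq[OF y] by (simp add: linear_0[OF triv_linear[OF u(1) yU]])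
  qed
  ultimately show ?thesis using that \<rho>(2,3) by blast
qed

text \<open>An indefinite metric can have null frame vectors, which obstruct orthonormalisation of a
  given frame. The dual frame is instead read off from the inverse of the Gram matrix, whose entries
  are smooth because Cramer's rule expresses them as quotients of determinants.\<close>

lemma local_dual_frame:
  obtains W s t where "open W" "x \<in> W" "\<And>b. is_sec (s b)" "\<And>b. is_sec (t b)"
    "\<And>y. y \<in> W \<Longrightarrow> dual_frame (m y) (\<lambda>b. s b y) (\<lambda>b. t b y)"
proof -
  obtain W s where s: "open W" "x \<in> W" "\<And>b. is_sec (s b)"
    and span: "\<And>y v. y \<in> W \<Longrightarrow> \<exists>c::'v. v = (\<Sum>b\<in>Basis. (c \<bullet> b) *\<^sub>R s b y)"
    and indep: "\<And>y c. y \<in> W \<Longrightarrow> (\<Sum>b\<in>Basis. (c \<bullet> b) *\<^sub>R s b y) = 0 \<Longrightarrow> (c::'v) = 0"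
    by (rule local_frame[of x], rule that; assumption)
  obtain \<rho> W' K where \<rho>: "smooth_fun A \<rho>" "open W'" "x \<in> W'" "W' \<subseteq> W" "\<And>y. y \<in> W' \<Longrightarrow> \<rho> y = 1"
    "closed K" "K \<subseteq> W" "\<And>y. y \<notin> K \<Longrightarrow> \<rho> y = 0"
    using smooth_bump_function[OF s(1,2)] by metis
  define r where "r = (Rep_basis_index :: 'v basis_index \<Rightarrow> 'v)"
  define M :: "'m \<Rightarrow> real ^ 'v basis_index ^ 'v basis_index"
    where "M y = (\<chi> i j. m y (s (r i) y) (s (r j) y))" for y
  \<comment> \<open>The row \<open>N y k\<close> is the solution of
    \<open>M y *v z = axis k 1\<close> given by Cramer's rule, that is, a row of the inverse Gram
    matrix.\<close>
  define N :: "'m \<Rightarrow> 'v basis_index \<Rightarrow> 'v basis_index \<Rightarrow> real" where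
    "N y k l = det (\<chi> i j. if j = l then axis k 1 $ i else M y $ i $ j) * inverse (det (M y))"
    for y k l
  have det_smooth: "smooth_map_on A W (\<lambda>y. det (\<chi> i j. F y i j))"
    if "\<And>i j. smooth_map_on A W (\<lambda>y. F y i j)" for F :: "'m \<Rightarrow> 'v basis_index \<Rightarrow> 'v basis_index \<Rightarrow> real"
    unfolding det_def
    by (intro smooth_map_on_sum smooth_map_on_mult smooth_map_on_prod smooth_map_on_const s(1))
      (simp add: that)
  have M_smooth: "smooth_map_on A W (\<lambda>y. M y $ i $ j)" for i j
    unfolding M_def using smooth_map_on_subset[OF m_smooth[OF s(3) s(3)]] by simp
  \<comment> \<open>A kernel vector of the Gram matrix gives a combination of frame vectors
    orthogonal to the whole fibre. It vanishes by nondegeneracy, and its coefficients vanish by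
    independence of the frame.\<close>
  have detM: "det (M y) \<noteq> 0" if y: "y \<in> W" for y
  proof -
    have "c = 0" if c: "M y *v c = 0" for c
    proof -
      define a where "a = (\<Sum>j\<in>UNIV. c $ j *\<^sub>R r j)"
      have ar: "a \<bullet> r j = c $ j" for j
      proof -
        have "a \<bullet> r j = (\<Sum>i\<in>UNIV. c $ i * (if i = j then 1 else 0))"
          unfolding a_def inner_sum_left
          by (intro sum.cong) (auto simp: r_def inner_Basis Rep_basis_index Rep_basis_index_inject)
        then show ?thesis by (simp add: if_distrib cong: if_cong)
      qed
      define v where "v = (\<Sum>b\<in>Basis. (a \<bullet> b) *\<^sub>R s b y)"
      have v: "v = (\<Sum>j\<in>UNIV. c $ j *\<^sub>R s (r j) y)"
        using sum_basis_index[of "\<lambda>b. (a \<bullet> b) *\<^sub>R s b y"] ar by (simp add: v_def r_def)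
      have sv: "m y (s (r i) y) v = 0" for i
      proof -
        have "m y (s (r i) y) v = (M y *v c) $ i"
          unfolding v M_def matrix_vector_mult_def
          by (simp add: bilinear_sum_right[OF m_bilinear] bilinear_rmul[OF m_bilinear] mult.commute)
        then show ?thesis by (simp add: c)
      qed
      have sv': "m y (s b y) v = 0" if "b \<in> Basis" for b
        using sv[of "Abs_basis_index b"] that by (simp add: r_def Abs_basis_index_inverse)
      have "m y v w = 0" for w
      proof -
        obtain d where "w = (\<Sum>b\<in>Basis. (d \<bullet> b) *\<^sub>R s b y)" using span[OF y] by blast
        then have "m y w v = 0"
          by (simp add: bilinear_sum_left[OF m_bilinear] bilinear_lmul[OF m_bilinear] sv')
        then show ?thesis by (simp add: m_sym)
      qed
      then have "v = 0" using m_nondegenerate[of y] unfolding nondegenerate_def by blast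
      then have "a = 0" unfolding v_def using indep[OF y] by blast
      then show "c = 0" using ar by (simp add: vec_eq_iff)
    qed
    then have "\<exists>B. B ** M y = mat 1" unfolding matrix_left_invertible_ker by blast
    then show ?thesis using invertible_left_inverse invertible_det_nz by blast
  qed
  have N_smooth: "smooth_map_on A W (\<lambda>y. N y k l)" for k l
  proof -
    have "smooth_map_on A W (\<lambda>y. if j = l then axis k 1 $ i else M y $ i $ j)" for i j
      by (cases "j = l") (simp_all add: smooth_map_on_const M_smooth)
    then have "smooth_map_on A W (\<lambda>y. det (\<chi> i j. if j = l then axis k 1 $ i else M y $ i $ j))"
      by (rule det_smooth)
    moreover have "smooth_map_on A W (\<lambda>y. det (M y))"
      using det_smooth[of "\<lambda>y i j. M y $ i $ j"] by (simp add: M_smooth)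
    ultimately show ?thesis
      unfolding N_def by (intro smooth_map_on_mult smooth_map_on_inverse s(1) detM)
  qed
  have MN: "(\<Sum>j\<in>UNIV. M y $ i $ j * N y k j) = (if i = k then 1 else 0)" if "y \<in> W" for y i k
  proof -
    have "M y *v (\<chi> l. N y k l) = axis k 1"
      unfolding cramer[OF detM[OF that]] N_def by (simp add: divide_inverse)
    then have "(M y *v (\<chi> l. N y k l)) $ i = axis k 1 $ i" by simp
    then show ?thesis by (simp add: matrix_vector_mult_def axis_def)
  qed
  \<comment> \<open>The coefficients are smooth only on \<open>W\<close>; the cutoff
    \<open>\<rho>\<close> makes these global sections, and equals 1 on \<open>W'\<close>, where
    duality is claimed.\<close>
  define t where "t b y = (\<Sum>j\<in>UNIV. (\<rho> y *\<^sub>R N y (Abs_basis_index b) j) *\<^sub>R s (r j) y)" for b y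
  show ?thesis
  proof (rule that[of W' s t])
    show "is_sec (t b)" for b
      unfolding t_def
      by (intro sec_sum sec_scale s(3) smooth_map_on_extend[OF s(1) \<rho>(6-8,1) open_UNIV])
        (simp_all add: N_smooth)
    fix y assume y: "y \<in> W'"
    then have yW: "y \<in> W" using \<rho> by auto
    have "m y (s b y) (t c y) = (if b = c then 1 else 0)" if "b \<in> Basis" "c \<in> Basis" for b c
    proof -
      have b: "b = r (Abs_basis_index b)" using that by (simp add: r_def Abs_basis_index_inverse)
      have "m y (s b y) (t c y) =
          (\<Sum>j\<in>UNIV. M y $ Abs_basis_index b $ j * N y (Abs_basis_index c) j)"
        unfolding t_def using y \<rho>(5) b
        by (simp add: bilinear_sum_right[OF m_bilinear] bilinear_rmul[OF m_bilinear] M_def mult.commute)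
      also have "\<dots> = (if b = c then 1 else 0)"
        using MN[OF yW] that by (simp add: Abs_basis_index_inject)
      finally show ?thesis .
    qed
    then show "dual_frame (m y) (\<lambda>b. s b y) (\<lambda>b. t b y)" by (simp add: dual_frame_def)
  qed (use \<rho> s in auto)
qed

section \<open>Tensorial operators\<close>

lemma ext_section:
  shows is_sec_ext: "is_sec (ext A T x p)" and ext_at: "ext A T x p x = p"
proof -
  obtain W s t where st: "x \<in> W" "\<And>b. is_sec (s b)"
    "\<And>y. y \<in> W \<Longrightarrow> dual_frame (m y) (\<lambda>b. s b y) (\<lambda>b. t b y)"
    using local_dual_frame by metis
  have "is_sec (\<lambda>y. \<Sum>b\<in>Basis. m x p (t b x) *\<^sub>R s b y)"
    by (intro sec_sum sec_scale_const st)
  moreover have "p = (\<Sum>b\<in>Basis. m x p (t b x) *\<^sub>R s b x)"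
    by (rule dual_frame_expand[OF m_bilinear st(3)[OF st(1)]])
  ultimately have "\<exists>s. is_sec s \<and> s x = p" by metis
  from someI_ex[OF this] show "is_sec (ext A T x p)" "ext A T x p x = p"
    unfolding ext_def by auto
qed

definition tensorial :: "'m \<Rightarrow> (('m \<Rightarrow> 'v) \<Rightarrow> 'c::real_vector) \<Rightarrow> bool" where
  "tensorial x F \<longleftrightarrow> (\<forall>s t. is_sec s \<and> is_sec t \<longrightarrow> F (\<lambda>y. s y + t y) = F s + F t) \<and>
    (\<forall>f s. smooth_fun A f \<and> is_sec s \<longrightarrow> F (\<lambda>y. f y *\<^sub>R s y) = f x *\<^sub>R F s)"

lemma tensorialI:
  assumes "\<And>s t. is_sec s \<Longrightarrow> is_sec t \<Longrightarrow> F (\<lambda>y. s y + t y) = F s + F t"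
    "\<And>f s. smooth_fun A f \<Longrightarrow> is_sec s \<Longrightarrow> F (\<lambda>y. f y *\<^sub>R s y) = f x *\<^sub>R F s"
  shows "tensorial x F"
  using assms unfolding tensorial_def by blast

text \<open>A section is first multiplied by a cutoff that is 1 at \<open>x\<close>, which leaves
  the value of the operator unchanged, and only then expanded in a local frame. The coefficients are
  then globally smooth and can be pulled out.\<close>

lemma tensorial_linear:
  assumes "tensorial x F"
  obtains L where "linear L" "\<And>s. is_sec s \<Longrightarrow> F s = L (s x)"
proof -
  have add: "F (\<lambda>y. s y + t y) = F s + F t" if "is_sec s" "is_sec t" for s t
    using assms that unfolding tensorial_def by blast
  have scale: "F (\<lambda>y. f y *\<^sub>R s y) = f x *\<^sub>R F s" if "smooth_fun A f" "is_sec s" for f s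
    using assms that unfolding tensorial_def by blast
  have zero: "F (\<lambda>_. 0) = 0" using scale[OF smooth_map_on_const sec_zero, of 0] by simp
  have fsum: "F (\<lambda>y. \<Sum>i\<in>I. s i y) = (\<Sum>i\<in>I. F (s i))" if "\<And>i. is_sec (s i)" for I s
    by (induction I rule: infinite_finite_induct) (simp_all add: zero add sec_sum that)
  obtain W s t where st: "open W" "x \<in> W" "\<And>b. is_sec (s b)" "\<And>b. is_sec (t b)"
    "\<And>y. y \<in> W \<Longrightarrow> dual_frame (m y) (\<lambda>b. s b y) (\<lambda>b. t b y)"
    using local_dual_frame by metis
  obtain \<rho> W' K where \<rho>: "smooth_fun A \<rho>" "x \<in> W'" "\<And>y. y \<in> W' \<Longrightarrow> \<rho> y = 1" "K \<subseteq> W"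
    "\<And>y. y \<notin> K \<Longrightarrow> \<rho> y = 0"
    using smooth_bump_function[OF st(1,2)] by metis
  define L where "L p = (\<Sum>b\<in>Basis. m x p (t b x) *\<^sub>R F (s b))" for p
  have "linear L" unfolding L_def
    by (rule linearI)
      (simp_all add: bilinear_ladd[OF m_bilinear] bilinear_lmul[OF m_bilinear] algebra_simps
        sum.distrib scaleR_sum_right)
  moreover have "F u = L (u x)" if u: "is_sec u" for u
  proof -
    have e: "\<rho> y *\<^sub>R u y = (\<Sum>b\<in>Basis. (\<rho> y * m y (u y) (t b y)) *\<^sub>R s b y)" for y
    proof (cases "y \<in> W")
      case True
      show ?thesis
        by (subst dual_frame_expand[OF m_bilinear st(5)[OF True], of "u y"])
          (simp add: scaleR_sum_right)
    next
      case False
      then have "y \<notin> K" using \<rho>(4) by blast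
      then show ?thesis using \<rho>(5) by simp
    qed
    have sm: "smooth_fun A (\<lambda>y. \<rho> y * m y (u y) (t b y))" for b
      by (intro smooth_map_on_mult open_UNIV \<rho> m_smooth u st)
    \<comment> \<open>Linearity over functions pulls \<open>\<rho>\<close> out with its value at
      \<open>x\<close>, which is 1.\<close>
    have "F u = F (\<lambda>y. \<rho> y *\<^sub>R u y)" using scale[OF \<rho>(1) u] \<rho>(3)[OF \<rho>(2)] by simp
    also have "\<dots> = (\<Sum>b\<in>Basis. F (\<lambda>y. (\<rho> y * m y (u y) (t b y)) *\<^sub>R s b y))"
      unfolding e by (rule fsum) (intro sec_scale sm st)
    also have "\<dots> = L (u x)"
      unfolding L_def using \<rho>(3)[OF \<rho>(2)] by (simp add: scale[OF sm st(3)])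
    finally show ?thesis .
  qed
  ultimately show ?thesis using that by blast
qed

lemma tensorial_cong:
  assumes "tensorial x F" "is_sec s" "is_sec t" "s x = t x"
  shows "F s = F t"
  using tensorial_linear[OF assms(1)] assms(2-4) by metis

text \<open>The choice of a section through \<open>p\<close> need not be linear in \<open>p\<close>;
  tensoriality makes the result depend on \<open>p\<close> alone and restores linearity.\<close>

lemma tensorial_ext_linear: "tensorial x F \<Longrightarrow> linear (\<lambda>p. F (ext A T x p))"
  using tensorial_linear[of x F] is_sec_ext ext_at by (metis (no_types, lifting) ext)

text \<open>The coefficients of \<open>w\<close> in a local frame are its pairings with the dual
  frame. A section defined fibrewise by a description is therefore smooth as soon as its pairings
  with smooth sections are.\<close>

lemma smooth_dual_section:
  assumes "\<And>x v. m x (w x) v = \<alpha> x v" and "\<And>s. is_sec s \<Longrightarrow> smooth_fun A (\<lambda>x. \<alpha> x (s x))"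
  shows "is_sec w"
proof (rule sec_local)
  fix x
  obtain W s t where st: "open W" "x \<in> W" "\<And>b. is_sec (s b)" "\<And>b. is_sec (t b)"
    "\<And>y. y \<in> W \<Longrightarrow> dual_frame (m y) (\<lambda>b. s b y) (\<lambda>b. t b y)"
    using local_dual_frame by metis
  have "is_sec (\<lambda>y. \<Sum>b\<in>Basis. \<alpha> y (t b y) *\<^sub>R s b y)"
    by (intro sec_sum sec_scale assms(2) st)
  moreover have "w y = (\<Sum>b\<in>Basis. \<alpha> y (t b y) *\<^sub>R s b y)" if "y \<in> W" for y
    using dual_frame_expand[OF m_bilinear st(5)[OF that], of "w y"] by (simp add: assms(1))
  ultimately show "\<exists>W t. open W \<and> x \<in> W \<and> is_sec t \<and> (\<forall>y\<in>W. w y = t y)"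
    using st(1,2) by blast
qed

end

section \<open>Torsion-free generalised connections\<close>

locale courant_geometry =
  fixes C :: "('m::{t2_space,second_countable_topology}, 'n::finite, 'v::euclidean_space) courant"
  assumes courant: "courant_algebroid C"
begin

sublocale E: metric_bundle "atlas C" "trivs C" "pairing C"
  using courant unfolding courant_algebroid_def
  by (intro metric_bundle.intro smooth_manifold.intro metric_bundle_axioms.intro) simp_all

lemmas courant_axioms =
  courant[unfolded courant_algebroid_def, THEN conjunct2, THEN conjunct2, THEN conjunct2,
    THEN conjunct1]
  courant[unfolded courant_algebroid_def, THEN conjunct2, THEN conjunct2, THEN conjunct2,
    THEN conjunct2, THEN conjunct1]
  courant[unfolded courant_algebroid_def, THEN conjunct2, THEN conjunct2, THEN conjunct2,
    THEN conjunct2, THEN conjunct2, THEN conjunct1]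
  courant[unfolded courant_algebroid_def, THEN conjunct2, THEN conjunct2, THEN conjunct2,
    THEN conjunct2, THEN conjunct2, THEN conjunct2, THEN conjunct1]
  courant[unfolded courant_algebroid_def, THEN conjunct2, THEN conjunct2, THEN conjunct2,
    THEN conjunct2, THEN conjunct2, THEN conjunct2, THEN conjunct2, THEN conjunct2,
    THEN conjunct1]
  courant[unfolded courant_algebroid_def, THEN conjunct2, THEN conjunct2, THEN conjunct2,
    THEN conjunct2, THEN conjunct2, THEN conjunct2, THEN conjunct2, THEN conjunct2,
    THEN conjunct2, THEN conjunct1]
  courant[unfolded courant_algebroid_def, THEN conjunct2, THEN conjunct2, THEN conjunct2,
    THEN conjunct2, THEN conjunct2, THEN conjunct2, THEN conjunct2, THEN conjunct2,
    THEN conjunct2, THEN conjunct2, THEN conjunct1]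

lemma anchor_linear: "linear (anchor C x)"
  and anc_vector_field: "sec C u \<Longrightarrow> vector_field (atlas C) (anc C u)"
  and bracket_sec: "sec C u \<Longrightarrow> sec C v \<Longrightarrow> sec C (bracket C u v)"
  using courant_axioms(1,2,3) by blast+

lemma bracket_add_right: "sec C u \<Longrightarrow> sec C v \<Longrightarrow> sec C w \<Longrightarrow>
    bracket C w (\<lambda>x. u x + v x) = (\<lambda>x. bracket C w u x + bracket C w v x)"
  using courant_axioms(4)[rule_format, of u v w] by blast

lemma bracket_jacobi: "sec C u \<Longrightarrow> sec C v \<Longrightarrow> sec C w \<Longrightarrow> bracket C u (bracket C v w) =
    (\<lambda>x. bracket C (bracket C u v) w x + bracket C v (bracket C u w) x)"
  using courant_axioms(5)[rule_format, of u v w] by blast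

lemma anc_bracket: "sec C u \<Longrightarrow> sec C v \<Longrightarrow>
    anc C (bracket C u v) = lie_bracket (atlas C) (anc C u) (anc C v)"
  using courant_axioms(6)[rule_format, of u v] by blast

lemma bracket_leibniz: "smooth_fun (atlas C) f \<Longrightarrow> sec C u \<Longrightarrow> sec C v \<Longrightarrow>
    bracket C u (\<lambda>x. f x *\<^sub>R v x) = (\<lambda>x. act C u f x *\<^sub>R v x + f x *\<^sub>R bracket C u v x)"
  using courant_axioms(7)[rule_format, of f u v] by blast

lemma act_eq: "act C u f x = tderiv (atlas C) x (anchor C x (u x)) f"
  by (simp add: vapply_def)

lemma act_smooth:
  "sec C u \<Longrightarrow> smooth_fun (atlas C) f \<Longrightarrow> smooth_fun (atlas C) (act C u f)"
  unfolding act_eq[abs_def] using E.smooth_map_on_tderiv[OF anc_vector_field open_UNIV] .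

lemmas smooth_intros = E.sec_add E.sec_scale E.is_sec_ext act_smooth bracket_sec
  E.smooth_map_on_mult[OF open_UNIV] E.smooth_map_on_add[OF open_UNIV] E.m_smooth

text \<open>Expanding the Jacobi identity for \<open>[u, [v, f w]]\<close> by the Leibniz rule leaves this
  identity multiplied by \<open>w\<close>.\<close>

lemma act_bracket:
  assumes uv: "sec C u" "sec C v" and f: "smooth_fun (atlas C) f"
  shows "act C (bracket C u v) f x = act C u (act C v f) x - act C v (act C u f) x"
proof -
  obtain p :: 'v where p: "p \<in> Basis" using nonempty_Basis by blast
  define w where "w = sext C x p"
  have w: "sec C w" "w x = p" unfolding w_def by (rule E.is_sec_ext, rule E.ext_at)
  note b = bracket_leibniz bracket_add_right smooth_intros uv f w(1)
  have 1: "bracket C u (bracket C v (\<lambda>x. f x *\<^sub>R w x)) x =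
      (act C u (act C v f) x *\<^sub>R w x + act C v f x *\<^sub>R bracket C u w x) +
      (act C u f x *\<^sub>R bracket C v w x + f x *\<^sub>R bracket C u (bracket C v w) x)"
    by (simp add: b)
  have 2: "bracket C v (bracket C u (\<lambda>x. f x *\<^sub>R w x)) x =
      (act C v (act C u f) x *\<^sub>R w x + act C u f x *\<^sub>R bracket C v w x) +
      (act C v f x *\<^sub>R bracket C u w x + f x *\<^sub>R bracket C v (bracket C u w) x)"
    by (simp add: b)
  have 3: "bracket C (bracket C u v) (\<lambda>x. f x *\<^sub>R w x) x =
      act C (bracket C u v) f x *\<^sub>R w x + f x *\<^sub>R bracket C (bracket C u v) w x"
    by (simp add: b)
  have 4: "bracket C u (bracket C v (\<lambda>x. f x *\<^sub>R w x)) x =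
      bracket C (bracket C u v) (\<lambda>x. f x *\<^sub>R w x) x + bracket C v (bracket C u (\<lambda>x. f x *\<^sub>R w x)) x"
    by (subst bracket_jacobi) (simp_all add: b)
  have 5: "bracket C u (bracket C v w) x =
      bracket C (bracket C u v) w x + bracket C v (bracket C u w) x"
    by (subst bracket_jacobi) (simp_all add: b)
  have "(act C (bracket C u v) f x - (act C u (act C v f) x - act C v (act C u f) x)) *\<^sub>R w x = 0"
    using 4 unfolding 1 2 3 5 by (simp add: algebra_simps)
  then show ?thesis using w(2) p nonzero_Basis by auto
qed

text \<open>The vector \<open>q\<close> is the differential of \<open>f\<close>, pulled back along
  the anchor and turned into an element of \<open>E\<close> by the scalar product.\<close>

lemma gradient_ex:
  assumes "smooth_fun (atlas C) f"
  obtains q where "\<And>v. pairing C x q v = tderiv (atlas C) x (anchor C x v) f"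
proof -
  have "\<exists>!q. \<forall>v. pairing C x q v = ((\<lambda>\<xi>. tderiv (atlas C) x \<xi> f) \<circ> anchor C x) v"
    by (intro nondegenerate_represent E.m_bilinear E.m_nondegenerate linear_compose
        anchor_linear E.tderiv_linear[OF assms UNIV_I])
  then show ?thesis using that by auto
qed

end

locale torsion_free_connection = courant_geometry C
  for C :: "('m::{t2_space,second_countable_topology}, 'n::finite, 'v::euclidean_space) courant" +
  fixes D :: "('m, 'v) gconn"
  assumes connection: "generalised_connection C D"
    and torsion_free: "sec C u \<Longrightarrow> sec C v \<Longrightarrow> sec C w \<Longrightarrow> torsion C D u v w x = 0"
begin

lemmas connection_axioms =
  connection[unfolded generalised_connection_def, THEN conjunct1]
  connection[unfolded generalised_connection_def, THEN conjunct2, THEN conjunct1]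
  connection[unfolded generalised_connection_def, THEN conjunct2, THEN conjunct2, THEN conjunct1]
  connection[unfolded generalised_connection_def, THEN conjunct2, THEN conjunct2, THEN conjunct2]

lemma D_sec: "sec C u \<Longrightarrow> sec C v \<Longrightarrow> sec C (D u v)"
  and D_add_left: "sec C u \<Longrightarrow> sec C v \<Longrightarrow> sec C w \<Longrightarrow>
    D (\<lambda>x. u x + v x) w = (\<lambda>x. D u w x + D v w x)"
  and D_add_right: "sec C u \<Longrightarrow> sec C v \<Longrightarrow> sec C w \<Longrightarrow>
    D w (\<lambda>x. u x + v x) = (\<lambda>x. D w u x + D w v x)"
  and D_scale_left: "smooth_fun (atlas C) f \<Longrightarrow> sec C u \<Longrightarrow> sec C v \<Longrightarrow>
    D (\<lambda>x. f x *\<^sub>R u x) v = (\<lambda>x. f x *\<^sub>R D u v x)"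
  and D_leibniz: "smooth_fun (atlas C) f \<Longrightarrow> sec C u \<Longrightarrow> sec C v \<Longrightarrow>
    D u (\<lambda>x. f x *\<^sub>R v x) = (\<lambda>x. act C u f x *\<^sub>R v x + f x *\<^sub>R D u v x)"
  and D_pairing: "sec C u \<Longrightarrow> sec C v \<Longrightarrow> sec C w \<Longrightarrow>
    act C u (ip C v w) = (\<lambda>x. ip C (D u v) w x + ip C v (D u w) x)"
  using connection_axioms(1)[rule_format, of u v] connection_axioms(2)[rule_format, of u v w]
    connection_axioms(3)[rule_format, of f u v] connection_axioms(4)[rule_format, of u v w]
  by blast+

lemma D_tensorial: "sec C v \<Longrightarrow> E.tensorial x (\<lambda>u. D u v x)"
  by (rule E.tensorialI) (simp_all add: D_add_left D_scale_left)

lemma torsion_eq: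
  "sec C u \<Longrightarrow> sec C v \<Longrightarrow> sec C w \<Longrightarrow>
    pairing C x (D u v x - D v u x - bracket C u v x) (w x) + pairing C x (D w u x) (v x) = 0"
  using torsion_free unfolding torsion_def by simp

section \<open>The generalised Riemann tensor as a tensor\<close>

abbreviation "Rm \<equiv> gen_riemann C D"

lemma D_pairing_linear: "sec C v \<Longrightarrow> linear (\<lambda>p. ip C (D (sext C x p) v) w x)"
  using linear_compose[OF E.tensorial_ext_linear[OF D_tensorial] bilinear_left[OF E.m_bilinear]]
  by (simp add: o_def)

text \<open>The two commutator terms trade places and the trace is symmetric in its two slots.
  Tensoriality in the last two arguments thereby reduces to that in the first two.\<close>

lemma Rm_swap:
  assumes "sec C v" "sec C b"
  shows "Rm a b v w x = Rm w v b a x"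
proof -
  have "metric_trace (pairing C x) (\<lambda>p q. ip C (D (sext C x p) v) w x * ip C (D (sext C x q) b) a x)
    = metric_trace (pairing C x) (\<lambda>p q. ip C (D (sext C x p) b) a x * ip C (D (sext C x q) v) w x)"
    by (subst metric_trace_swap[OF E.m_bilinear E.m_nondegenerate E.m_sym
          bilinear_mult[OF D_pairing_linear[OF assms(1)] D_pairing_linear[OF assms(2)]]])
      (simp add: mult.commute)
  then show ?thesis unfolding gen_riemann_def by simp
qed

lemmas conn_intros = smooth_intros D_sec
lemmas conn_simps = D_add_left D_add_right D_scale_left D_leibniz

lemma pairing_simps:
  "pairing C x (u + v) w = pairing C x u w + pairing C x v w"
  "pairing C x (u - v) w = pairing C x u w - pairing C x v w"
  "pairing C x (r *\<^sub>R u) w = r * pairing C x u w"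
  "pairing C x w (u + v) = pairing C x w u + pairing C x w v"
  "pairing C x w (u - v) = pairing C x w u - pairing C x w v"
  "pairing C x w (r *\<^sub>R u) = r * pairing C x w u"
  using E.m_bilinear[of x]
  by (simp_all add: bilinear_ladd bilinear_lsub bilinear_lmul bilinear_radd bilinear_rsub bilinear_rmul)

text \<open>The argument \<open>a\<close> is not differentiated as a section: it is paired with, or
  it is a direction in \<open>D2\<close>. In a direction \<open>D2\<close> is tensorial, since the
  subtracted connection term removes the derivative of the coefficient.\<close>

lemma Rm_tensorial_1:
  assumes "sec C b" "sec C v" "sec C w"
  shows "E.tensorial x (\<lambda>a. Rm a b v w x)"
proof (rule E.tensorialI)
  fix s t assume st: "sec C s" "sec C t"
  have "D2 D (\<lambda>y. s y + t y) b v x = D2 D s b v x + D2 D t b v x"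
    "D2 D b (\<lambda>y. s y + t y) v x = D2 D b s v x + D2 D b t v x"
    unfolding D2_def by (simp_all add: conn_simps conn_intros assms st)
  then show "Rm (\<lambda>y. s y + t y) b v w x = Rm s b v w x + Rm t b v w x"
    unfolding gen_riemann_def
    by (simp add: pairing_simps distrib_left metric_trace_add algebra_simps)
next
  fix f s assume f: "smooth_fun (atlas C) f" and s: "sec C s"
  have 1: "D2 D (\<lambda>y. f y *\<^sub>R s y) b v x = f x *\<^sub>R D2 D s b v x"
    unfolding D2_def by (simp add: conn_simps conn_intros assms s f algebra_simps)
  have 2: "D2 D b (\<lambda>y. f y *\<^sub>R s y) v x = f x *\<^sub>R D2 D b s v x"
    unfolding D2_def by (simp add: conn_simps conn_intros assms s f algebra_simps)
  show "Rm (\<lambda>y. f y *\<^sub>R s y) b v w x = f x *\<^sub>R Rm s b v w x"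
    unfolding gen_riemann_def 1 2
    by (simp add: pairing_simps metric_trace_cmult[symmetric] algebra_simps)
qed

text \<open>The vanishing torsion makes the derivatives of \<open>f\<close> in the commutator of second derivatives
  cancel those in the trace.\<close>

lemma Rm_tensorial_2:
  assumes "sec C a" "sec C v" "sec C w"
  shows "E.tensorial x (\<lambda>b. Rm a b v w x)"
proof (rule E.tensorialI)
  fix s t assume st: "sec C s" "sec C t"
  have "D2 D v w (\<lambda>y. s y + t y) x = D2 D v w s x + D2 D v w t x"
    "D2 D w v (\<lambda>y. s y + t y) x = D2 D w v s x + D2 D w v t x"
    "D2 D (\<lambda>y. s y + t y) a v x = D2 D s a v x + D2 D t a v x"
    "D2 D a (\<lambda>y. s y + t y) v x = D2 D a s v x + D2 D a t v x"
    unfolding D2_def by (simp_all add: conn_simps conn_intros assms st)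
  then show "Rm a (\<lambda>y. s y + t y) v w x = Rm a s v w x + Rm a t v w x"
    unfolding gen_riemann_def
    by (simp add: conn_simps conn_intros assms st pairing_simps distrib_left metric_trace_add
        algebra_simps)
next
  fix f b assume f: "smooth_fun (atlas C) f" and b: "sec C b"
  have 1: "D2 D (\<lambda>y. f y *\<^sub>R b y) a v x = f x *\<^sub>R D2 D b a v x"
    unfolding D2_def by (simp add: conn_simps conn_intros assms b f algebra_simps)
  have 2: "D2 D a (\<lambda>y. f y *\<^sub>R b y) v x = f x *\<^sub>R D2 D a b v x"
    unfolding D2_def by (simp add: conn_simps conn_intros assms b f algebra_simps)
  have 3: "D2 D u u' (\<lambda>y. f y *\<^sub>R b y) x =
      (act C u (act C u' f) x - act C (D u u') f x) *\<^sub>R b x + act C u' f x *\<^sub>R D u b x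
      + act C u f x *\<^sub>R D u' b x + f x *\<^sub>R D2 D u u' b x" if "sec C u" "sec C u'" for u u'
    unfolding D2_def using that by (simp add: conn_simps conn_intros b f algebra_simps)
  obtain q where q: "\<And>v. pairing C x q v = tderiv (atlas C) x (anchor C x v) f"
    using gradient_ex[OF f] by blast
  define Q where "Q = sext C x q"
  have Q: "sec C Q" "Q x = q" unfolding Q_def by (rule E.is_sec_ext, rule E.ext_at)
  define L where "L p = pairing C x (D (sext C x p) v x) (w x)" for p
  have L: "linear L" unfolding L_def using D_pairing_linear[OF assms(2)] .
  \<comment> \<open>The torsion identity is applied with the gradient as third argument: its last
    term is \<open>L q\<close>, and pairing with the gradient turns the other terms into derivatives
    of \<open>f\<close>.\<close>
  have "L q = - pairing C x q (D v w x - D w v x - bracket C v w x)"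
    using torsion_eq[OF assms(2,3) Q(1), of x] by (simp add: L_def Q_def[symmetric] Q(2) E.m_sym)
  also have "\<dots> = act C (bracket C v w) f x - (act C (D v w) f x - act C (D w v) f x)"
    by (simp add: pairing_simps q act_eq)
  finally have Lq: "L q = act C v (act C w f) x - act C w (act C v f) x
      - (act C (D v w) f x - act C (D w v) f x)"
    by (simp add: act_bracket assms f)
  \<comment> \<open>Differentiating the coefficient \<open>f\<close> contributes the pairing of the
    gradient with the direction, and tracing against it evaluates \<open>L\<close> at the
    gradient.\<close>
  have tr: "metric_trace (pairing C x) (\<lambda>p q. ip C (D (sext C x p) v) w x *
        ip C (D (sext C x q) (\<lambda>y. f y *\<^sub>R b y)) a x) =
      L q * pairing C x (b x) (a x) + f x * metric_trace (pairing C x)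
        (\<lambda>p q. ip C (D (sext C x p) v) w x * ip C (D (sext C x q) b) a x)"
  proof -
    have "metric_trace (pairing C x) (\<lambda>p q. ip C (D (sext C x p) v) w x *
          ip C (D (sext C x q) (\<lambda>y. f y *\<^sub>R b y)) a x) =
        metric_trace (pairing C x) (\<lambda>p r. pairing C x (b x) (a x) * (L p * pairing C x q r) +
          f x * (ip C (D (sext C x p) v) w x * ip C (D (sext C x r) b) a x))"
      by (intro arg_cong2[where f = metric_trace] refl ext)
        (simp add: conn_simps conn_intros f b pairing_simps L_def q act_eq E.ext_at algebra_simps)
    then show ?thesis
      by (simp only: metric_trace_add metric_trace_cmult
          metric_trace_represent[OF E.m_bilinear E.m_nondegenerate E.m_sym L] mult.commute)
  qed
  show "Rm a (\<lambda>y. f y *\<^sub>R b y) v w x = f x *\<^sub>R Rm a b v w x"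
    unfolding gen_riemann_def 1 2 3[OF assms(2,3)] 3[OF assms(3,2)] tr
    by (simp add: pairing_simps Lq algebra_simps)
qed

lemma Rm_tensorial_3: "sec C a \<Longrightarrow> sec C b \<Longrightarrow> sec C w \<Longrightarrow> E.tensorial x (\<lambda>v. Rm a b v w x)"
  using Rm_tensorial_2[of w b a x] Rm_swap[of _ b a w x]
  unfolding E.tensorial_def by (simp add: E.sec_add E.sec_scale)

lemma Rm_tensorial_4: "sec C a \<Longrightarrow> sec C b \<Longrightarrow> sec C v \<Longrightarrow> E.tensorial x (\<lambda>w. Rm a b v w x)"
  using Rm_tensorial_1[of v b a x] Rm_swap[of v b a _ x]
  unfolding E.tensorial_def by (simp add: E.sec_add E.sec_scale)

lemma Rm_cong:
  assumes s: "sec C a" "sec C b" "sec C v" "sec C w" "sec C a'" "sec C b'" "sec C v'" "sec C w'"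
    and e: "a x = a' x" "b x = b' x" "v x = v' x" "w x = w' x"
  shows "Rm a b v w x = Rm a' b' v' w' x"
proof -
  have "Rm a b v w x = Rm a' b v w x"
    by (rule E.tensorial_cong[OF Rm_tensorial_1]) (use s e in auto)
  also have "\<dots> = Rm a' b' v w x"
    by (rule E.tensorial_cong[OF Rm_tensorial_2]) (use s e in auto)
  also have "\<dots> = Rm a' b' v' w x"
    by (rule E.tensorial_cong[OF Rm_tensorial_3]) (use s e in auto)
  also have "\<dots> = Rm a' b' v' w' x"
    by (rule E.tensorial_cong[OF Rm_tensorial_4]) (use s e in auto)
  finally show ?thesis .
qed

text \<open>The extensions are the same chosen ones as in \<open>gen_ricci\<close> and
  \<open>gen_scalar\<close>, so those traces unfold to traces of \<open>Rmx\<close> without further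
  argument.\<close>

definition Rmx :: "'m \<Rightarrow> 'v \<Rightarrow> 'v \<Rightarrow> 'v \<Rightarrow> 'v \<Rightarrow> real" where
  "Rmx x p q r s = Rm (sext C x p) (sext C x q) (sext C x r) (sext C x s) x"

lemma Rmx_eq:
  "sec C a \<Longrightarrow> sec C b \<Longrightarrow> sec C v \<Longrightarrow> sec C w \<Longrightarrow> Rmx x (a x) (b x) (v x) (w x) = Rm a b v w x"
  unfolding Rmx_def by (rule Rm_cong) (simp_all add: E.is_sec_ext E.ext_at)

lemma Rmx_linear:
  "linear (\<lambda>p. Rmx x p q r s)" "linear (\<lambda>q. Rmx x p q r s)"
  "linear (\<lambda>r. Rmx x p q r s)" "linear (\<lambda>s. Rmx x p q r s)"
  unfolding Rmx_def
  by (rule E.tensorial_ext_linear[OF Rm_tensorial_1] E.tensorial_ext_linear[OF Rm_tensorial_2]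
      E.tensorial_ext_linear[OF Rm_tensorial_3] E.tensorial_ext_linear[OF Rm_tensorial_4];
      rule E.is_sec_ext)+

lemma gen_scalar_eq:
  "gen_scalar C G D x = (1 / 2) * metric_trace (G x)
     (\<lambda>q s. metric_trace (pairing C x) (\<lambda>p r. Rmx x p q r s))"
  unfolding gen_scalar_def gen_ricci_def Rmx_def ..

end

section \<open>The Levi-Civita connection\<close>

text \<open>\<open>lie_bracket\<close> is a definite description, so its action on functions must be
  justified separately. It is assumed here and later derived from the bracket of the Courant
  algebroid.\<close>

locale levi_civita_geometry = metric_bundle A "tangent_trivs A" g
  for A :: "('m::{t2_space,second_countable_topology}, 'n::finite) atlas"
    and g :: "'m \<Rightarrow> real ^ 'n \<Rightarrow> real ^ 'n \<Rightarrow> real" +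
  fixes nabla :: "('m \<Rightarrow> real ^ 'n) \<Rightarrow> ('m \<Rightarrow> real ^ 'n) \<Rightarrow> 'm \<Rightarrow> real ^ 'n"
  assumes levi_civita: "levi_civita A g nabla"
    and lie_bracket_apply: "vector_field A X \<Longrightarrow> vector_field A Y \<Longrightarrow> smooth_fun A f \<Longrightarrow>
      vapply A (lie_bracket A X Y) f x = vapply A X (vapply A Y f) x - vapply A Y (vapply A X f) x"
begin

lemmas levi_civita_axioms =
  levi_civita[unfolded levi_civita_def, THEN conjunct1]
  levi_civita[unfolded levi_civita_def, THEN conjunct2, THEN conjunct1]
  levi_civita[unfolded levi_civita_def, THEN conjunct2, THEN conjunct2, THEN conjunct1]
  levi_civita[unfolded levi_civita_def, THEN conjunct2, THEN conjunct2, THEN conjunct2, THEN conjunct1]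
  levi_civita[unfolded levi_civita_def, THEN conjunct2, THEN conjunct2, THEN conjunct2, THEN conjunct2]

lemma nabla_field: "is_sec X \<Longrightarrow> is_sec Y \<Longrightarrow> is_sec (nabla X Y)"
  and nabla_add_left: "is_sec X \<Longrightarrow> is_sec Y \<Longrightarrow> is_sec Z \<Longrightarrow>
    nabla (\<lambda>x. X x + Y x) Z = (\<lambda>x. nabla X Z x + nabla Y Z x)"
  and nabla_add_right: "is_sec X \<Longrightarrow> is_sec Y \<Longrightarrow> is_sec Z \<Longrightarrow>
    nabla Z (\<lambda>x. X x + Y x) = (\<lambda>x. nabla Z X x + nabla Z Y x)"
  and nabla_scale_left: "smooth_fun A f \<Longrightarrow> is_sec X \<Longrightarrow> is_sec Y \<Longrightarrow>
    nabla (\<lambda>x. f x *\<^sub>R X x) Y = (\<lambda>x. f x *\<^sub>R nabla X Y x)"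
  and nabla_leibniz: "smooth_fun A f \<Longrightarrow> is_sec X \<Longrightarrow> is_sec Y \<Longrightarrow>
    nabla X (\<lambda>x. f x *\<^sub>R Y x) = (\<lambda>x. vapply A X f x *\<^sub>R Y x + f x *\<^sub>R nabla X Y x)"
  and lie_bracket_eq: "is_sec X \<Longrightarrow> is_sec Y \<Longrightarrow>
    lie_bracket A X Y = (\<lambda>x. nabla X Y x - nabla Y X x)"
  and nabla_metric: "is_sec X \<Longrightarrow> is_sec Y \<Longrightarrow> is_sec Z \<Longrightarrow>
    vapply A X (\<lambda>x. g x (Y x) (Z x)) = (\<lambda>x. g x (nabla X Y x) (Z x) + g x (Y x) (nabla X Z x))"
  using levi_civita_axioms(1)[rule_format, of X Y] levi_civita_axioms(2)[rule_format, of X Y Z]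
    levi_civita_axioms(3)[rule_format, of f X Y] levi_civita_axioms(4)[rule_format, of X Y]
    levi_civita_axioms(5)[rule_format, of X Y Z]
  by (blast | simp)+

lemma nabla_diff_left: "is_sec X \<Longrightarrow> is_sec Y \<Longrightarrow> is_sec Z \<Longrightarrow>
    nabla (\<lambda>x. X x - Y x) Z = (\<lambda>x. nabla X Z x - nabla Y Z x)"
  using nabla_add_left[of X "\<lambda>x. - 1 *\<^sub>R Y x" Z] nabla_scale_left[OF smooth_map_on_const, of Y Z "- 1"]
    sec_scale_const[of Y "- 1"] by simp

lemma nabla_tensorial: "is_sec Y \<Longrightarrow> tensorial x (\<lambda>X. nabla X Y x)"
  by (rule tensorialI) (simp_all add: nabla_add_left nabla_scale_left)

lemma vapply_smooth: "is_sec X \<Longrightarrow> smooth_fun A f \<Longrightarrow> smooth_fun A (vapply A X f)"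
  unfolding vapply_def[abs_def] using smooth_map_on_tderiv[OF _ open_UNIV] .

lemma nabla_zero_right: "is_sec X \<Longrightarrow> nabla X (\<lambda>_. 0) = (\<lambda>_. 0)"
  using nabla_leibniz[OF smooth_map_on_const, of X "\<lambda>_. 0" 0] sec_zero by (simp add: vapply_def tderiv_const)

lemma nabla_sum_right:
  "is_sec X \<Longrightarrow> (\<And>i. i \<in> I \<Longrightarrow> is_sec (Y i)) \<Longrightarrow>
    nabla X (\<lambda>x. \<Sum>i\<in>I. Y i x) = (\<lambda>x. \<Sum>i\<in>I. nabla X (Y i) x)"
  by (induction I rule: infinite_finite_induct) (simp_all add: nabla_zero_right nabla_add_right sec_sum)

text \<open>Multiplying by a cutoff equal to 1 near \<open>x\<close> makes the two fields globally
  equal; its derivative at \<open>x\<close> multiplies values that already agree there.\<close>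

lemma nabla_local:
  assumes X: "is_sec X" and YZ: "is_sec Y" "is_sec Z" and W: "open W" "x \<in> W"
    and eq: "\<And>y. y \<in> W \<Longrightarrow> Y y = Z y"
  shows "nabla X Y x = nabla X Z x"
proof -
  obtain \<rho> W' K where \<rho>: "smooth_fun A \<rho>" "x \<in> W'" "\<And>y. y \<in> W' \<Longrightarrow> \<rho> y = 1" "K \<subseteq> W"
    "\<And>y. y \<notin> K \<Longrightarrow> \<rho> y = 0"
    using smooth_bump_function[OF W] by metis
  have "\<rho> y *\<^sub>R Y y = \<rho> y *\<^sub>R Z y" for y
    using eq[of y] \<rho>(4,5) by (cases "y \<in> W") auto
  then have "(\<lambda>y. \<rho> y *\<^sub>R Y y) = (\<lambda>y. \<rho> y *\<^sub>R Z y)" by (rule ext)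
  then have "nabla X (\<lambda>y. \<rho> y *\<^sub>R Y y) x = nabla X (\<lambda>y. \<rho> y *\<^sub>R Z y) x" by (rule arg_cong)
  then show ?thesis
    by (simp add: nabla_leibniz \<rho>(1) X YZ eq[OF W(2)] \<rho>(3)[OF \<rho>(2)])
qed

section \<open>The Riemann tensor of the base and its traces\<close>

lemma vapply_diff_left: "smooth_fun A f \<Longrightarrow>
    vapply A (\<lambda>x. X x - Y x) f x = vapply A X f x - vapply A Y f x"
  by (simp add: vapply_def linear_diff[OF tderiv_linear])

text \<open>Vanishing torsion trades the Lie bracket for \<nabla>, after which tensoriality follows
  from the rules of the connection.\<close>

lemma riemann_eq: "is_sec X \<Longrightarrow> is_sec Y \<Longrightarrow> is_sec Z \<Longrightarrow> riemann A nabla X Y Z x =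
    nabla X (nabla Y Z) x - nabla Y (nabla X Z) x - (nabla (nabla X Y) Z x - nabla (nabla Y X) Z x)"
  by (simp add: riemann_def lie_bracket_eq nabla_diff_left nabla_field)

lemmas nabla_intros = sec_add sec_scale sec_diff nabla_field vapply_smooth
lemmas nabla_simps = nabla_add_left nabla_add_right nabla_scale_left nabla_leibniz

lemma riemann_tensorial_1:
  assumes "is_sec Y" "is_sec Z"
  shows "tensorial x (\<lambda>X. riemann A nabla X Y Z x)"
  by (rule tensorialI)
    (simp_all add: riemann_eq nabla_simps nabla_intros assms algebra_simps)

lemma riemann_tensorial_2:
  assumes "is_sec X" "is_sec Z"
  shows "tensorial x (\<lambda>Y. riemann A nabla X Y Z x)"
  by (rule tensorialI)
    (simp_all add: riemann_eq nabla_simps nabla_intros assms algebra_simps)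

text \<open>The derivatives of the coefficient that survive form the commutator of \<open>X\<close>
  and \<open>Y\<close> on \<open>f\<close> minus the derivative along their Lie bracket, which is
  zero.\<close>

lemma riemann_tensorial_3:
  assumes "is_sec X" "is_sec Y"
  shows "tensorial x (\<lambda>Z. riemann A nabla X Y Z x)"
proof (rule tensorialI)
  fix f Z assume f: "smooth_fun A f" and Z: "is_sec Z"
  have "vapply A X (vapply A Y f) x - vapply A Y (vapply A X f) x =
      vapply A (nabla X Y) f x - vapply A (nabla Y X) f x"
    using lie_bracket_apply[OF assms f, of x] by (simp add: lie_bracket_eq assms vapply_diff_left f)
  then have "vapply A X (vapply A Y f) x *\<^sub>R Z x = vapply A Y (vapply A X f) x *\<^sub>R Z x +
      vapply A (nabla X Y) f x *\<^sub>R Z x - vapply A (nabla Y X) f x *\<^sub>R Z x"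
    by (simp flip: scaleR_left.add scaleR_left.diff)
  then show "riemann A nabla X Y (\<lambda>y. f y *\<^sub>R Z y) x = f x *\<^sub>R riemann A nabla X Y Z x"
    by (simp add: riemann_eq nabla_simps nabla_intros assms f Z algebra_simps)
qed (simp_all add: riemann_eq nabla_simps nabla_intros assms algebra_simps)

text \<open>Duality is asked at the single point \<open>x\<close>, which is enough to evaluate
  traces there; where the frame itself is differentiated, duality is assumed on a
  neighbourhood.\<close>

abbreviation dual_fields :: "'m \<Rightarrow> (real ^ 'n \<Rightarrow> 'm \<Rightarrow> real ^ 'n) \<Rightarrow> (real ^ 'n \<Rightarrow> 'm \<Rightarrow> real ^ 'n) \<Rightarrow> bool"
  where "dual_fields x F F' \<equiv> (\<forall>b. is_sec (F b)) \<and> (\<forall>b. is_sec (F' b)) \<and>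
    dual_frame (g x) (\<lambda>b. F b x) (\<lambda>b. F' b x)"

lemma dual_fields_swap: "dual_fields x F F' \<Longrightarrow> dual_fields x F' F"
  using dual_frame_sym m_sym by blast

lemma trace_dual_fields:
  assumes "bilinear B" "dual_fields x F F'"
  shows "metric_trace (g x) B = (\<Sum>b\<in>Basis. B (F b x) (F' b x))"
  using metric_trace_frame[OF m_bilinear m_nondegenerate m_sym assms(1)
      dual_frame_expand[OF m_bilinear]] assms(2) by blast

lemma endo_trace_dual_fields:
  assumes "linear L" "dual_fields x F F'"
  shows "endo_trace L = (\<Sum>b\<in>Basis. g x (L (F b x)) (F' b x))"
  using endo_trace_frame[OF m_bilinear assms(1) dual_frame_expand[OF m_bilinear]] assms(2) by blast

lemma vdiv_dual_fields:
  assumes "is_sec X" "dual_fields x F F'"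
  shows "vdiv A nabla X x = (\<Sum>b\<in>Basis. g x (nabla (F b) X x) (F' b x))"
  unfolding vdiv_def
  by (subst endo_trace_dual_fields[OF tensorial_ext_linear[OF nabla_tensorial[OF assms(1)]] assms(2)])
    (use assms tensorial_cong[OF nabla_tensorial[OF assms(1)] is_sec_ext _ ext_at]
      in \<open>auto intro!: sum.cong\<close>)

lemma ricci_dual_fields:
  assumes "is_sec Y" "is_sec Z" "dual_fields x F F'"
  shows "ricci A nabla Y Z x = (\<Sum>b\<in>Basis. g x (riemann A nabla (F b) Y Z x) (F' b x))"
  unfolding ricci_def
  by (subst endo_trace_dual_fields[OF tensorial_ext_linear[OF riemann_tensorial_1[OF assms(1,2)]]
        assms(3)])
    (use assms tensorial_cong[OF riemann_tensorial_1[OF assms(1,2)] is_sec_ext _ ext_at]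
      in \<open>auto intro!: sum.cong\<close>)

lemma g_simps:
  "g x (u + v) w = g x u w + g x v w" "g x (u - v) w = g x u w - g x v w"
  "g x (r *\<^sub>R u) w = r * g x u w" "g x (- u) w = - g x u w" "g x 0 w = 0"
  "g x w (u + v) = g x w u + g x w v" "g x w (u - v) = g x w u - g x w v"
  "g x w (r *\<^sub>R u) = r * g x w u" "g x w (- u) = - g x w u" "g x w 0 = 0"
  using m_bilinear[of x]
  by (simp_all add: bilinear_ladd bilinear_lsub bilinear_lmul bilinear_radd bilinear_rsub
      bilinear_rmul bilinear_lneg bilinear_rneg bilinear_lzero bilinear_rzero)

lemmas g_sum_left = bilinear_sum_left[OF m_bilinear]
lemmas g_sum_right = bilinear_sum_right[OF m_bilinear]

text \<open>The Ricci form is tensorial in both arguments, so the chosen extensions in the nested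
  traces can be replaced by the fields of one frame.\<close>

lemma scalar_curvature_dual_fields:
  assumes F: "dual_fields x F F'"
  shows "scalar_curvature A g nabla x =
    (\<Sum>i\<in>Basis. \<Sum>j\<in>Basis. g x (riemann A nabla (F i) (F j) (F' j) x) (F' i x))"
proof -
  have t2: "tensorial x (\<lambda>Y. ricci A nabla Y Z x)" if "is_sec Z" for Z
  proof (rule tensorialI)
    fix s t assume "is_sec s" "is_sec t"
    then show "ricci A nabla (\<lambda>y. s y + t y) Z x = ricci A nabla s Z x + ricci A nabla t Z x"
      using F that riemann_tensorial_2[OF _ that, of _ x] unfolding tensorial_def
      by (simp add: ricci_dual_fields[OF _ _ F] sec_add g_simps sum.distrib)
  next
    fix f s assume "smooth_fun A f" "is_sec s"
    then show "ricci A nabla (\<lambda>y. f y *\<^sub>R s y) Z x = f x *\<^sub>R ricci A nabla s Z x"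
      using F that riemann_tensorial_2[OF _ that, of _ x] unfolding tensorial_def
      by (simp add: ricci_dual_fields[OF _ _ F] sec_scale g_simps sum_distrib_left)
  qed
  have t3: "tensorial x (\<lambda>Z. ricci A nabla Y Z x)" if "is_sec Y" for Y
  proof (rule tensorialI)
    fix s t assume "is_sec s" "is_sec t"
    then show "ricci A nabla Y (\<lambda>y. s y + t y) x = ricci A nabla Y s x + ricci A nabla Y t x"
      using F that riemann_tensorial_3[OF _ that, of _ x] unfolding tensorial_def
      by (simp add: ricci_dual_fields[OF _ _ F] sec_add g_simps sum.distrib)
  next
    fix f s assume "smooth_fun A f" "is_sec s"
    then show "ricci A nabla Y (\<lambda>y. f y *\<^sub>R s y) x = f x *\<^sub>R ricci A nabla Y s x"
      using F that riemann_tensorial_3[OF _ that, of _ x] unfolding tensorial_def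
      by (simp add: ricci_dual_fields[OF _ _ F] sec_scale g_simps sum_distrib_left)
  qed
  have b: "bilinear (\<lambda>\<eta> \<zeta>. ricci A nabla (vext A x \<eta>) (vext A x \<zeta>) x)"
    unfolding bilinear_def
    using tensorial_ext_linear[OF t3[OF is_sec_ext]] tensorial_ext_linear[OF t2[OF is_sec_ext]]
    by blast
  have e: "ricci A nabla (vext A x (Y x)) (vext A x (Z x)) x = ricci A nabla Y Z x"
    if "is_sec Y" "is_sec Z" for Y Z
    using tensorial_cong[OF t2[OF is_sec_ext] is_sec_ext that(1) ext_at]
      tensorial_cong[OF t3[OF that(1)] is_sec_ext that(2) ext_at] by metis
  have "scalar_curvature A g nabla x = (\<Sum>j\<in>Basis. ricci A nabla (F j) (F' j) x)"
    unfolding scalar_curvature_def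
    by (subst trace_dual_fields[OF b F]) (use F e in simp)
  also have "\<dots> = (\<Sum>j\<in>Basis. \<Sum>i\<in>Basis. g x (riemann A nabla (F i) (F j) (F' j) x) (F' i x))"
    using F by (simp add: ricci_dual_fields[OF _ _ F])
  finally show ?thesis by (subst sum.swap)
qed

lemma g_expand:
  assumes "dual_fields x F F'"
  shows "g x u v = (\<Sum>b\<in>Basis. g x u (F b x) * g x v (F' b x))"
proof -
  have "v = (\<Sum>b\<in>Basis. g x v (F' b x) *\<^sub>R F b x)"
    using dual_frame_expand[OF m_bilinear] assms by blast
  then have "g x u v = g x u (\<Sum>b\<in>Basis. g x v (F' b x) *\<^sub>R F b x)" by simp
  then show ?thesis by (simp add: g_sum_right g_simps mult.commute)
qed

lemma linear_expand:
  assumes "dual_fields x F F'" "linear L"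
  shows "L v = (\<Sum>b\<in>Basis. g x v (F' b x) *\<^sub>R L (F b x))"
proof -
  have "v = (\<Sum>b\<in>Basis. g x v (F' b x) *\<^sub>R F b x)"
    using dual_frame_expand[OF m_bilinear] assms by blast
  then have "L v = L (\<Sum>b\<in>Basis. g x v (F' b x) *\<^sub>R F b x)" by simp
  then show ?thesis by (simp add: linear_sum[OF assms(2)] linear_cmul[OF assms(2)])
qed

end

section \<open>Contractions of trilinear forms\<close>

definition trilinear :: "('a::real_vector \<Rightarrow> 'a \<Rightarrow> 'a \<Rightarrow> real) \<Rightarrow> bool" where
  "trilinear t \<longleftrightarrow> (\<forall>u v. linear (\<lambda>w. t u v w) \<and> linear (\<lambda>w. t u w v) \<and> linear (\<lambda>w. t w u v))"

definition contract3 ::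
  "('v::euclidean_space \<Rightarrow> 'v \<Rightarrow> real) \<Rightarrow> ('v \<Rightarrow> 'v \<Rightarrow> 'v \<Rightarrow> real) \<Rightarrow> ('v \<Rightarrow> 'v \<Rightarrow> 'v \<Rightarrow> real) \<Rightarrow> real"
  where "contract3 m s t = metric_trace m (\<lambda>a a'. metric_trace m (\<lambda>b b'.
    metric_trace m (\<lambda>c c'. s a b c * t a' b' c')))"

lemma linear_metric_trace:
  assumes "\<And>p q. linear (\<lambda>a. B a p q :: real)"
  shows "linear (\<lambda>a. metric_trace m (B a))"
  unfolding metric_trace_def
  by (rule linearI) (simp_all add: linear_add[OF assms] linear_cmul[OF assms] sum.distrib sum_distrib_left)

lemma linear_times_const:
  fixes L :: "'a::real_vector \<Rightarrow> real"
  shows "linear L \<Longrightarrow> linear (\<lambda>a. L a * r)" "linear L \<Longrightarrow> linear (\<lambda>a. r * L a)"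
  by (auto intro!: linearI simp: linear_add linear_cmul algebra_simps)

text \<open>Each slot may use its own dual pair. This allows the frame and its dual to be exchanged
  slot by slot, as happens in the double trace of the curvature.\<close>

lemma contract3_frames:
  fixes m :: "'v::euclidean_space \<Rightarrow> 'v \<Rightarrow> real"
  assumes m: "bilinear m" "nondegenerate m" "\<And>u v. m u v = m v u"
    and s: "trilinear s" and t: "trilinear t"
    and f: "dual_frame m f1 f1'" "dual_frame m f2 f2'" "dual_frame m f3 f3'"
  shows "contract3 m s t = (\<Sum>i\<in>Basis. \<Sum>j\<in>Basis. \<Sum>k\<in>Basis.
    s (f1 i) (f2 j) (f3 k) * t (f1' i) (f2' j) (f3' k))"
proof -
  have s1: "linear (\<lambda>a. s u v a)" "linear (\<lambda>a. s u a v)" "linear (\<lambda>a. s a u v)" for u v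
    using s unfolding trilinear_def by auto
  have t1: "linear (\<lambda>a. t u v a)" "linear (\<lambda>a. t u a v)" "linear (\<lambda>a. t a u v)" for u v
    using t unfolding trilinear_def by auto
  have b3: "bilinear (\<lambda>c c'. s a b c * t a' b' c')" for a b a' b'
    unfolding bilinear_def by (auto intro!: linear_times_const s1 t1)
  have b2: "bilinear (\<lambda>b b'. metric_trace m (\<lambda>c c'. s a b c * t a' b' c'))" for a a'
    unfolding bilinear_def by (auto intro!: linear_metric_trace linear_times_const s1 t1)
  have b1: "bilinear (\<lambda>a a'. metric_trace m (\<lambda>b b'. metric_trace m (\<lambda>c c'. s a b c * t a' b' c')))"
    unfolding bilinear_def by (auto intro!: linear_metric_trace linear_times_const s1 t1)
  note tr = metric_trace_frame[OF m _ dual_frame_expand[OF m(1)]]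
  show ?thesis
    unfolding contract3_def
    by (subst tr[OF b1 f(1)], intro sum.cong refl, subst tr[OF b2 f(2)], intro sum.cong refl,
        rule tr[OF b3 f(3)])
qed

lemma trilinear_rotate: "trilinear s \<Longrightarrow> trilinear (\<lambda>a b c. s b c a)"
  unfolding trilinear_def by auto

lemma sum_rotate:
  "(\<Sum>i\<in>I. \<Sum>j\<in>J. \<Sum>k\<in>K. h i j k) = (\<Sum>j\<in>J. \<Sum>k\<in>K. \<Sum>i\<in>I. (h i j k :: real))"
proof -
  have "(\<Sum>i\<in>I. \<Sum>j\<in>J. \<Sum>k\<in>K. h i j k) = (\<Sum>j\<in>J. \<Sum>i\<in>I. \<Sum>k\<in>K. h i j k)"
    by (rule sum.swap)
  also have "\<dots> = (\<Sum>j\<in>J. \<Sum>k\<in>K. \<Sum>i\<in>I. h i j k)"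
    by (rule sum.cong[OF refl sum.swap])
  finally show ?thesis .
qed

lemma contract3_add:
  "contract3 m (\<lambda>a b c. s a b c + s' a b c) t = contract3 m s t + contract3 m s' t"
  "contract3 m t (\<lambda>a b c. s a b c + s' a b c) = contract3 m t s + contract3 m t s'"
  by (simp_all add: contract3_def metric_trace_def algebra_simps sum.distrib)

lemma contract3_scale:
  "contract3 m (\<lambda>a b c. r * s a b c) t = r * contract3 m s t"
  "contract3 m t (\<lambda>a b c. r * s a b c) = r * contract3 m t s"
  by (simp_all add: contract3_def metric_trace_def sum_distrib_left algebra_simps)

context
  fixes m :: "'v::euclidean_space \<Rightarrow> 'v \<Rightarrow> real"
  assumes m: "bilinear m" "nondegenerate m" "\<And>u v. m u v = m v u"
begin

lemma dual_frame_Basis: "dual_frame m (dual_vec m) (\<lambda>b. b)"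
  by (simp add: dual_frame_def dual_vec[OF m(1,2)] inner_Basis)

lemmas dual_frame_Basis' = dual_frame_sym[OF dual_frame_Basis m(3)]

lemma contract3_sym:
  assumes "trilinear s" "trilinear t"
  shows "contract3 m s t = contract3 m t s"
  unfolding contract3_frames[OF m assms dual_frame_Basis dual_frame_Basis dual_frame_Basis]
    contract3_frames[OF m assms(2,1) dual_frame_Basis' dual_frame_Basis' dual_frame_Basis']
  by (simp add: mult.commute)

lemma contract3_rotate:
  assumes "trilinear s" "trilinear t"
  shows "contract3 m (\<lambda>a b c. s b c a) (\<lambda>a b c. t b c a) = contract3 m s t"
  unfolding contract3_frames[OF m assms dual_frame_Basis dual_frame_Basis dual_frame_Basis]
    contract3_frames[OF m trilinear_rotate[OF assms(1)] trilinear_rotate[OF assms(2)]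
      dual_frame_Basis dual_frame_Basis dual_frame_Basis]
  by (rule sum_rotate)

text \<open>Rotating the arguments of both forms preserves the contraction. A form and its two
  rotations thus have equal norms and equal mutual contractions, and expanding the square of their
  sum gives three terms of the first kind and six of the second.\<close>

lemma
  assumes s: "trilinear s"
  shows contract3_rotate_12: "contract3 m (\<lambda>a b c. s b c a) (\<lambda>a b c. s c a b) = contract3 m s (\<lambda>a b c. s b c a)"
    and contract3_rotate_02: "contract3 m s (\<lambda>a b c. s c a b) = contract3 m s (\<lambda>a b c. s b c a)"
    and contract3_rotate_10: "contract3 m (\<lambda>a b c. s b c a) s = contract3 m s (\<lambda>a b c. s b c a)"
    and contract3_cyclic_sum: "contract3 m (\<lambda>a b c. s a b c + s b c a + s c a b)
      (\<lambda>a b c. s a b c + s b c a + s c a b) =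
      3 * contract3 m s s + 6 * contract3 m s (\<lambda>a b c. s b c a)"
proof -
  let ?s1 = "\<lambda>a b c. s b c a" and ?s2 = "\<lambda>a b c. s c a b"
  have t1: "trilinear ?s1" using trilinear_rotate[OF s] .
  have t2: "trilinear ?s2" using trilinear_rotate[OF t1] .
  have e: "contract3 m ?s1 ?s1 = contract3 m s s" "contract3 m ?s2 ?s2 = contract3 m s s"
    "contract3 m ?s1 ?s2 = contract3 m s ?s1" "contract3 m ?s2 s = contract3 m s ?s1"
    "contract3 m ?s1 s = contract3 m s ?s1"
    "contract3 m s ?s2 = contract3 m s ?s1" "contract3 m ?s2 ?s1 = contract3 m s ?s1"
    using contract3_rotate[OF s s] contract3_rotate[OF t1 t1] contract3_rotate[OF s t1]
      contract3_rotate[OF t1 t2] contract3_sym[OF s t1] contract3_sym[OF s t2]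
      contract3_sym[OF t1 t2] by simp_all
  show "contract3 m ?s1 ?s2 = contract3 m s ?s1" "contract3 m s ?s2 = contract3 m s ?s1"
    "contract3 m ?s1 s = contract3 m s ?s1" by (fact e)+
  show "contract3 m (\<lambda>a b c. s a b c + s b c a + s c a b) (\<lambda>a b c. s a b c + s b c a + s c a b) =
      3 * contract3 m s s + 6 * contract3 m s ?s1"
    by (simp add: contract3_add e)
qed

end

section \<open>Curvature of a metric connection with torsion\<close>

text \<open>This treats both eigenbundles at once. \<open>S\<close> is the contorsion of the induced
  connection and \<open>h\<close> its cyclic sum, which also appears as the difference between
  \<nabla> and the connection along the other eigenbundle.\<close>

locale levi_civita_contorsion = levi_civita_geometry A g nabla
  for A :: "('m::{t2_space,second_countable_topology}, 'n::finite) atlas"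
    and g :: "'m \<Rightarrow> real ^ 'n \<Rightarrow> real ^ 'n \<Rightarrow> real"
    and nabla :: "('m \<Rightarrow> real ^ 'n) \<Rightarrow> ('m \<Rightarrow> real ^ 'n) \<Rightarrow> 'm \<Rightarrow> real ^ 'n" +
  fixes S :: "('m \<Rightarrow> real ^ 'n) \<Rightarrow> ('m \<Rightarrow> real ^ 'n) \<Rightarrow> 'm \<Rightarrow> real ^ 'n"
    and h :: "'m \<Rightarrow> real ^ 'n \<Rightarrow> real ^ 'n \<Rightarrow> real ^ 'n \<Rightarrow> real"
  assumes S_field: "vector_field A X \<Longrightarrow> vector_field A Y \<Longrightarrow> vector_field A (S X Y)"
    and S_tensorial_left: "vector_field A Y \<Longrightarrow> tensorial x (\<lambda>X. S X Y x)"
    and S_tensorial_right: "vector_field A X \<Longrightarrow> tensorial x (\<lambda>Y. S X Y x)"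
    and S_skew: "vector_field A X \<Longrightarrow> vector_field A Y \<Longrightarrow> vector_field A Z \<Longrightarrow>
      g x (S X Y x) (Z x) = - g x (S X Z x) (Y x)"
    and S_cyclic: "vector_field A X \<Longrightarrow> vector_field A Y \<Longrightarrow> vector_field A Z \<Longrightarrow>
      g x (S X Y x) (Z x) + g x (S Y Z x) (X x) + g x (S Z X x) (Y x) = h x (X x) (Y x) (Z x)"
begin

definition Sx :: "'m \<Rightarrow> real ^ 'n \<Rightarrow> real ^ 'n \<Rightarrow> real ^ 'n" where
  "Sx x \<xi> \<eta> = S (vext A x \<xi>) (vext A x \<eta>) x"

lemma S_eq: "is_sec X \<Longrightarrow> is_sec Y \<Longrightarrow> S X Y x = Sx x (X x) (Y x)"
proof -
  assume X: "is_sec X" and Y: "is_sec Y"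
  have "S X Y x = S (vext A x (X x)) Y x"
    by (rule tensorial_cong[OF S_tensorial_left[OF Y] X is_sec_ext ext_at[symmetric]])
  also have "\<dots> = Sx x (X x) (Y x)"
    unfolding Sx_def
    by (rule tensorial_cong[OF S_tensorial_right[OF is_sec_ext] Y is_sec_ext ext_at[symmetric]])
  finally show ?thesis .
qed

lemma S_add_left: "is_sec X \<Longrightarrow> is_sec Y \<Longrightarrow> is_sec Z \<Longrightarrow>
    S (\<lambda>y. X y + Y y) Z x = S X Z x + S Y Z x"
  using S_tensorial_left unfolding tensorial_def by blast

lemma S_add_right: "is_sec X \<Longrightarrow> is_sec Y \<Longrightarrow> is_sec Z \<Longrightarrow>
    S Z (\<lambda>y. X y + Y y) x = S Z X x + S Z Y x"
  using S_tensorial_right unfolding tensorial_def by blast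

lemma Sx_bilinear: "bilinear (Sx x)"
  unfolding bilinear_def Sx_def
  using tensorial_ext_linear[OF S_tensorial_left[OF is_sec_ext]]
    tensorial_ext_linear[OF S_tensorial_right[OF is_sec_ext]] by blast

lemma Sx_skew: "g x (Sx x \<xi> \<eta>) \<zeta> = - g x (Sx x \<xi> \<zeta>) \<eta>"
  using S_skew[OF is_sec_ext is_sec_ext is_sec_ext, of x x \<xi> x \<eta> x \<zeta>]
  by (simp add: S_eq is_sec_ext ext_at)

lemma h_eq: "h x \<xi> \<eta> \<zeta> = g x (Sx x \<xi> \<eta>) \<zeta> + g x (Sx x \<eta> \<zeta>) \<xi> + g x (Sx x \<zeta> \<xi>) \<eta>"
  using S_cyclic[OF is_sec_ext is_sec_ext is_sec_ext, of x x \<xi> x \<eta> x \<zeta>]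
  by (simp add: S_eq is_sec_ext ext_at)

lemmas Sx_simps = bilinear_ladd[OF Sx_bilinear] bilinear_radd[OF Sx_bilinear]
  bilinear_lsub[OF Sx_bilinear] bilinear_rsub[OF Sx_bilinear]
  bilinear_lmul[OF Sx_bilinear] bilinear_rmul[OF Sx_bilinear]

definition s3 :: "'m \<Rightarrow> real ^ 'n \<Rightarrow> real ^ 'n \<Rightarrow> real ^ 'n \<Rightarrow> real" where
  "s3 x \<xi> \<eta> \<zeta> = g x (Sx x \<xi> \<eta>) \<zeta>"

lemma s3_trilinear: "trilinear (s3 x)"
  unfolding trilinear_def s3_def by (auto intro!: linearI simp: g_simps Sx_simps)

lemma s3_skew: "s3 x a b c = - s3 x a c b"
  unfolding s3_def by (rule Sx_skew)

lemma h_s3: "h x = (\<lambda>a b c. s3 x a b c + s3 x b c a + s3 x c a b)"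
  by (intro ext) (simp add: h_eq s3_def)

lemma h_trilinear: "trilinear (h x)"
  unfolding trilinear_def h_s3 s3_def by (auto intro!: linearI simp: g_simps Sx_simps algebra_simps)

lemma h_skew: "h x a b c = - h x a c b"
  unfolding h_s3 using s3_skew[of x a b c] s3_skew[of x b c a] s3_skew[of x c a b] by simp

definition N :: "('m \<Rightarrow> real ^ 'n) \<Rightarrow> ('m \<Rightarrow> real ^ 'n) \<Rightarrow> 'm \<Rightarrow> real ^ 'n" where
  "N X Y = (\<lambda>x. nabla X Y x + S X Y x)"

text \<open>This is the covariant derivative of the tensor \<open>S\<close> in direction
  \<open>V\<close>, evaluated on \<open>W\<close> and \<open>B\<close>.\<close>

definition nablaS :: "('m \<Rightarrow> real ^ 'n) \<Rightarrow> ('m \<Rightarrow> real ^ 'n) \<Rightarrow> ('m \<Rightarrow> real ^ 'n) \<Rightarrow> 'm \<Rightarrow> real ^ 'n"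
  where "nablaS V W B x = nabla V (S W B) x - Sx x (nabla V W x) (B x) - Sx x (W x) (nabla V B x)"

text \<open>The commutator of second derivatives for \<open>\<nabla> + S\<close> without the
  \<nabla>-derivatives along \<open>S V W - S W V\<close>: the Riemann tensor, the antisymmetrised
  derivative of \<open>S\<close>, the commutator of \<open>S\<close> with itself, and
  \<open>S\<close> in that direction.\<close>

definition curv :: "('m \<Rightarrow> real ^ 'n) \<Rightarrow> ('m \<Rightarrow> real ^ 'n) \<Rightarrow> ('m \<Rightarrow> real ^ 'n) \<Rightarrow> ('m \<Rightarrow> real ^ 'n) \<Rightarrow>
    'm \<Rightarrow> real" where
  "curv V W B Z x = g x (riemann A nabla V W B x) (Z x) + g x (nablaS V W B x) (Z x) - g x (nablaS W V B x) (Z x)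
    + g x (Sx x (V x) (Sx x (W x) (B x))) (Z x) - g x (Sx x (W x) (Sx x (V x) (B x))) (Z x)
    - g x (Sx x (Sx x (V x) (W x)) (B x)) (Z x) + g x (Sx x (Sx x (W x) (V x)) (B x)) (Z x)"

lemmas S_intros = nabla_intros S_field

lemma D2_N:
  assumes "is_sec V" "is_sec W" "is_sec B"
  shows "g x (D2 N V W B x - D2 N W V B x) (Z x) =
    curv V W B Z x - g x (nabla (S V W) B x) (Z x) + g x (nabla (S W V) B x) (Z x)"
  unfolding D2_def N_def nablaS_def curv_def
  using assms
  by (simp add: nabla_simps S_intros S_add_left S_add_right riemann_eq g_simps, simp add: S_eq S_intros)

text \<open>Differentiating the skewness of \<open>S\<close> with the metric connection \<nabla>
  gives the skewness of its derivative; the correction terms are skew by themselves.\<close>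

lemma nablaS_skew:
  assumes "is_sec V" "is_sec W" "is_sec B" "is_sec Z"
  shows "g x (nablaS V W B x) (Z x) = - g x (nablaS V W Z x) (B x)"
proof -
  have 1: "vapply A V (\<lambda>x. g x (S W Y x) (Y' x)) x =
      g x (nabla V (S W Y) x) (Y' x) + g x (S W Y x) (nabla V Y' x)"
    if "is_sec Y" "is_sec Y'" for Y Y'
    using nabla_metric[of V "S W Y" Y'] assms that by (simp add: S_intros)
  have "vapply A V (\<lambda>x. g x (S W B x) (Z x)) x = vapply A V (\<lambda>x. - 1 * g x (S W Z x) (B x)) x"
    using S_skew[OF assms(2,3,4)] by simp
  also have "\<dots> = - vapply A V (\<lambda>x. g x (S W Z x) (B x)) x"
    unfolding vapply_def
    by (subst tderiv_mult[OF smooth_map_on_const m_smooth[OF S_field[OF assms(2,4)] assms(3)] UNIV_I])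
      (simp add: tderiv_const)
  finally show ?thesis
    unfolding 1[OF assms(3,4)] 1[OF assms(4,3)] nablaS_def
    using Sx_skew[of x "nabla V W x" "B x" "Z x"] Sx_skew[of x "W x" "nabla V B x" "Z x"]
      Sx_skew[of x "W x" "nabla V Z x" "B x"] assms
    by (simp add: g_simps S_eq)
qed

text \<open>The derivative terms on the right-hand side are those which \<open>D2_N\<close> leaves over from \<open>curv\<close>.\<close>

lemma trace_conn_product:
  assumes F: "dual_fields x F F'"
    and sec: "is_sec V" "is_sec W" "is_sec B" "is_sec Z"
  shows "(\<Sum>k\<in>Basis. g x (N (F k) V x) (W x) * g x (N (F' k) B x) (Z x) -
      (g x (nabla (F k) V x) (W x) + h x (F k x) (V x) (W x)) *
      (g x (nabla (F' k) B x) (Z x) + h x (F' k x) (B x) (Z x))) =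
    (\<Sum>k\<in>Basis. s3 x (F k x) (V x) (W x) * s3 x (F' k x) (B x) (Z x)
      - h x (F k x) (V x) (W x) * h x (F' k x) (B x) (Z x))
    - g x (nabla (S V W) B x) (Z x) + g x (nabla (S W V) B x) (Z x)
    - g x (nabla (S B Z) V x) (W x) + g x (nabla (S Z B) V x) (W x)"
proof -
  have secF: "is_sec (F k)" "is_sec (F' k)" for k using F by auto
  have lin: "linear (\<lambda>\<xi>. g x (nabla (vext A x \<xi>) Y x) (Y' x))" if "is_sec Y" for Y Y'
    using linear_compose[OF tensorial_ext_linear[OF nabla_tensorial[OF that]]
        bilinear_left[OF m_bilinear]] by (simp add: o_def)
  have ext: "nabla (vext A x (X x)) Y x = nabla X Y x" if "is_sec X" "is_sec Y" for X Y
    using tensorial_cong[OF nabla_tensorial[OF that(2)] is_sec_ext that(1) ext_at] .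
  \<comment> \<open>As \<nabla> is linear in its direction, contracting the direction with a dual
    frame against \<open>X\<close> gives the derivative along \<open>X\<close>.\<close>
  have nab: "(\<Sum>k\<in>Basis. g x (X x) (F' k x) * g x (nabla (F k) Y x) (Y' x)) =
      g x (nabla X Y x) (Y' x)"
    if "dual_fields x F F'" "is_sec X" "is_sec Y" for X Y Y' F F'
    using linear_expand[OF that(1) lin[OF that(3)], of "X x" Y'] that by (simp add: ext)
  \<comment> \<open>Removing the cyclic sum leaves the other two rotations with a minus sign.
    Skewness moves the frame vector \<open>a\<close> into the last slot of both, so the sum over the
    frame becomes a derivative along an antisymmetrised \<open>S\<close>.\<close>
  have sh: "s3 x a b c - h x a b c = g x (Sx x c b - Sx x b c) a" for a b c
    unfolding h_s3 s3_def using Sx_skew[of x c a b] by (simp add: g_simps)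
  have diff: "(\<Sum>k\<in>Basis. g x (nabla (F k) Y x) (Y' x) * g x (Sx x (B' x) (Z' x) - Sx x (Z' x) (B' x)) (F' k x)) =
      g x (nabla (S B' Z') Y x) (Y' x) - g x (nabla (S Z' B') Y x) (Y' x)"
    if "dual_fields x F F'" "is_sec Y" "is_sec B'" "is_sec Z'" for Y Y' B' Z' F F'
  proof -
    have "(\<Sum>k\<in>Basis. g x (nabla (F k) Y x) (Y' x) * g x (Sx x (B' x) (Z' x) - Sx x (Z' x) (B' x)) (F' k x)) =
        (\<Sum>k\<in>Basis. g x (S B' Z' x - S Z' B' x) (F' k x) * g x (nabla (F k) Y x) (Y' x))"
      by (simp add: S_eq that mult.commute)
    also have "\<dots> = g x (nabla (\<lambda>y. S B' Z' y - S Z' B' y) Y x) (Y' x)"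
      by (rule nab[OF that(1) sec_diff[OF S_field[OF that(3,4)] S_field[OF that(4,3)]] that(2)])
    also have "\<dots> = g x (nabla (S B' Z') Y x) (Y' x) - g x (nabla (S Z' B') Y x) (Y' x)"
      by (simp add: nabla_diff_left S_field that g_simps)
    finally show ?thesis .
  qed
  have "(\<Sum>k\<in>Basis. g x (N (F k) V x) (W x) * g x (N (F' k) B x) (Z x) -
      (g x (nabla (F k) V x) (W x) + h x (F k x) (V x) (W x)) *
      (g x (nabla (F' k) B x) (Z x) + h x (F' k x) (B x) (Z x))) =
    (\<Sum>k\<in>Basis. (s3 x (F k x) (V x) (W x) * s3 x (F' k x) (B x) (Z x)
      - h x (F k x) (V x) (W x) * h x (F' k x) (B x) (Z x))
      + g x (nabla (F k) V x) (W x) * (s3 x (F' k x) (B x) (Z x) - h x (F' k x) (B x) (Z x))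
      + g x (nabla (F' k) B x) (Z x) * (s3 x (F k x) (V x) (W x) - h x (F k x) (V x) (W x)))"
    by (intro sum.cong refl) (simp add: N_def S_eq secF sec g_simps s3_def algebra_simps)
  also have "\<dots> = (\<Sum>k\<in>Basis. s3 x (F k x) (V x) (W x) * s3 x (F' k x) (B x) (Z x)
      - h x (F k x) (V x) (W x) * h x (F' k x) (B x) (Z x))
      + (\<Sum>k\<in>Basis. g x (nabla (F k) V x) (W x) * g x (Sx x (Z x) (B x) - Sx x (B x) (Z x)) (F' k x))
      + (\<Sum>k\<in>Basis. g x (nabla (F' k) B x) (Z x) * g x (Sx x (W x) (V x) - Sx x (V x) (W x)) (F k x))"
    unfolding sh by (simp add: sum.distrib)
  finally show ?thesis
    using diff[OF F sec(1) sec(4) sec(3), of W] diff[OF dual_fields_swap[OF F] sec(3) sec(2) sec(1), of Z]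
    by simp
qed

section \<open>Traces over a moving dual frame\<close>

context
  fixes W x F F' \<tau>
  assumes W: "open W" "x \<in> W" and F: "\<And>y. y \<in> W \<Longrightarrow> dual_fields y F F'"
    and \<tau>: "is_sec \<tau>" "\<And>y. y \<in> W \<Longrightarrow> (\<Sum>b\<in>Basis. S (F b) (F' b) y) = \<tau> y"
begin

lemma fields: "is_sec (F b)" "is_sec (F' b)"
  using F[OF W(2)] by auto

text \<open>Covariant differentiation commutes with the metric trace: the terms in which the frame
  is differentiated cancel because the pairings of the frame with its dual are constant near
  \<open>x\<close>.\<close>

lemma trace_nablaS:
  assumes V: "is_sec V"
  shows "(\<Sum>j\<in>Basis. nablaS V (F j) (F' j) x) = nabla V \<tau> x"
proof -
  have "nabla V (\<lambda>y. \<Sum>j\<in>Basis. S (F j) (F' j) y) x = nabla V \<tau> x"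
    by (rule nabla_local[OF V _ \<tau>(1) W \<tau>(2)]) (auto intro!: sec_sum S_field fields)
  then have 1: "(\<Sum>j\<in>Basis. nabla V (S (F j) (F' j)) x) = nabla V \<tau> x"
    by (simp add: nabla_sum_right V S_field fields)
  have cancel: "g x (nabla V (F j) x) (F' k x) + g x (F j x) (nabla V (F' k) x) = 0"
    if jk: "j \<in> Basis" "k \<in> Basis" for j k
  proof -
    have "vapply A V (\<lambda>y. g y (F j y) (F' k y)) x = tderiv A x (V x) (\<lambda>_. if j = k then 1 else 0 :: real)"
      unfolding vapply_def
      by (rule tderiv_cong[OF W _ smooth_map_on_subset[OF m_smooth]])
        (use F jk fields in \<open>auto simp: dual_frame_def\<close>)
    then show ?thesis using nabla_metric[OF V fields(1)[of j] fields(2)[of k]]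
      by (simp add: tderiv_const)
  qed
  note d = F[OF W(2)]
  have "(\<Sum>j\<in>Basis. Sx x (nabla V (F j) x) (F' j x)) =
      (\<Sum>j\<in>Basis. \<Sum>k\<in>Basis. g x (nabla V (F j) x) (F' k x) *\<^sub>R Sx x (F k x) (F' j x))"
    by (intro sum.cong refl linear_expand[OF d bilinear_left[OF Sx_bilinear]])
  also have "\<dots> = (\<Sum>k\<in>Basis. \<Sum>j\<in>Basis. g x (nabla V (F j) x) (F' k x) *\<^sub>R Sx x (F k x) (F' j x))"
    by (rule sum.swap)
  finally have 2: "(\<Sum>j\<in>Basis. Sx x (nabla V (F j) x) (F' j x)) =
      (\<Sum>k\<in>Basis. \<Sum>j\<in>Basis. g x (nabla V (F j) x) (F' k x) *\<^sub>R Sx x (F k x) (F' j x))" .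
  have 3: "(\<Sum>k\<in>Basis. Sx x (F k x) (nabla V (F' k) x)) =
      (\<Sum>k\<in>Basis. \<Sum>j\<in>Basis. g x (nabla V (F' k) x) (F j x) *\<^sub>R Sx x (F k x) (F' j x))"
    by (intro sum.cong refl linear_expand[OF dual_fields_swap[OF d] bilinear_right[OF Sx_bilinear]])
  have "(\<Sum>j\<in>Basis. Sx x (nabla V (F j) x) (F' j x)) + (\<Sum>k\<in>Basis. Sx x (F k x) (nabla V (F' k) x)) = 0"
    unfolding 2 3 sum.distrib[symmetric]
    by (intro sum.neutral ballI)
      (use cancel in \<open>simp add: m_sym flip: scaleR_left.add\<close>)
  then show ?thesis
    unfolding nablaS_def sum_subtractf 1 by (simp add: algebra_simps)
qed

lemma trace_curv:
  "(\<Sum>i\<in>Basis. \<Sum>j\<in>Basis. curv (F i) (F j) (F' j) (F' i) x) =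
    scalar_curvature A g nabla x + 2 * vdiv A nabla \<tau> x - g x (\<tau> x) (\<tau> x)
      + contract3 (g x) (s3 x) (\<lambda>a b c. s3 x b c a)"
proof -
  note d = F[OF W(2)]
  have df: "dual_frame (g x) (\<lambda>b. F b x) (\<lambda>b. F' b x)" "dual_frame (g x) (\<lambda>b. F' b x) (\<lambda>b. F b x)"
    using d dual_fields_swap[OF d] by auto
  note c3 = contract3_frames[OF m_bilinear m_nondegenerate m_sym]
  have tri: "trilinear (\<lambda>a b c. s3 x b a c)" "trilinear (\<lambda>a b c. s3 x c b a)"
    using s3_trilinear[of x] unfolding trilinear_def by auto
  define P where "P = contract3 (g x) (s3 x) (\<lambda>a b c. s3 x b c a)"
  have neg: "contract3 (g x) (\<lambda>a b c. - s a b c) t = - contract3 (g x) s t"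
    "contract3 (g x) s (\<lambda>a b c. - t a b c) = - contract3 (g x) s t" for s t
    using contract3_scale[where r = "-1"] by simp_all
  have T: "(\<Sum>b\<in>Basis. Sx x (F b x) (F' b x)) = \<tau> x"
    using \<tau>(2)[OF W(2)] by (simp add: S_eq fields)
  have 1: "(\<Sum>i\<in>Basis. \<Sum>j\<in>Basis. g x (riemann A nabla (F i) (F j) (F' j) x) (F' i x)) =
      scalar_curvature A g nabla x"
    by (rule scalar_curvature_dual_fields[OF d, symmetric])
  have dv: "(\<Sum>i\<in>Basis. \<Sum>j\<in>Basis. g x (nablaS (F i) (F j) (F' j) x) (F' i x)) = vdiv A nabla \<tau> x"
    by (simp add: trace_nablaS fields vdiv_dual_fields[OF \<tau>(1) d] flip: g_sum_left)
  have 3: "(\<Sum>i\<in>Basis. \<Sum>j\<in>Basis. g x (nablaS (F j) (F i) (F' j) x) (F' i x)) = - vdiv A nabla \<tau> x"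
    unfolding dv[symmetric] sum_negf[symmetric]
    by (subst sum.swap) (intro sum.cong refl nablaS_skew fields)
  \<comment> \<open>Skewness moves the inner \<open>S\<close> out of the outer one, and the double
    sum factors into two copies of \<open>\<tau>\<close>.\<close>
  have 4: "(\<Sum>i\<in>Basis. \<Sum>j\<in>Basis. g x (Sx x (F i x) (Sx x (F j x) (F' j x))) (F' i x)) =
      - g x (\<tau> x) (\<tau> x)"
    unfolding Sx_skew[of x _ "Sx x (F _ x) (F' _ x)"] T[symmetric]
    by (simp add: sum_negf g_sum_left g_sum_right) (rule sum.swap)
  \<comment> \<open>Up to skewness and rotation the three remaining quadratic terms are contractions
    of \<open>S\<close> with its rotation. They enter the trace of \<open>curv\<close> as
    \<open>- P\<close>, \<open>+ P\<close> and \<open>+ P\<close>.\<close>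
  have 5: "(\<Sum>i\<in>Basis. \<Sum>j\<in>Basis. g x (Sx x (F j x) (Sx x (F i x) (F' j x))) (F' i x)) = P"
  proof -
    have "(\<Sum>i\<in>Basis. \<Sum>j\<in>Basis. g x (Sx x (F j x) (Sx x (F i x) (F' j x))) (F' i x)) =
      - (\<Sum>i\<in>Basis. \<Sum>j\<in>Basis. \<Sum>k\<in>Basis. s3 x (F j x) (F' i x) (F k x) * s3 x (F i x) (F' j x) (F' k x))"
      unfolding Sx_skew[of x _ "Sx x (F _ x) (F' _ x)"] s3_def
      by (simp add: sum_negf g_expand[OF d, of "Sx x _ _" "Sx x _ _"])
    also have "\<dots> = - contract3 (g x) (\<lambda>a b c. s3 x b a c) (s3 x)"
      by (simp add: c3[OF tri(1) s3_trilinear df(2) df(1) df(1)])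
    also have "\<dots> = contract3 (g x) (\<lambda>a b c. s3 x b c a) (s3 x)"
      by (subst s3_skew[of x _ _ _]) (simp only: neg minus_minus)
    finally show ?thesis
      by (simp add: P_def contract3_rotate_10[OF m_bilinear m_nondegenerate m_sym s3_trilinear])
  qed
  have e6: "g x (Sx x (Sx x (F i x) (F j x)) (F' j' x)) (F' i' x) =
      (\<Sum>k\<in>Basis. s3 x (F i x) (F j x) (F' k x) * s3 x (F k x) (F' j' x) (F' i' x))" for i j i' j'
  proof -
    have "linear (\<lambda>u. g x (Sx x u (F' j' x)) (F' i' x))"
      by (rule linearI) (simp_all add: g_simps Sx_simps)
    from linear_expand[OF d this, of "Sx x (F i x) (F j x)"] show ?thesis by (simp add: s3_def)
  qed
  have 6: "(\<Sum>i\<in>Basis. \<Sum>j\<in>Basis. g x (Sx x (Sx x (F i x) (F j x)) (F' j x)) (F' i x)) = - P"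
  proof -
    have "(\<Sum>i\<in>Basis. \<Sum>j\<in>Basis. g x (Sx x (Sx x (F i x) (F j x)) (F' j x)) (F' i x)) =
        contract3 (g x) (s3 x) (\<lambda>a b c. s3 x c b a)"
      unfolding e6 by (simp add: c3[OF s3_trilinear tri(2) df(1) df(1) df(2)])
    also have "\<dots> = - contract3 (g x) (s3 x) (\<lambda>a b c. s3 x c a b)"
      unfolding neg(2)[symmetric] by (intro arg_cong2[where f = "contract3 (g x)"] refl ext s3_skew)
    finally show ?thesis
      by (simp add: P_def contract3_rotate_02[OF m_bilinear m_nondegenerate m_sym s3_trilinear])
  qed
  have 7: "(\<Sum>i\<in>Basis. \<Sum>j\<in>Basis. g x (Sx x (Sx x (F j x) (F i x)) (F' j x)) (F' i x)) = P"
  proof -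
    have "(\<Sum>i\<in>Basis. \<Sum>j\<in>Basis. g x (Sx x (Sx x (F j x) (F i x)) (F' j x)) (F' i x)) =
        contract3 (g x) (\<lambda>a b c. s3 x b a c) (\<lambda>a b c. s3 x c b a)"
      unfolding e6 by (simp add: c3[OF tri(1) tri(2) df(1) df(1) df(2)])
    also have "\<dots> = contract3 (g x) (\<lambda>a b c. - s3 x b c a) (\<lambda>a b c. - s3 x c a b)"
      by (intro arg_cong2[where f = "contract3 (g x)"] ext s3_skew)
    finally show ?thesis
      by (simp add: P_def neg contract3_rotate_12[OF m_bilinear m_nondegenerate m_sym s3_trilinear])
  qed
  show ?thesis
    unfolding curv_def sum.distrib sum_subtractf 1 dv 3 4 5 6 7 P_def[symmetric] by simp
qed

end

text \<open>In the second half of the Riemann tensor the frame and its dual exchange roles; a metric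
  trace does not see this, so both halves have the same \<open>\<tau>\<close>.\<close>

lemma trace_S_swap:
  assumes F: "dual_fields y F F'"
  shows "(\<Sum>b\<in>Basis. S (F' b) (F b) y) = (\<Sum>b\<in>Basis. S (F b) (F' b) y)"
proof (rule nondegenerate_eqI[OF m_bilinear m_nondegenerate])
  fix v
  have b: "bilinear (\<lambda>\<xi> \<eta>. g y (Sx y \<xi> \<eta>) v)"
    unfolding bilinear_def by (auto intro!: linearI simp: g_simps Sx_simps)
  show "g y (\<Sum>b\<in>Basis. S (F' b) (F b) y) v = g y (\<Sum>b\<in>Basis. S (F b) (F' b) y) v"
    using trace_dual_fields[OF b F] trace_dual_fields[OF b dual_fields_swap[OF F]] F
    by (simp add: g_sum_left S_eq)
qed

lemma curvature_trace:
  assumes W: "open W" "x \<in> W" and F: "\<And>y. y \<in> W \<Longrightarrow> dual_fields y F F'"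
    and \<tau>: "is_sec \<tau>" "\<And>y. y \<in> W \<Longrightarrow> (\<Sum>b\<in>Basis. S (F b) (F' b) y) = \<tau> y"
  shows "(\<Sum>i\<in>Basis. \<Sum>j\<in>Basis.
      g x (D2 N (F i) (F j) (F' j) x - D2 N (F j) (F i) (F' j) x) (F' i x)
      + g x (D2 N (F' j) (F' i) (F i) x - D2 N (F' i) (F' j) (F i) x) (F j x)
      - (\<Sum>k\<in>Basis. g x (N (F k) (F i) x) (F j x) * g x (N (F' k) (F' j) x) (F' i x) -
        (g x (nabla (F k) (F i) x) (F j x) + h x (F k x) (F i x) (F j x)) *
        (g x (nabla (F' k) (F' j) x) (F' i x) + h x (F' k x) (F' j x) (F' i x)))) =
    2 * scalar_curvature A g nabla x + 4 * vdiv A nabla \<tau> x - 2 * g x (\<tau> x) (\<tau> x)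
      - 2 / 3 * contract3 (g x) (h x) (h x)" (is "(\<Sum>i\<in>Basis. \<Sum>j\<in>Basis. ?t i j) = _")
proof -
  note d = F[OF W(2)]
  have secF: "is_sec (F k)" "is_sec (F' k)" for k using d by auto
  have df: "dual_frame (g x) (\<lambda>b. F b x) (\<lambda>b. F' b x)" using d by auto
  \<comment> \<open>In the dual factor the last two arguments come in reversed order. Skewness
    restores the order needed for a full contraction, at the price of a sign on both
    products.\<close>
  have sk: "s3 x (F k x) (F i x) (F j x) * s3 x (F' k x) (F' j x) (F' i x)
      - h x (F k x) (F i x) (F j x) * h x (F' k x) (F' j x) (F' i x) =
      h x (F k x) (F i x) (F j x) * h x (F' k x) (F' i x) (F' j x)
      - s3 x (F k x) (F i x) (F j x) * s3 x (F' k x) (F' i x) (F' j x)" for i j k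
    using s3_skew[of x "F' k x" "F' j x" "F' i x"] h_skew[of x "F' k x" "F' j x" "F' i x"] by simp
  have t: "?t i j = curv (F i) (F j) (F' j) (F' i) x + curv (F' j) (F' i) (F i) (F j) x
      - (\<Sum>k\<in>Basis. h x (F k x) (F i x) (F j x) * h x (F' k x) (F' i x) (F' j x)
      - s3 x (F k x) (F i x) (F j x) * s3 x (F' k x) (F' i x) (F' j x))" for i j
    unfolding trace_conn_product[OF d secF(1) secF(1) secF(2) secF(2)] sk
      D2_N[OF secF(1) secF(1) secF(2)] D2_N[OF secF(2) secF(2) secF(1)] by simp
  define P where "P = contract3 (g x) (s3 x) (\<lambda>a b c. s3 x b c a)"
  have c3: "(\<Sum>i\<in>Basis. \<Sum>j\<in>Basis. \<Sum>k\<in>Basis. r (F k x) (F i x) (F j x) * r (F' k x) (F' i x) (F' j x)) =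
      contract3 (g x) r r" if "trilinear r" for r
    unfolding contract3_frames[OF m_bilinear m_nondegenerate m_sym that that df df df]
    by (rule sum_rotate[symmetric])
  have q1: "(\<Sum>i\<in>Basis. \<Sum>j\<in>Basis. curv (F i) (F j) (F' j) (F' i) x) =
      scalar_curvature A g nabla x + 2 * vdiv A nabla \<tau> x - g x (\<tau> x) (\<tau> x) + P"
    unfolding P_def by (rule trace_curv[OF W F \<tau>])
  have \<tau>': "(\<Sum>b\<in>Basis. S (F' b) (F b) y) = \<tau> y" if "y \<in> W" for y
    using \<tau>(2)[OF that] trace_S_swap[OF F[OF that]] by simp
  have "(\<Sum>i\<in>Basis. \<Sum>j\<in>Basis. curv (F' i) (F' j) (F j) (F i) x) =
      scalar_curvature A g nabla x + 2 * vdiv A nabla \<tau> x - g x (\<tau> x) (\<tau> x) + P"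
    unfolding P_def by (rule trace_curv[OF W dual_fields_swap[OF F] \<tau>(1) \<tau>'])
  then have q2: "(\<Sum>i\<in>Basis. \<Sum>j\<in>Basis. curv (F' j) (F' i) (F i) (F j) x) =
      scalar_curvature A g nabla x + 2 * vdiv A nabla \<tau> x - g x (\<tau> x) (\<tau> x) + P"
    by (subst sum.swap)
  have "contract3 (g x) (h x) (h x) = 3 * contract3 (g x) (s3 x) (s3 x) + 6 * P"
    unfolding h_s3 P_def
    by (rule contract3_cyclic_sum[OF m_bilinear m_nondegenerate m_sym s3_trilinear])
  then show ?thesis
    unfolding t unfolding sum.distrib sum_subtractf q1 q2 c3[OF h_trilinear] c3[OF s3_trilinear]
    by (simp add: field_simps)
qed

end

section \<open>Generalised metrics\<close>

locale generalised_geometry = courant_geometry C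
  for C :: "('m::{t2_space,second_countable_topology}, 'n::finite, 'v::euclidean_space) courant" +
  fixes G :: "'m \<Rightarrow> 'v \<Rightarrow> 'v \<Rightarrow> real"
    and g :: "'m \<Rightarrow> real ^ 'n \<Rightarrow> real ^ 'n \<Rightarrow> real"
  assumes exact: "exact_courant_algebroid C"
    and generalised_metric: "generalised_metric C G"
    and induced: "induced_metric C G g"
begin

sublocale GE: metric_bundle "atlas C" "trivs C" G
  using generalised_metric E.vbundle unfolding generalised_metric_def by unfold_locales simp_all

sublocale T: metric_bundle "atlas C" "tangent_trivs (atlas C)" g
  using induced E.tangent_bundle unfolding induced_metric_def by unfold_locales simp_all

lemmas P_simps = bilinear_ladd[OF E.m_bilinear] bilinear_lsub[OF E.m_bilinear]
  bilinear_lmul[OF E.m_bilinear] bilinear_radd[OF E.m_bilinear] bilinear_rsub[OF E.m_bilinear]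
  bilinear_rmul[OF E.m_bilinear]

lemmas gm_simps = bilinear_ladd[OF T.m_bilinear] bilinear_lsub[OF T.m_bilinear]
  bilinear_lmul[OF T.m_bilinear] bilinear_radd[OF T.m_bilinear] bilinear_rsub[OF T.m_bilinear]
  bilinear_rmul[OF T.m_bilinear]

lemmas anchor_simps = linear_add[OF anchor_linear] linear_diff[OF anchor_linear]
  linear_cmul[OF anchor_linear]

lemmas P_eqI = nondegenerate_eqI[OF E.m_bilinear E.m_nondegenerate]

lemma gEnd_pairing: "pairing C x (gEnd C G x u) v = G x u v"
  using theI'[OF nondegenerate_represent[OF E.m_bilinear E.m_nondegenerate
        bilinear_right[OF GE.m_bilinear]], of x x u]
  unfolding gEnd_def by blast

lemma gEnd_linear: "linear (gEnd C G x)"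
proof (rule linearI)
  show "gEnd C G x (u + v) = gEnd C G x u + gEnd C G x v" for u v
    by (rule P_eqI[of x]) (simp add: P_simps gEnd_pairing bilinear_ladd[OF GE.m_bilinear])
  show "gEnd C G x (r *\<^sub>R u) = r *\<^sub>R gEnd C G x u" for r u
    by (rule P_eqI[of x]) (simp add: P_simps gEnd_pairing bilinear_lmul[OF GE.m_bilinear])
qed

lemma gEnd_sym: "pairing C x (gEnd C G x u) v = pairing C x u (gEnd C G x v)"
  by (metis gEnd_pairing GE.m_sym E.m_sym)

lemma gEnd_gEnd: "gEnd C G x (gEnd C G x u) = u"
  using generalised_metric unfolding generalised_metric_def by blast

definition pr :: "real \<Rightarrow> 'm \<Rightarrow> 'v \<Rightarrow> 'v" where
  "pr \<sigma> x u = (1 / 2) *\<^sub>R (u + \<sigma> *\<^sub>R gEnd C G x u)"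

lemma gproj_eq: "gproj C G \<sigma> u x = pr \<sigma> x (u x)"
  by (simp add: gproj_def pr_def)

lemma pr_eig: "\<sigma> \<in> {1, -1} \<Longrightarrow> gEnd C G x (pr \<sigma> x u) = \<sigma> *\<^sub>R pr \<sigma> x u"
  by (auto simp: pr_def linear_cmul[OF gEnd_linear] linear_add[OF gEnd_linear]
      linear_neg[OF gEnd_linear] gEnd_gEnd algebra_simps)

lemma pr_same: "\<sigma> \<in> {1, -1} \<Longrightarrow> gEnd C G x u = \<sigma> *\<^sub>R u \<Longrightarrow> pr \<sigma> x u = u"
  by (auto simp: pr_def simp flip: scaleR_2)

lemma pr_other: "\<sigma> \<in> {1, -1} \<Longrightarrow> gEnd C G x u = \<sigma> *\<^sub>R u \<Longrightarrow> pr (- \<sigma>) x u = 0"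
  by (auto simp: pr_def)

lemma pr_sum: "pr 1 x u + pr (- 1) x u = u"
  by (simp add: pr_def flip: scaleR_add_right)

lemma pr_pairing: "pairing C x (pr \<sigma> x u) v = pairing C x u (pr \<sigma> x v)"
  by (simp add: pr_def P_simps gEnd_sym)

lemma pr_linear: "linear (pr \<sigma> x)"
  unfolding pr_def
  by (rule linearI) (simp_all add: linear_cmul[OF gEnd_linear] linear_add[OF gEnd_linear] algebra_simps)

lemma G_eig: "gEnd C G x u = \<sigma> *\<^sub>R u \<Longrightarrow> G x u v = \<sigma> * pairing C x u v"
  by (simp add: P_simps flip: gEnd_pairing)

lemma induced_eig:
  assumes "\<sigma> \<in> {1, -1}" "gEnd C G x u = \<sigma> *\<^sub>R u" "gEnd C G x v = \<sigma> *\<^sub>R v"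
  shows "g x (anchor C x u) (anchor C x v) = \<sigma> * pairing C x u v"
proof -
  have "\<forall>\<sigma>\<in>{1, -1}. \<forall>u\<in>eigenbundle C G \<sigma> x. \<forall>v\<in>eigenbundle C G \<sigma> x.
      g x (anchor C x u) (anchor C x v) = G x u v"
    using induced unfolding induced_metric_def by blast
  then have "g x (anchor C x u) (anchor C x v) = G x u v"
    using assms unfolding eigenbundle_def by blast
  then show ?thesis using G_eig[OF assms(2)] by simp
qed

lemma eig_orthogonal:
  assumes "\<sigma> \<in> {1, -1}" "gEnd C G x u = \<sigma> *\<^sub>R u" "gEnd C G x v = - \<sigma> *\<^sub>R v"
  shows "pairing C x u v = 0"
  using gEnd_sym[of x u v] assms by (auto simp: P_simps bilinear_lneg[OF E.m_bilinear] bilinear_rneg[OF E.m_bilinear])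

text \<open>Projections are self-adjoint, so only the component of \<open>v\<close> in the
  eigenbundle of \<open>u\<close> counts, and there \<open>g\<close> and the scalar product differ
  by the sign.\<close>

lemma pairing_eig:
  assumes "\<sigma> \<in> {1, -1}" "gEnd C G x u = \<sigma> *\<^sub>R u"
  shows "pairing C x u v = \<sigma> * g x (anchor C x u) (anchor C x (pr \<sigma> x v))"
proof -
  have "pairing C x u v = pairing C x u (pr \<sigma> x v)"
    using pr_pairing[of x \<sigma> u v] pr_same[OF assms] by simp
  moreover have "\<sigma> * \<sigma> = 1" using assms by auto
  ultimately show ?thesis
    by (simp add: induced_eig[OF assms pr_eig[OF assms(1)]] flip: mult.assoc)
qed

section \<open>The anchor on an eigenbundle\<close>

lemma anchor_eig_inj:
  assumes "\<sigma> \<in> {1, -1}" "gEnd C G x u = \<sigma> *\<^sub>R u" "anchor C x u = 0"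
  shows "u = 0"
proof -
  have "pairing C x u v = 0" for v
    by (simp add: pairing_eig[OF assms(1,2)] assms(3) bilinear_lzero[OF T.m_bilinear])
  then show ?thesis using E.m_nondegenerate[of x] unfolding nondegenerate_def by blast
qed

text \<open>Exactness enters here: the element of \<open>E\<close> representing a covector of the
  base lies in the kernel of the anchor.\<close>

lemma cotangent_vector:
  assumes "linear \<alpha>"
  obtains a where "anchor C x a = 0" "\<And>v. pairing C x a v = \<alpha> (anchor C x v) / 2"
proof -
  have "linear (\<lambda>v. \<alpha> (anchor C x v) / 2)"
    by (rule linearI) (simp_all add: anchor_simps linear_add[OF assms] linear_cmul[OF assms] add_divide_distrib)
  from theI'[OF nondegenerate_represent[OF E.m_bilinear E.m_nondegenerate this], of x]
  have "\<forall>v. pairing C x (cotangent_incl C x \<alpha>) v = \<alpha> (anchor C x v) / 2"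
    unfolding cotangent_incl_def .
  moreover have "cotangent_incl C x ` {\<alpha>. linear \<alpha>} = {a. anchor C x a = 0}"
    using exact unfolding exact_courant_algebroid_def by blast
  then have "anchor C x (cotangent_incl C x \<alpha>) = 0" using assms by blast
  ultimately show ?thesis using that by blast
qed

text \<open>The covector \<open>g(Y, \<cdot>)\<close> of such a \<open>Y\<close>, as an element of \<open>E\<close>, lies in the other eigenbundle and
  in the kernel of the anchor.\<close>

lemma anchor_eig_orthogonal:
  assumes \<sigma>: "\<sigma> \<in> {1, -1}" and Y: "\<And>v. g x Y (anchor C x (pr \<sigma> x v)) = 0"
  shows "Y = 0"
proof -
  obtain a where a: "anchor C x a = 0" "\<And>v. pairing C x a v = g x Y (anchor C x v) / 2"
    by (rule cotangent_vector[of "g x Y" x, OF bilinear_right[OF T.m_bilinear]]) blast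
  have "pr \<sigma> x a = 0"
    by (rule P_eqI[of x]) (simp add: pr_pairing a(2) Y bilinear_lzero[OF E.m_bilinear])
  then have "a = pr (- \<sigma>) x a" using pr_sum[of x a] \<sigma> by auto
  then have "gEnd C G x a = - \<sigma> *\<^sub>R a" using pr_eig[of "- \<sigma>" x a] \<sigma> by auto
  then have "a = 0" using anchor_eig_inj[of "- \<sigma>" x a] \<sigma> a(1) by auto
  then have "g x Y (anchor C x v) = 0" for v
    using a(2)[of v] by (simp add: bilinear_lzero[OF E.m_bilinear])
  moreover have "surj (anchor C x)" using exact unfolding exact_courant_algebroid_def by blast
  ultimately have "g x Y Z = 0" for Z by (metis surjD)
  then show ?thesis using T.m_nondegenerate[of x] unfolding nondegenerate_def by blast
qed

text \<open>The inverse of the anchor on \<open>E\<^sub>\<sigma>\<close>, given through its pairings so that its smoothness follows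
  from \<open>E.smooth_dual_section\<close>.\<close>

definition lf :: "real \<Rightarrow> 'm \<Rightarrow> real ^ 'n \<Rightarrow> 'v" where
  "lf \<sigma> x \<xi> = (THE w. \<forall>v. pairing C x w v = \<sigma> * g x \<xi> (anchor C x (pr \<sigma> x v)))"

lemma lf_pairing: "pairing C x (lf \<sigma> x \<xi>) v = \<sigma> * g x \<xi> (anchor C x (pr \<sigma> x v))"
proof -
  have "linear (\<lambda>v. \<sigma> * g x \<xi> (anchor C x (pr \<sigma> x v)))"
    by (rule linearI)
      (simp_all add: anchor_simps linear_add[OF pr_linear] linear_cmul[OF pr_linear] gm_simps algebra_simps)
  from theI'[OF nondegenerate_represent[OF E.m_bilinear E.m_nondegenerate this], of x]
  show ?thesis unfolding lf_def by blast
qed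

lemma pr_pr: "\<sigma> \<in> {1, -1} \<Longrightarrow> pr \<sigma> x (pr \<sigma> x v) = pr \<sigma> x v"
  using pr_same[OF _ pr_eig] by blast

lemma lf_eig:
  assumes "\<sigma> \<in> {1, -1}"
  shows "gEnd C G x (lf \<sigma> x \<xi>) = \<sigma> *\<^sub>R lf \<sigma> x \<xi>"
proof -
  have "pr \<sigma> x (lf \<sigma> x \<xi>) = lf \<sigma> x \<xi>"
    by (rule P_eqI[of x]) (simp add: pr_pairing lf_pairing pr_pr[OF assms])
  then show ?thesis using pr_eig[OF assms, of x "lf \<sigma> x \<xi>"] by simp
qed

text \<open>Surjectivity of the anchor on an eigenbundle is obtained by orthogonality and not by
  computing ranks: the error is \<open>g\<close>-orthogonal to the image of the eigenbundle and
  hence zero.\<close>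

lemma anchor_lf:
  assumes "\<sigma> \<in> {1, -1}"
  shows "anchor C x (lf \<sigma> x \<xi>) = \<xi>"
proof -
  have "anchor C x (lf \<sigma> x \<xi>) - \<xi> = 0"
  proof (rule anchor_eig_orthogonal[OF assms])
    fix v
    have "\<sigma> * g x (anchor C x (lf \<sigma> x \<xi>)) (anchor C x (pr \<sigma> x v)) = \<sigma> * g x \<xi> (anchor C x (pr \<sigma> x v))"
      using pairing_eig[OF assms lf_eig[OF assms]] lf_pairing by metis
    then show "g x (anchor C x (lf \<sigma> x \<xi>) - \<xi>) (anchor C x (pr \<sigma> x v)) = 0"
      using assms by (auto simp: gm_simps)
  qed
  then show ?thesis by simp
qed

lemma lf_anchor:
  assumes "\<sigma> \<in> {1, -1}" "gEnd C G x u = \<sigma> *\<^sub>R u"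
  shows "lf \<sigma> x (anchor C x u) = u"
  by (rule P_eqI[of x]) (simp add: lf_pairing pairing_eig[OF assms])

lemma lf_linear: "linear (lf \<sigma> x)"
proof (rule linearI)
  show "lf \<sigma> x (u + v) = lf \<sigma> x u + lf \<sigma> x v" for u v
    by (rule P_eqI[of x]) (simp add: P_simps lf_pairing gm_simps algebra_simps)
  show "lf \<sigma> x (r *\<^sub>R u) = r *\<^sub>R lf \<sigma> x u" for r u
    by (rule P_eqI[of x]) (simp add: P_simps lf_pairing gm_simps)
qed

lemma pairing_lf: "\<sigma> \<in> {1, -1} \<Longrightarrow> pairing C x (lf \<sigma> x \<xi>) (lf \<sigma> x \<eta>) = \<sigma> * g x \<xi> \<eta>"
  by (simp add: lf_pairing pr_same lf_eig anchor_lf)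

lemma pr_lf_other: "\<sigma> \<in> {1, -1} \<Longrightarrow> pr (- \<sigma>) x (lf \<sigma> x \<eta>) = 0"
  by (rule pr_other) (simp_all add: lf_eig)

lemma pr_sec: "sec C u \<Longrightarrow> sec C (\<lambda>x. pr \<sigma> x (u x))"
proof -
  assume u: "sec C u"
  have "sec C (\<lambda>x. gEnd C G x (u x))"
    by (rule E.smooth_dual_section[where \<alpha> = "\<lambda>x. G x (u x)"])
      (simp_all add: gEnd_pairing GE.m_smooth u)
  then show ?thesis unfolding pr_def by (intro E.sec_add E.sec_scale_const u)
qed

lemma lf_sec: "vector_field (atlas C) X \<Longrightarrow> sec C (\<lambda>x. lf \<sigma> x (X x))"
  by (rule E.smooth_dual_section[where \<alpha> = "\<lambda>x v. \<sigma> * g x (X x) (anchor C x (pr \<sigma> x v))"])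
    (auto simp: lf_pairing intro!: E.smooth_map_on_mult E.smooth_map_on_const T.m_smooth
      anc_vector_field pr_sec)

lemma anc_lf: "\<sigma> \<in> {1, -1} \<Longrightarrow> anc C (\<lambda>x. lf \<sigma> x (X x)) = X"
  by (simp add: anchor_lf)

text \<open>Both fields are lifted to \<open>E\<close>. The anchor sends the Courant bracket of the
  lifts to the Lie bracket, and for the Courant bracket the commutator formula is known from the
  Jacobi identity.\<close>

lemma lie_bracket_apply:
  assumes "vector_field (atlas C) X" "vector_field (atlas C) Y" "smooth_fun (atlas C) f"
  shows "vapply (atlas C) (lie_bracket (atlas C) X Y) f x =
    vapply (atlas C) X (vapply (atlas C) Y f) x - vapply (atlas C) Y (vapply (atlas C) X f) x"
proof -
  note sX = lf_sec[OF assms(1), of 1] and sY = lf_sec[OF assms(2), of 1]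
  show ?thesis
    using act_bracket[OF sX sY assms(3), of x] unfolding anc_bracket[OF sX sY]
    by (simp add: anchor_lf)
qed

end

section \<open>The generalised scalar curvature\<close>

locale generalised_levi_civita_geometry = generalised_geometry C G g + torsion_free_connection C D
  for C :: "('m::{t2_space,second_countable_topology}, 'n::finite, 'v::euclidean_space) courant"
    and G :: "'m \<Rightarrow> 'v \<Rightarrow> 'v \<Rightarrow> real"
    and g :: "'m \<Rightarrow> real ^ 'n \<Rightarrow> real ^ 'n \<Rightarrow> real"
    and D :: "('m, 'v) gconn" +
  fixes nabla :: "('m \<Rightarrow> real ^ 'n) \<Rightarrow> ('m \<Rightarrow> real ^ 'n) \<Rightarrow> 'm \<Rightarrow> real ^ 'n"
    and H :: "'m \<Rightarrow> real ^ 'n \<Rightarrow> real ^ 'n \<Rightarrow> real ^ 'n \<Rightarrow> real"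
  assumes levi_civita: "levi_civita (atlas C) g nabla"
    and three_form: "courant_three_form C G g H"
    and D_metric: "sec C u \<Longrightarrow> sec C v \<Longrightarrow> sec C w \<Longrightarrow>
      act C u (\<lambda>x. G x (v x) (w x)) = (\<lambda>x. G x (D u v x) (w x) + G x (v x) (D u w x))"
begin

sublocale LC: levi_civita_geometry "atlas C" g nabla
  by unfold_locales (fact levi_civita, rule lie_bracket_apply)

section \<open>Lifted vector fields and their brackets\<close>

definition Lf :: "real \<Rightarrow> ('m \<Rightarrow> real ^ 'n) \<Rightarrow> 'm \<Rightarrow> 'v" where
  "Lf \<sigma> X x = lf \<sigma> x (X x)"

lemma Lf_sec: "vector_field (atlas C) X \<Longrightarrow> sec C (Lf \<sigma> X)"
  unfolding Lf_def[abs_def] by (rule lf_sec)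

lemma anc_Lf: "\<sigma> \<in> {1, -1} \<Longrightarrow> anc C (Lf \<sigma> X) = X"
  unfolding Lf_def[abs_def] by (rule anc_lf)

lemma Lf_add: "Lf \<sigma> (\<lambda>x. X x + Y x) = (\<lambda>x. Lf \<sigma> X x + Lf \<sigma> Y x)"
  and Lf_scale: "Lf \<sigma> (\<lambda>x. f x *\<^sub>R X x) = (\<lambda>x. f x *\<^sub>R Lf \<sigma> X x)"
  by (simp_all add: Lf_def[abs_def] linear_add[OF lf_linear] linear_cmul[OF lf_linear])

lemma phi_Lf:
  assumes "\<sigma> \<in> {1, -1}"
  shows "phi C G g (Lf \<sigma> X) = (\<lambda>x. (X x, \<lambda>\<zeta>. \<sigma> * g x (X x) \<zeta>))"
proof (rule ext)
  fix x
  have "pr \<sigma> x (lf \<sigma> x (X x)) = lf \<sigma> x (X x)" "pr (- \<sigma>) x (lf \<sigma> x (X x)) = 0"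
    using pr_same[OF assms lf_eig[OF assms]] pr_lf_other[OF assms] by auto
  then show "phi C G g (Lf \<sigma> X) x = (X x, \<lambda>\<zeta>. \<sigma> * g x (X x) \<zeta>)"
    using assms
    by (auto simp: phi_def gproj_eq Lf_def anchor_lf linear_0[OF anchor_linear]
        LC.g_simps)
qed

text \<open>\<open>phi\<close> respects scalar products. Since the twisted bracket is given through
  \<open>phi\<close>, pairings with brackets can be computed on the base.\<close>

lemma pairing_phi:
  "pairing C x (u x) (v x) = (1 / 2) *
    (snd (phi C G g u x) (anchor C x (v x)) + snd (phi C G g v x) (anchor C x (u x)))"
proof -
  have e: "pairing C x p q = g x (anchor C x (pr 1 x p)) (anchor C x (pr 1 x q))
      - g x (anchor C x (pr (- 1) x p)) (anchor C x (pr (- 1) x q))" for p q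
  proof -
    have "pairing C x p q = pairing C x (pr 1 x p) q + pairing C x (pr (- 1) x p) q"
      by (simp add: pr_sum flip: bilinear_ladd[OF E.m_bilinear])
    then show ?thesis
      using pairing_eig[OF _ pr_eig, of 1 x p q] pairing_eig[OF _ pr_eig, of "- 1" x p q] by simp
  qed
  have a: "anchor C x p = anchor C x (pr 1 x p) + anchor C x (pr (- 1) x p)" for p
    by (simp add: pr_sum flip: linear_add[OF anchor_linear])
  show ?thesis
    unfolding phi_def gproj_eq snd_conv e a[of "v x"] a[of "u x"]
    by (simp add: LC.g_simps T.m_sym)
qed

lemma vapply_scale_const:
  "smooth_fun (atlas C) f \<Longrightarrow> vapply (atlas C) X (\<lambda>y. r * f y) x = r * vapply (atlas C) X f x"
  unfolding vapply_def
  by (subst E.tderiv_mult[OF E.smooth_map_on_const _ UNIV_I]) (simp_all add: E.tderiv_const)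

lemma nabla_vext:
  "vector_field (atlas C) Y \<Longrightarrow> vector_field (atlas C) Z \<Longrightarrow>
    nabla (vext (atlas C) x (Z x)) Y x = nabla Z Y x"
  by (rule T.tensorial_cong[OF LC.nabla_tensorial T.is_sec_ext _ T.ext_at])

lemma vapply_metric:
  assumes "vector_field (atlas C) X" "vector_field (atlas C) Y" "vector_field (atlas C) Z"
  shows "vapply (atlas C) X (\<lambda>y. r * g y (Y y) (Z y)) x =
    r * (g x (nabla X Y x) (Z x) + g x (Y x) (nabla X Z x))"
  using vapply_scale_const[OF T.m_smooth[OF assms(2,3)]] LC.nabla_metric[OF assms] by simp

text \<open>Written with the torsion-free \<nabla>, the derivatives of the chosen extension of
  \<open>Z x\<close> cancel, and only its value at \<open>x\<close> is left. The same happens for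
  the exterior derivative.\<close>

lemma lie_deriv_metric:
  assumes "vector_field (atlas C) X" "vector_field (atlas C) Y" "vector_field (atlas C) Z"
  shows "lie_deriv_form (atlas C) X (\<lambda>x \<zeta>. r * g x (Y x) \<zeta>) x (Z x) =
    r * (g x (nabla X Y x) (Z x) + g x (Y x) (nabla Z X x))"
proof -
  note v = T.is_sec_ext[of x "Z x"]
  show ?thesis
    unfolding lie_deriv_form_def Let_def vapply_metric[OF assms(1,2) v] LC.lie_bracket_eq[OF assms(1) v]
    by (simp add: nabla_vext[OF assms(1,3)] T.ext_at LC.g_simps algebra_simps)
qed

lemma ext_deriv_metric:
  assumes "vector_field (atlas C) X" "vector_field (atlas C) Y" "vector_field (atlas C) Z"
  shows "ext_deriv1 (atlas C) (\<lambda>x \<zeta>. r * g x (X x) \<zeta>) x (Y x) (Z x) =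
    r * (g x (nabla Y X x) (Z x) - g x (nabla Z X x) (Y x))"
proof -
  note v = T.is_sec_ext[of x "Z x"] and w = T.is_sec_ext[of x "Y x"]
  show ?thesis
    unfolding ext_deriv1_def Let_def vapply_metric[OF w assms(1) v] vapply_metric[OF v assms(1) w]
      LC.lie_bracket_eq[OF w v]
    by (simp add: nabla_vext[OF assms(1,3)] nabla_vext[OF assms(1,2)] T.ext_at LC.g_simps algebra_simps)
qed

text \<open>One formula serves all sign combinations: \<open>\<rho>\<close> multiplies the vector
  part of the bracket, \<open>\<tau>\<close> the Lie derivative of the second covector, and
  \<open>\<sigma>\<close> the exterior derivative of the first.\<close>

lemma bracket_Lf:
  assumes s: "\<sigma> \<in> {1, -1}" "\<tau> \<in> {1, -1}" "\<rho> \<in> {1, -1}"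
    and X: "vector_field (atlas C) X" and Y: "vector_field (atlas C) Y"
    and Z: "vector_field (atlas C) Z"
  shows "pairing C x (bracket C (Lf \<sigma> X) (Lf \<tau> Y) x) (Lf \<rho> Z x) = (1 / 2) *
    (\<rho> * (g x (nabla X Y x) (Z x) - g x (nabla Y X x) (Z x))
     + \<tau> * (g x (nabla X Y x) (Z x) + g x (nabla Z X x) (Y x))
     - \<sigma> * (g x (nabla Y X x) (Z x) - g x (nabla Z X x) (Y x)) + H x (X x) (Y x) (Z x))"
proof -
  have sec: "sec C (Lf \<sigma> X)" "sec C (Lf \<tau> Y)" using X Y by (simp_all add: Lf_sec)
  have "phi C G g (bracket C (Lf \<sigma> X) (Lf \<tau> Y)) x =
      twisted_bracket (atlas C) H (phi C G g (Lf \<sigma> X)) (phi C G g (Lf \<tau> Y)) x"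
    using three_form sec unfolding courant_three_form_def by metis
  then have 1: "snd (phi C G g (bracket C (Lf \<sigma> X) (Lf \<tau> Y)) x) (Z x) =
      lie_deriv_form (atlas C) X (\<lambda>x \<zeta>. \<tau> * g x (Y x) \<zeta>) x (Z x)
      - ext_deriv1 (atlas C) (\<lambda>x \<zeta>. \<sigma> * g x (X x) \<zeta>) x (Y x) (Z x) + H x (X x) (Y x) (Z x)"
    by (simp add: twisted_bracket_def phi_Lf[OF s(1)] phi_Lf[OF s(2)] Let_def o_def)
  have 2: "anchor C x (bracket C (Lf \<sigma> X) (Lf \<tau> Y) x) = nabla X Y x - nabla Y X x"
    using fun_cong[OF anc_bracket[OF sec], of x]
    by (simp add: anc_Lf[OF s(1)] anc_Lf[OF s(2)] LC.lie_bracket_eq[OF X Y])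
  have 3: "anchor C x (Lf \<rho> Z x) = Z x" using fun_cong[OF anc_Lf[OF s(3)]] .
  show ?thesis
    unfolding pairing_phi[of x "bracket C (Lf \<sigma> X) (Lf \<tau> Y)" "Lf \<rho> Z"] phi_Lf[OF s(3)] 1 2 3
      lie_deriv_metric[OF X Y Z] ext_deriv_metric[OF X Y Z]
    by (simp add: LC.g_simps T.m_sym algebra_simps)
qed

text \<open>\<open>D\<close> is compatible with both \<open>G\<close> and the scalar product, and on
  an eigensection these differ by the constant factor \<open>\<sigma>\<close>. Comparing the two
  product rules gives the claim.\<close>

lemma D_eig:
  assumes sec: "sec C u" "sec C v" and v: "\<And>y. gEnd C G y (v y) = \<sigma> *\<^sub>R v y"
  shows "gEnd C G x (D u v x) = \<sigma> *\<^sub>R D u v x"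
proof (rule P_eqI[of x])
  fix p
  define w where "w = sext C x p"
  have w: "sec C w" "w x = p" unfolding w_def by (rule E.is_sec_ext, rule E.ext_at)
  have "G x (D u v x) (w x) + G x (v x) (D u w x) = act C u (\<lambda>x. G x (v x) (w x)) x"
    using D_metric[OF sec w(1)] by simp
  also have "\<dots> = act C u (\<lambda>x. \<sigma> * pairing C x (v x) (w x)) x"
    by (simp add: G_eig[OF v])
  also have "\<dots> = \<sigma> * (pairing C x (D u v x) (w x) + pairing C x (v x) (D u w x))"
    using vapply_scale_const[OF E.m_smooth[OF sec(2) w(1)]] D_pairing[OF sec w(1)] by simp
  finally show "pairing C x (gEnd C G x (D u v x)) p = pairing C x (\<sigma> *\<^sub>R D u v x) p"
    by (simp add: gEnd_pairing P_simps w(2) G_eig[OF v] distrib_left)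
qed

section \<open>The connections induced on the tangent bundle\<close>

definition N :: "real \<Rightarrow> ('m \<Rightarrow> real ^ 'n) \<Rightarrow> ('m \<Rightarrow> real ^ 'n) \<Rightarrow> 'm \<Rightarrow> real ^ 'n" where
  "N \<sigma> X Y x = anchor C x (D (Lf \<sigma> X) (Lf \<sigma> Y) x)"

definition S :: "real \<Rightarrow> ('m \<Rightarrow> real ^ 'n) \<Rightarrow> ('m \<Rightarrow> real ^ 'n) \<Rightarrow> 'm \<Rightarrow> real ^ 'n" where
  "S \<sigma> X Y x = N \<sigma> X Y x - nabla X Y x"

lemma Lf_eig: "\<sigma> \<in> {1, -1} \<Longrightarrow> gEnd C G y (Lf \<sigma> X y) = \<sigma> *\<^sub>R Lf \<sigma> X y"
  unfolding Lf_def by (rule lf_eig)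

lemma D_Lf_eig:
  "\<sigma> \<in> {1, -1} \<Longrightarrow> sec C u \<Longrightarrow> vector_field (atlas C) X \<Longrightarrow>
    gEnd C G x (D u (Lf \<sigma> X) x) = \<sigma> *\<^sub>R D u (Lf \<sigma> X) x"
  by (rule D_eig) (simp_all add: Lf_sec Lf_eig)

lemma D_Lf:
  assumes "\<sigma> \<in> {1, -1}" "vector_field (atlas C) X" "vector_field (atlas C) Y"
  shows "D (Lf \<sigma> X) (Lf \<sigma> Y) = Lf \<sigma> (N \<sigma> X Y)"
proof (rule ext)
  fix x
  show "D (Lf \<sigma> X) (Lf \<sigma> Y) x = Lf \<sigma> (N \<sigma> X Y) x"
    using lf_anchor[OF assms(1) D_Lf_eig[OF assms(1) Lf_sec[OF assms(2)] assms(3)]]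
    by (simp add: Lf_def N_def)
qed

lemma N_field:
  assumes "vector_field (atlas C) X" "vector_field (atlas C) Y"
  shows "vector_field (atlas C) (N \<sigma> X Y)"
  unfolding N_def[abs_def] by (intro anc_vector_field D_sec Lf_sec assms)

lemma pairing_Lf: "\<sigma> \<in> {1, -1} \<Longrightarrow> pairing C x (Lf \<sigma> X x) (Lf \<sigma> Y x) = \<sigma> * g x (X x) (Y x)"
  unfolding Lf_def by (rule pairing_lf)

lemma pairing_other:
  "\<sigma> \<in> {1, -1} \<Longrightarrow> gEnd C G x u = \<sigma> *\<^sub>R u \<Longrightarrow> pairing C x u (Lf (- \<sigma>) Y x) = 0"
  by (rule eig_orthogonal[of \<sigma>]) (use Lf_eig[of "- \<sigma>"] in auto)

lemma act_Lf: "\<sigma> \<in> {1, -1} \<Longrightarrow> act C (Lf \<sigma> X) f = vapply (atlas C) X f"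
  by (simp add: anc_Lf)

lemma N_metric:
  assumes s: "\<sigma> \<in> {1, -1}" and XYZ: "vector_field (atlas C) X" "vector_field (atlas C) Y"
    "vector_field (atlas C) Z"
  shows "vapply (atlas C) X (\<lambda>y. g y (Y y) (Z y)) x = g x (N \<sigma> X Y x) (Z x) + g x (Y x) (N \<sigma> X Z x)"
proof -
  have "\<sigma> * vapply (atlas C) X (\<lambda>y. g y (Y y) (Z y)) x = act C (Lf \<sigma> X) (ip C (Lf \<sigma> Y) (Lf \<sigma> Z)) x"
    unfolding act_Lf[OF s] pairing_Lf[OF s]
    by (rule vapply_scale_const[symmetric, OF T.m_smooth[OF XYZ(2,3)]])
  also have "\<dots> = ip C (D (Lf \<sigma> X) (Lf \<sigma> Y)) (Lf \<sigma> Z) x + ip C (Lf \<sigma> Y) (D (Lf \<sigma> X) (Lf \<sigma> Z)) x"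
    by (rule fun_cong[OF D_pairing]) (intro Lf_sec XYZ)+
  also have "\<dots> = \<sigma> * (g x (N \<sigma> X Y x) (Z x) + g x (Y x) (N \<sigma> X Z x))"
    by (simp add: XYZ D_Lf[OF s] pairing_Lf[OF s] distrib_left)
  finally show ?thesis using s by auto
qed

lemma contorsion:
  assumes s: "\<sigma> \<in> {1, -1}"
  shows "levi_civita_contorsion (atlas C) g nabla (S \<sigma>) (\<lambda>x a b c. \<sigma> / 2 * H x a b c)"
proof unfold_locales
  fix X Y Z :: "'m \<Rightarrow> real ^ 'n" and x
  assume X: "vector_field (atlas C) X" and Y: "vector_field (atlas C) Y"
  show "vector_field (atlas C) (S \<sigma> X Y)"
    unfolding S_def[abs_def] by (intro T.sec_diff N_field LC.nabla_field X Y)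
  assume Z: "vector_field (atlas C) Z"
  have sk: "g x (S \<sigma> X Y x) (Z x) = - g x (S \<sigma> X Z x) (Y x)"
    if "vector_field (atlas C) X" "vector_field (atlas C) Y" "vector_field (atlas C) Z" for X Y Z
    using N_metric[OF s that, of x] LC.nabla_metric[OF that]
    by (simp add: S_def LC.g_simps T.m_sym)
  show "g x (S \<sigma> X Y x) (Z x) = - g x (S \<sigma> X Z x) (Y x)" by (rule sk[OF X Y Z])
  \<comment> \<open>The torsion is tested on three lifts with the same sign. Subtracting the
    matching \<nabla> terms of the bracket leaves \<open>H / 2\<close>, and skewness of
    \<open>S\<close> turns the left-hand side into a cyclic sum.\<close>
  have "\<sigma> * (g x (N \<sigma> X Y x) (Z x) - g x (N \<sigma> Y X x) (Z x) + g x (N \<sigma> Z X x) (Y x)) =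
      pairing C x (bracket C (Lf \<sigma> X) (Lf \<sigma> Y) x) (Lf \<sigma> Z x)"
    using torsion_eq[OF Lf_sec[OF X, of \<sigma>] Lf_sec[OF Y, of \<sigma>] Lf_sec[OF Z, of \<sigma>], of x]
    by (simp add: D_Lf[OF s] X Y Z P_simps pairing_Lf[OF s] algebra_simps)
  also have "\<dots> = \<sigma> * (g x (nabla X Y x) (Z x) - g x (nabla Y X x) (Z x) + g x (nabla Z X x) (Y x))
      + H x (X x) (Y x) (Z x) / 2"
    unfolding bracket_Lf[OF s s s X Y Z] by (simp add: field_simps)
  finally have "\<sigma> * (g x (S \<sigma> X Y x) (Z x) - g x (S \<sigma> Y X x) (Z x) + g x (S \<sigma> Z X x) (Y x)) =
      H x (X x) (Y x) (Z x) / 2"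
    by (simp add: S_def LC.g_simps algebra_simps)
  then show "g x (S \<sigma> X Y x) (Z x) + g x (S \<sigma> Y Z x) (X x) + g x (S \<sigma> Z X x) (Y x) =
      \<sigma> / 2 * H x (X x) (Y x) (Z x)"
    using s sk[OF Y X Z] by auto
next
  fix Y :: "'m \<Rightarrow> real ^ 'n" and x
  assume Y: "vector_field (atlas C) Y"
  show "T.tensorial x (\<lambda>X. S \<sigma> X Y x)"
  proof (rule T.tensorialI)
    fix X X' assume "vector_field (atlas C) X" "vector_field (atlas C) X'"
    then show "S \<sigma> (\<lambda>y. X y + X' y) Y x = S \<sigma> X Y x + S \<sigma> X' Y x"
      by (simp add: S_def N_def Lf_add D_add_left LC.nabla_add_left Lf_sec Y anchor_simps)
  next
    fix f X assume "smooth_fun (atlas C) f" "vector_field (atlas C) X"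
    then show "S \<sigma> (\<lambda>y. f y *\<^sub>R X y) Y x = f x *\<^sub>R S \<sigma> X Y x"
      by (simp add: S_def N_def Lf_scale D_scale_left LC.nabla_scale_left Lf_sec Y anchor_simps
          scaleR_diff_right)
  qed
next
  fix X :: "'m \<Rightarrow> real ^ 'n" and x
  assume X: "vector_field (atlas C) X"
  show "T.tensorial x (\<lambda>Y. S \<sigma> X Y x)"
  proof (rule T.tensorialI)
    fix Y Y' assume "vector_field (atlas C) Y" "vector_field (atlas C) Y'"
    then show "S \<sigma> X (\<lambda>y. Y y + Y' y) x = S \<sigma> X Y x + S \<sigma> X Y' x"
      by (simp add: S_def N_def Lf_add D_add_right LC.nabla_add_right Lf_sec X anchor_simps)
  next
    fix f Y assume "smooth_fun (atlas C) f" "vector_field (atlas C) Y"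
    then show "S \<sigma> X (\<lambda>y. f y *\<^sub>R Y y) x = f x *\<^sub>R S \<sigma> X Y x"
      by (simp add: S_def N_def Lf_scale D_leibniz LC.nabla_leibniz Lf_sec X anchor_simps
          act_Lf[OF s] fun_cong[OF anc_Lf[OF s]] scaleR_diff_right)
  qed
qed

text \<open>In the torsion identity for one section of the other eigenbundle and two of this one,
  the remaining connection terms pair orthogonal eigenbundles. The bracket alone determines
  \<open>D\<close> here, so this part is common to all generalised Levi-Civita connections.\<close>

lemma D_mixed:
  assumes s: "\<sigma> \<in> {1, -1}"
    and X: "vector_field (atlas C) X" and Y: "vector_field (atlas C) Y"
    and Z: "vector_field (atlas C) Z"
  shows "pairing C x (D (Lf (- \<sigma>) X) (Lf \<sigma> Y) x) (Lf \<sigma> Z x) =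
    \<sigma> * (g x (nabla X Y x) (Z x) + \<sigma> / 2 * H x (X x) (Y x) (Z x))"
proof -
  have s': "- \<sigma> \<in> {1, -1}" using s by auto
  have z: "pairing C x (D u (Lf (- \<sigma>) X) x) (Lf \<sigma> W x) = 0" if "sec C u" for u W
    using pairing_other[OF s' D_Lf_eig[OF s' that X]] by simp
  have "pairing C x (D (Lf (- \<sigma>) X) (Lf \<sigma> Y) x) (Lf \<sigma> Z x) =
      pairing C x (bracket C (Lf (- \<sigma>) X) (Lf \<sigma> Y) x) (Lf \<sigma> Z x)"
    using torsion_eq[OF Lf_sec[OF X, of "- \<sigma>"] Lf_sec[OF Y, of \<sigma>] Lf_sec[OF Z, of \<sigma>], of x]
    by (simp add: P_simps z Lf_sec Y Z)
  also have "\<dots> = \<sigma> * (g x (nabla X Y x) (Z x) + \<sigma> / 2 * H x (X x) (Y x) (Z x))"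
    unfolding bracket_Lf[OF s' s s X Y Z] using s by (auto simp: field_simps)
  finally show ?thesis .
qed

text \<open>A dual pair for \<open>g\<close> lifts to both eigenbundles and gives a frame of
  \<open>E\<close>. Its dual carries the factor \<open>\<sigma>\<close> for the scalar product,
  which is \<open>\<sigma> g\<close> on lifts, and no factor for \<open>G\<close>.\<close>

lemma lf_expand:
  assumes "dual_frame (g x) f f'"
  shows "v = (\<Sum>i\<in>{1, -1} \<times> Basis. pairing C x v (fst i *\<^sub>R lf (fst i) x (f' (snd i))) *\<^sub>R
    lf (fst i) x (f (snd i)))"
    and "v = (\<Sum>i\<in>{1, -1} \<times> Basis. G x v (lf (fst i) x (f' (snd i))) *\<^sub>R lf (fst i) x (f (snd i)))"
proof -
  have e: "pr \<sigma> x v = (\<Sum>b\<in>Basis. g x (anchor C x (pr \<sigma> x v)) (f' b) *\<^sub>R lf \<sigma> x (f b))"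
    if "\<sigma> \<in> {1, -1}" for \<sigma>
  proof -
    have "pr \<sigma> x v = lf \<sigma> x (anchor C x (pr \<sigma> x v))"
      using lf_anchor[OF that pr_eig[OF that]] by simp
    also have "\<dots> = lf \<sigma> x (\<Sum>b\<in>Basis. g x (anchor C x (pr \<sigma> x v)) (f' b) *\<^sub>R f b)"
      by (rule arg_cong[OF dual_frame_expand[OF T.m_bilinear assms]])
    finally show ?thesis by (simp add: linear_sum[OF lf_linear] linear_cmul[OF lf_linear])
  qed
  have p: "\<sigma> * pairing C x v (lf \<sigma> x \<xi>) = g x (anchor C x (pr \<sigma> x v)) \<xi>" if "\<sigma> \<in> {1, -1}" for \<sigma> \<xi>
    using that by (auto simp: E.m_sym[of x v] lf_pairing T.m_sym)
  have 1: "v = (\<Sum>\<sigma>\<in>{1, -1}. \<Sum>b\<in>Basis. g x (anchor C x (pr \<sigma> x v)) (f' b) *\<^sub>R lf \<sigma> x (f b))"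
    using e[of 1] e[of "- 1"] pr_sum[of x v] by simp
  have "(\<Sum>i\<in>{1, -1} \<times> Basis. pairing C x v (fst i *\<^sub>R lf (fst i) x (f' (snd i))) *\<^sub>R
      lf (fst i) x (f (snd i))) =
      (\<Sum>\<sigma>\<in>{1, -1}. \<Sum>b\<in>Basis. (\<sigma> * pairing C x v (lf \<sigma> x (f' b))) *\<^sub>R lf \<sigma> x (f b))"
    by (simp only: sum.cartesian_product' fst_conv snd_conv P_simps real_scaleR_def)
  also have "\<dots> = (\<Sum>\<sigma>\<in>{1, -1}. \<Sum>b\<in>Basis. g x (anchor C x (pr \<sigma> x v)) (f' b) *\<^sub>R lf \<sigma> x (f b))"
    by (intro sum.cong refl) (simp only: p)
  finally show "v = (\<Sum>i\<in>{1, -1} \<times> Basis. pairing C x v (fst i *\<^sub>R lf (fst i) x (f' (snd i))) *\<^sub>R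
      lf (fst i) x (f (snd i)))"
    using 1 by simp
  have q: "G x v (lf \<sigma> x \<xi>) = g x (anchor C x (pr \<sigma> x v)) \<xi>" if "\<sigma> \<in> {1, -1}" for \<sigma> \<xi>
    unfolding p[OF that, symmetric] GE.m_sym[of x v] G_eig[OF lf_eig[OF that]] by (simp add: E.m_sym)
  have "(\<Sum>i\<in>{1, -1} \<times> Basis. G x v (lf (fst i) x (f' (snd i))) *\<^sub>R lf (fst i) x (f (snd i))) =
      (\<Sum>\<sigma>\<in>{1, -1}. \<Sum>b\<in>Basis. G x v (lf \<sigma> x (f' b)) *\<^sub>R lf \<sigma> x (f b))"
    by (simp only: sum.cartesian_product' fst_conv snd_conv)
  also have "\<dots> = (\<Sum>\<sigma>\<in>{1, -1}. \<Sum>b\<in>Basis. g x (anchor C x (pr \<sigma> x v)) (f' b) *\<^sub>R lf \<sigma> x (f b))"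
    by (intro sum.cong refl) (simp only: q)
  finally show "v = (\<Sum>i\<in>{1, -1} \<times> Basis. G x v (lf (fst i) x (f' (snd i))) *\<^sub>R lf (fst i) x (f (snd i)))"
    using 1 by simp
qed

lemma trace_pairing:
  assumes "dual_frame (g x) f f'" "bilinear B"
  shows "metric_trace (pairing C x) B =
    (\<Sum>\<sigma>\<in>{1, -1}. \<Sum>b\<in>Basis. \<sigma> * B (lf \<sigma> x (f b)) (lf \<sigma> x (f' b)))"
  unfolding metric_trace_frame[OF E.m_bilinear E.m_nondegenerate E.m_sym assms(2) lf_expand(1)[OF assms(1)]]
  by (simp add: sum.cartesian_product' bilinear_rmul[OF assms(2)])

lemma trace_G:
  assumes "dual_frame (g x) f f'" "bilinear B"
  shows "metric_trace (G x) B =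
    (\<Sum>\<sigma>\<in>{1, -1}. \<Sum>b\<in>Basis. B (lf \<sigma> x (f b)) (lf \<sigma> x (f' b)))"
  unfolding metric_trace_frame[OF GE.m_bilinear GE.m_nondegenerate GE.m_sym assms(2) lf_expand(2)[OF assms(1)]]
  by (simp add: sum.cartesian_product')

lemma endo_trace_E:
  assumes "dual_frame (g x) f f'" "linear L"
  shows "endo_trace L =
    (\<Sum>\<sigma>\<in>{1, -1}. \<Sum>b\<in>Basis. \<sigma> * pairing C x (L (lf \<sigma> x (f b))) (lf \<sigma> x (f' b)))"
  unfolding endo_trace_frame[OF E.m_bilinear assms(2) lf_expand(1)[OF assms(1)]]
  by (simp add: sum.cartesian_product' P_simps)

end

section \<open>Curvature and divergence on lifted fields\<close>

context generalised_levi_civita_geometry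
begin

lemma D2_Lf_eig:
  assumes "\<sigma> \<in> {1, -1}" "vector_field (atlas C) Y" "sec C u" "sec C v"
  shows "gEnd C G x (D2 D u v (Lf \<sigma> Y) x) = \<sigma> *\<^sub>R D2 D u v (Lf \<sigma> Y) x"
proof -
  have "gEnd C G x (D u (D v (Lf \<sigma> Y)) x) = \<sigma> *\<^sub>R D u (D v (Lf \<sigma> Y)) x"
    by (rule D_eig[OF assms(3) D_sec[OF assms(4) Lf_sec[OF assms(2)]] D_Lf_eig[OF assms(1,4,2)]])
  moreover have "gEnd C G x (D (D u v) (Lf \<sigma> Y) x) = \<sigma> *\<^sub>R D (D u v) (Lf \<sigma> Y) x"
    by (rule D_Lf_eig[OF assms(1) D_sec[OF assms(3,4)] assms(2)])
  ultimately show ?thesis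
    by (simp add: D2_def linear_diff[OF gEnd_linear] scaleR_diff_right)
qed

text \<open>Since \<open>D\<close> preserves the eigenbundles, each commutator term pairs a vector
  of one eigenbundle with a vector of the other, and so does each factor of the trace term.\<close>

lemma Rmx_mixed:
  assumes s: "\<sigma> \<in> {1, -1}"
  shows "Rmx x (lf \<sigma> x a) (lf (- \<sigma>) x b) (lf \<sigma> x c) (lf (- \<sigma>) x d) = 0"
proof -
  define X where "X p = vext (atlas C) x p" for p
  have X: "vector_field (atlas C) (X p)" "X p x = p" for p
    unfolding X_def by (rule T.is_sec_ext, rule T.ext_at)
  have s': "- \<sigma> \<in> {1, -1}" using s by auto
  have o: "pairing C x u (Lf (- \<sigma>) Y x) = 0" if "gEnd C G x u = \<sigma> *\<^sub>R u" for u Y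
    by (rule pairing_other[OF s that])
  have o': "pairing C x u (Lf \<sigma> Y x) = 0" if "gEnd C G x u = - \<sigma> *\<^sub>R u" for u Y
    using pairing_other[OF s', of x u Y] that by simp
  have "Rm (Lf \<sigma> (X a)) (Lf (- \<sigma>) (X b)) (Lf \<sigma> (X c)) (Lf (- \<sigma>) (X d)) x = 0"
    unfolding gen_riemann_def
    by (simp add: P_simps Lf_sec X D_sec E.is_sec_ext metric_trace_def
        o[OF D2_Lf_eig[OF s]] o[OF D_Lf_eig[OF s]] o'[OF D2_Lf_eig[OF s']])
  then show ?thesis
    using Rmx_eq[OF Lf_sec[OF X(1)[of a], of \<sigma>] Lf_sec[OF X(1)[of b], of "- \<sigma>"]
        Lf_sec[OF X(1)[of c], of \<sigma>] Lf_sec[OF X(1)[of d], of "- \<sigma>"], of x]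
    by (simp add: Lf_def X(2))
qed

text \<open>The outer trace is taken with \<open>G\<close> and the inner one with the scalar
  product; the inner one contributes the sign that distinguishes the two eigenbundles.\<close>

lemma gen_scalar_pure:
  assumes f: "dual_frame (g x) f f'"
  shows "gen_scalar C G D x = (1 / 2) * (\<Sum>\<sigma>\<in>{1, -1}. \<Sum>i\<in>Basis. \<Sum>j\<in>Basis.
    \<sigma> * Rmx x (lf \<sigma> x (f i)) (lf \<sigma> x (f j)) (lf \<sigma> x (f' i)) (lf \<sigma> x (f' j)))"
proof -
  have b1: "bilinear (\<lambda>p r. Rmx x p q r s)" for q s
    unfolding bilinear_def by (auto intro: Rmx_linear)
  have b2: "bilinear (\<lambda>q s. metric_trace (pairing C x) (\<lambda>p r. Rmx x p q r s))"
    unfolding bilinear_def by (auto intro!: linear_metric_trace Rmx_linear)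
  have mixed: "Rmx x (lf 1 x a) (lf (- 1) x b) (lf 1 x c) (lf (- 1) x d) = 0"
    "Rmx x (lf (- 1) x a) (lf 1 x b) (lf (- 1) x c) (lf 1 x d) = 0" for a b c d
    using Rmx_mixed[of 1 x a b c d] Rmx_mixed[of "- 1" x a b c d] by simp_all
  have "gen_scalar C G D x = (1 / 2) * (\<Sum>\<sigma>\<in>{1, -1}. \<Sum>j\<in>Basis. \<Sum>\<tau>\<in>{1, -1}. \<Sum>i\<in>Basis.
    \<tau> * Rmx x (lf \<tau> x (f i)) (lf \<sigma> x (f j)) (lf \<tau> x (f' i)) (lf \<sigma> x (f' j)))"
    unfolding gen_scalar_eq trace_G[OF f b2] unfolding trace_pairing[OF f b1] ..
  also have "\<dots> = (1 / 2) * (\<Sum>\<sigma>\<in>{1, -1}. \<Sum>j\<in>Basis. \<Sum>i\<in>Basis.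
    \<sigma> * Rmx x (lf \<sigma> x (f i)) (lf \<sigma> x (f j)) (lf \<sigma> x (f' i)) (lf \<sigma> x (f' j)))"
    by (simp add: mixed)
  finally show ?thesis by (subst (asm) sum.swap[of _ Basis])
qed

lemma D2_Lf:
  assumes s: "\<sigma> \<in> {1, -1}" and "vector_field (atlas C) V" "vector_field (atlas C) W"
    "vector_field (atlas C) B"
  shows "D2 D (Lf \<sigma> V) (Lf \<sigma> W) (Lf \<sigma> B) x = lf \<sigma> x (D2 (N \<sigma>) V W B x)"
  by (simp add: D2_def D_Lf[OF s] assms N_field Lf_def linear_diff[OF lf_linear])

text \<open>Multiplying by \<open>\<sigma>\<close> compensates the sign in the scalar product of
  lifts, so that both eigenbundles lead to the same expression on the base.\<close>

lemma Rm_Lf: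
  assumes s: "\<sigma> \<in> {1, -1}" and F: "LC.dual_fields x F F'"
    and sec: "vector_field (atlas C) V" "vector_field (atlas C) W" "vector_field (atlas C) B"
      "vector_field (atlas C) Z"
  shows "\<sigma> * Rm (Lf \<sigma> Z) (Lf \<sigma> B) (Lf \<sigma> V) (Lf \<sigma> W) x = (1 / 2) *
    (g x (D2 (N \<sigma>) V W B x - D2 (N \<sigma>) W V B x) (Z x)
     + g x (D2 (N \<sigma>) B Z V x - D2 (N \<sigma>) Z B V x) (W x)
     - (\<Sum>k\<in>Basis. g x (N \<sigma> (F k) V x) (W x) * g x (N \<sigma> (F' k) B x) (Z x) -
        (g x (nabla (F k) V x) (W x) + \<sigma> / 2 * H x (F k x) (V x) (W x)) *
        (g x (nabla (F' k) B x) (Z x) + \<sigma> / 2 * H x (F' k x) (B x) (Z x))))"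
proof -
  have secF: "vector_field (atlas C) (F k)" "vector_field (atlas C) (F' k)" for k using F by auto
  have df: "dual_frame (g x) (\<lambda>b. F b x) (\<lambda>b. F' b x)" using F by blast
  have ss: "\<sigma> * \<sigma> = 1" using s by auto
  have ext: "D (sext C x (lf \<rho> x (X x))) v x = D (Lf \<rho> X) v x"
    if "vector_field (atlas C) X" "sec C v" for \<rho> X v
    by (rule E.tensorial_cong[OF D_tensorial[OF that(2)] E.is_sec_ext Lf_sec[OF that(1)]])
      (simp add: E.ext_at Lf_def)
  have bil: "bilinear (\<lambda>p r. ip C (D (sext C x p) (Lf \<sigma> V)) (Lf \<sigma> W) x *
      ip C (D (sext C x r) (Lf \<sigma> B)) (Lf \<sigma> Z) x)"
    by (intro bilinear_mult D_pairing_linear Lf_sec sec)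
  have pure: "pairing C x (D (Lf \<sigma> X) (Lf \<sigma> Y) x) (Lf \<sigma> Y' x) = \<sigma> * g x (N \<sigma> X Y x) (Y' x)"
    if "vector_field (atlas C) X" "vector_field (atlas C) Y" for X Y Y'
    by (simp add: D_Lf[OF s that] pairing_Lf[OF s])
  have two: "(\<Sum>\<rho>\<in>{1, -1}. h \<rho>) = h \<sigma> + h (- \<sigma>)" for h :: "real \<Rightarrow> real"
    using s by auto
  have "metric_trace (pairing C x) (\<lambda>p r. ip C (D (sext C x p) (Lf \<sigma> V)) (Lf \<sigma> W) x *
      ip C (D (sext C x r) (Lf \<sigma> B)) (Lf \<sigma> Z) x) =
    (\<Sum>\<rho>\<in>{1, -1}. \<Sum>k\<in>Basis. \<rho> * (ip C (D (Lf \<rho> (F k)) (Lf \<sigma> V)) (Lf \<sigma> W) x *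
      ip C (D (Lf \<rho> (F' k)) (Lf \<sigma> B)) (Lf \<sigma> Z) x))"
    unfolding trace_pairing[OF df bil] by (simp add: ext secF Lf_sec sec)
  \<comment> \<open>Half of the frame of \<open>E\<close> differentiates along the same eigenbundle
    and gives \<open>N\<close>; the other half enters with the opposite sign and gives
    \<open>\<nabla> + h\<close> by \<open>D_mixed\<close>.\<close>
  also have "\<dots> = (\<Sum>k\<in>Basis. \<sigma> * ((\<sigma> * g x (N \<sigma> (F k) V x) (W x)) * (\<sigma> * g x (N \<sigma> (F' k) B x) (Z x))))
    + (\<Sum>k\<in>Basis. - \<sigma> * ((\<sigma> * (g x (nabla (F k) V x) (W x) + \<sigma> / 2 * H x (F k x) (V x) (W x))) *
        (\<sigma> * (g x (nabla (F' k) B x) (Z x) + \<sigma> / 2 * H x (F' k x) (B x) (Z x)))))"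
    unfolding two by (simp only: pure D_mixed[OF s] secF sec)
  also have "\<dots> = \<sigma> * (\<Sum>k\<in>Basis. g x (N \<sigma> (F k) V x) (W x) * g x (N \<sigma> (F' k) B x) (Z x) -
        (g x (nabla (F k) V x) (W x) + \<sigma> / 2 * H x (F k x) (V x) (W x)) *
        (g x (nabla (F' k) B x) (Z x) + \<sigma> / 2 * H x (F' k x) (B x) (Z x)))"
  proof -
    have e: "\<sigma> * ((\<sigma> * a) * (\<sigma> * b)) = \<sigma> * (a * b)" "- \<sigma> * ((\<sigma> * a) * (\<sigma> * b)) = \<sigma> * (- (a * b))"
      for a b using s by auto
    show ?thesis unfolding e
      by (simp only: sum.distrib[symmetric] sum_distrib_left[symmetric] distrib_left[symmetric]
          diff_conv_add_uminus)
  qed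
  finally have tr: "metric_trace (pairing C x) (\<lambda>p r. ip C (D (sext C x p) (Lf \<sigma> V)) (Lf \<sigma> W) x *
      ip C (D (sext C x r) (Lf \<sigma> B)) (Lf \<sigma> Z) x) =
      \<sigma> * (\<Sum>k\<in>Basis. g x (N \<sigma> (F k) V x) (W x) * g x (N \<sigma> (F' k) B x) (Z x) -
        (g x (nabla (F k) V x) (W x) + \<sigma> / 2 * H x (F k x) (V x) (W x)) *
        (g x (nabla (F' k) B x) (Z x) + \<sigma> / 2 * H x (F' k x) (B x) (Z x)))" .
  have P: "pairing C x (lf \<sigma> x \<xi>) (Lf \<sigma> Y x) = \<sigma> * g x \<xi> (Y x)" for \<xi> Y
    by (simp add: Lf_def pairing_lf[OF s])
  have "\<sigma> * Rm (Lf \<sigma> Z) (Lf \<sigma> B) (Lf \<sigma> V) (Lf \<sigma> W) x = (\<sigma> * \<sigma>) * ((1 / 2) *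
    (g x (D2 (N \<sigma>) V W B x - D2 (N \<sigma>) W V B x) (Z x)
     + g x (D2 (N \<sigma>) B Z V x - D2 (N \<sigma>) Z B V x) (W x)
     - (\<Sum>k\<in>Basis. g x (N \<sigma> (F k) V x) (W x) * g x (N \<sigma> (F' k) B x) (Z x) -
        (g x (nabla (F k) V x) (W x) + \<sigma> / 2 * H x (F k x) (V x) (W x)) *
        (g x (nabla (F' k) B x) (Z x) + \<sigma> / 2 * H x (F' k x) (B x) (Z x)))))"
    unfolding gen_riemann_def tr
    by (simp only: D2_Lf[OF s] sec P_simps P) (simp add: LC.g_simps algebra_simps)
  then show ?thesis unfolding ss by simp
qed

text \<open>The result of \<open>D\<close> stays in the eigenbundle of the argument and is
  orthogonal to the frame of the other one, so only one half of the trace survives.\<close>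

lemma conn_div_Lf:
  assumes s: "\<sigma> \<in> {1, -1}" and F: "LC.dual_fields x F F'" and Y: "vector_field (atlas C) Y"
  shows "conn_div C D (Lf \<sigma> Y) x = (\<Sum>b\<in>Basis. g x (N \<sigma> (F b) Y x) (F' b x))"
proof -
  have secF: "vector_field (atlas C) (F k)" "vector_field (atlas C) (F' k)" for k using F by auto
  have df: "dual_frame (g x) (\<lambda>b. F b x) (\<lambda>b. F' b x)" using F by blast
  have ext: "D (sext C x (lf \<rho> x (X x))) v x = D (Lf \<rho> X) v x"
    if "vector_field (atlas C) X" "sec C v" for \<rho> X v
    by (rule E.tensorial_cong[OF D_tensorial[OF that(2)] E.is_sec_ext Lf_sec[OF that(1)]])
      (simp add: E.ext_at Lf_def)
  have two: "(\<Sum>\<rho>\<in>{1, -1}. h \<rho>) = h \<sigma> + h (- \<sigma>)" for h :: "real \<Rightarrow> real"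
    using s by auto
  have "conn_div C D (Lf \<sigma> Y) x = (\<Sum>\<rho>\<in>{1, -1}. \<Sum>b\<in>Basis.
      \<rho> * pairing C x (D (Lf \<rho> (F b)) (Lf \<sigma> Y) x) (Lf \<rho> (F' b) x))"
    unfolding conn_div_def
      endo_trace_E[OF df E.tensorial_ext_linear[OF D_tensorial[OF Lf_sec[OF Y]]]]
    by (simp add: ext secF Lf_sec Y Lf_def)
  also have "\<dots> = (\<Sum>b\<in>Basis. \<sigma> * (\<sigma> * g x (N \<sigma> (F b) Y x) (F' b x)))"
    unfolding two
    by (simp add: D_Lf[OF s secF(1) Y] pairing_Lf[OF s] pairing_other[OF s D_Lf_eig[OF s Lf_sec Y]] secF)
  also have "\<dots> = (\<Sum>b\<in>Basis. g x (N \<sigma> (F b) Y x) (F' b x))"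
    using s by auto
  finally show ?thesis .
qed

lemma contract3_form_norm2: "contract3 (g x) (\<lambda>a b c. r * H x a b c) (\<lambda>a b c. r * H x a b c) =
    r\<^sup>2 * form_norm2 g H x"
  unfolding contract3_scale
  by (simp add: contract3_def metric_trace_def form_norm2_def power2_eq_square)

theorem gen_scalar_formula:
  assumes e: "sec C e"
    and div: "\<And>v. sec C v \<Longrightarrow> conn_div C D v = (\<lambda>x. metric_div C nabla v x - ip C e v x)"
  shows "gen_scalar C G D x =
      scalar_curvature (atlas C) g nabla x - form_norm2 g H x / 12
      + metric_div C nabla (\<lambda>y. gproj C G 1 e y - gproj C G (- 1) e y) x
      - (1 / 2) * G x (e x) (e x)"
proof -
  obtain W F F' where W: "open W" "x \<in> W" and secF: "\<And>b. vector_field (atlas C) (F b)"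
    "\<And>b. vector_field (atlas C) (F' b)"
    and df: "\<And>y. y \<in> W \<Longrightarrow> dual_frame (g y) (\<lambda>b. F b y) (\<lambda>b. F' b y)"
    using T.local_dual_frame[of x] by metis
  have F: "LC.dual_fields y F F'" if "y \<in> W" for y using secF df[OF that] by blast
  define \<tau> where "\<tau> \<sigma> y = \<sigma> *\<^sub>R anchor C y (pr \<sigma> y (e y))" for \<sigma> y
  have \<tau>: "vector_field (atlas C) (\<tau> \<sigma>)" for \<sigma>
    unfolding \<tau>_def[abs_def] by (intro T.sec_scale_const anc_vector_field pr_sec e)
  have S\<tau>: "(\<Sum>b\<in>Basis. S \<sigma> (F b) (F' b) y) = \<tau> \<sigma> y" if s: "\<sigma> \<in> {1, -1}" and y: "y \<in> W" for \<sigma> y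
  proof (rule nondegenerate_eqI[OF T.m_bilinear T.m_nondegenerate])
    interpret CT: levi_civita_contorsion "atlas C" g nabla "S \<sigma>" "\<lambda>x a b c. \<sigma> / 2 * H x a b c"
      by (rule contorsion[OF s])
    fix v
    define Y where "Y = vext (atlas C) y v"
    have Y: "vector_field (atlas C) Y" "Y y = v"
      unfolding Y_def by (rule T.is_sec_ext, rule T.ext_at)
    \<comment> \<open>Skewness turns the trace of \<open>S\<close> into the difference between the
      divergence of \<nabla> and that of \<open>D\<close>. The prescribed divergence makes this
      difference the pairing of \<open>e\<close> with the lift of \<open>Y\<close>.\<close>
    have "g y (\<Sum>b\<in>Basis. S \<sigma> (F b) (F' b) y) (Y y) = (\<Sum>b\<in>Basis. - g y (S \<sigma> (F b) Y y) (F' b y))"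
      unfolding LC.g_sum_left by (intro sum.cong refl CT.S_skew secF Y)
    also have "\<dots> = vdiv (atlas C) nabla Y y - conn_div C D (Lf \<sigma> Y) y"
      unfolding conn_div_Lf[OF s F[OF y] Y(1)] LC.vdiv_dual_fields[OF Y(1) F[OF y]]
      by (simp add: S_def LC.g_simps flip: sum_subtractf)
    also have "\<dots> = pairing C y (lf \<sigma> y (Y y)) (e y)"
      unfolding div[OF Lf_sec[OF Y(1)]] metric_div_def anc_Lf[OF s]
      by (simp add: Lf_def E.m_sym)
    also have "\<dots> = g y (\<tau> \<sigma> y) (Y y)"
      by (simp add: lf_pairing \<tau>_def LC.g_simps T.m_sym)
    finally show "g y (\<Sum>b\<in>Basis. S \<sigma> (F b) (F' b) y) v = g y (\<tau> \<sigma> y) v" by (simp add: Y(2))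
  qed
  \<comment> \<open>The dual fields stand in the first two slots, which matches the arrangement of
    frame and dual frame in \<open>curvature_trace\<close>.\<close>
  define R where "R \<sigma> = (\<Sum>i\<in>Basis. \<Sum>j\<in>Basis.
    \<sigma> * Rmx x (lf \<sigma> x (F' i x)) (lf \<sigma> x (F' j x)) (lf \<sigma> x (F i x)) (lf \<sigma> x (F j x)))" for \<sigma>
  have R: "R \<sigma> = scalar_curvature (atlas C) g nabla x + 2 * vdiv (atlas C) nabla (\<tau> \<sigma>) x
      - g x (\<tau> \<sigma> x) (\<tau> \<sigma> x) - form_norm2 g H x / 12" if s: "\<sigma> \<in> {1, -1}" for \<sigma>
  proof -
    interpret CT: levi_civita_contorsion "atlas C" g nabla "S \<sigma>" "\<lambda>x a b c. \<sigma> / 2 * H x a b c"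
      by (rule contorsion[OF s])
    have N: "CT.N = N \<sigma>" by (intro ext) (simp add: CT.N_def S_def)
    have "Rmx x (lf \<sigma> x (F' i x)) (lf \<sigma> x (F' j x)) (lf \<sigma> x (F i x)) (lf \<sigma> x (F j x)) =
        Rm (Lf \<sigma> (F' i)) (Lf \<sigma> (F' j)) (Lf \<sigma> (F i)) (Lf \<sigma> (F j)) x" for i j
      using Rmx_eq[OF Lf_sec[OF secF(2)] Lf_sec[OF secF(2)] Lf_sec[OF secF(1)] Lf_sec[OF secF(1)]]
      by (simp add: Lf_def)
    then show ?thesis
      unfolding R_def
      using CT.curvature_trace[OF W F \<tau> S\<tau>[OF s]] s
      by (simp only: Rm_Lf[OF s F[OF W(2)] secF(1) secF(1) secF(2) secF(2)] N
          sum_distrib_left[symmetric] contract3_form_norm2) (auto simp: power2_eq_square field_simps)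
  qed
  \<comment> \<open>\<open>gen_scalar_pure\<close> is used with the frame and its dual exchanged, so
    that its summands are those of \<open>R\<close>.\<close>
  have "gen_scalar C G D x = (1 / 2) * (R 1 + R (- 1))"
    unfolding R_def gen_scalar_pure[OF dual_frame_sym[OF df[OF W(2)] T.m_sym]] by simp
  moreover have "metric_div C nabla (\<lambda>y. gproj C G 1 e y - gproj C G (- 1) e y) x =
      vdiv (atlas C) nabla (\<tau> 1) x + vdiv (atlas C) nabla (\<tau> (- 1)) x"
  proof -
    have "anc C (\<lambda>y. gproj C G 1 e y - gproj C G (- 1) e y) = (\<lambda>y. \<tau> 1 y + \<tau> (- 1) y)"
      by (simp add: gproj_eq \<tau>_def anchor_simps)
    then show ?thesis
      unfolding metric_div_def
      by (simp add: LC.vdiv_dual_fields[OF _ F[OF W(2)]] \<tau> T.sec_add LC.nabla_add_right secF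
          LC.g_simps sum.distrib)
  qed
  moreover have "G x (e x) (e x) = g x (\<tau> 1 x) (\<tau> 1 x) + g x (\<tau> (- 1) x) (\<tau> (- 1) x)"
  proof -
    have "G x (e x) (e x) = G x (pr 1 x (e x)) (e x) + G x (pr (- 1) x (e x)) (e x)"
      by (simp add: pr_sum flip: bilinear_ladd[OF GE.m_bilinear])
    then show ?thesis
      using G_eig[OF pr_eig, of 1 x "e x" "e x"] G_eig[OF pr_eig, of "- 1" x "e x" "e x"]
        pairing_eig[OF _ pr_eig, of 1 x "e x" "e x"] pairing_eig[OF _ pr_eig, of "- 1" x "e x" "e x"]
      by (simp add: \<tau>_def LC.g_simps)
  qed
  ultimately show ?thesis
    using R[of 1] R[of "- 1"] by (simp add: field_simps)
qed

end

theorem corollary4p4: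
  fixes C :: "('m::{t2_space,second_countable_topology}, 'n::finite, 'v::euclidean_space) courant"
    and G :: "'m \<Rightarrow> 'v \<Rightarrow> 'v \<Rightarrow> real"
    and g :: "'m \<Rightarrow> real ^ 'n \<Rightarrow> real ^ 'n \<Rightarrow> real"
    and nabla :: "('m \<Rightarrow> real ^ 'n) \<Rightarrow> ('m \<Rightarrow> real ^ 'n) \<Rightarrow> 'm \<Rightarrow> real ^ 'n"
    and H :: "'m \<Rightarrow> real ^ 'n \<Rightarrow> real ^ 'n \<Rightarrow> real ^ 'n \<Rightarrow> real"
    and dv :: "('m \<Rightarrow> 'v) \<Rightarrow> 'm \<Rightarrow> real"
    and e :: "'m \<Rightarrow> 'v"
    and D :: "('m, 'v) gconn"
  assumes "CARD('n) \<ge> 2"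
    and "exact_courant_algebroid C"
    and "generalised_metric C G"
    and "induced_metric C G g"
    and "levi_civita (atlas C) g nabla"
    and "courant_three_form C G g H"
    and "divergence_operator C dv"
    and "sec C e"
    and "\<And>v. sec C v \<Longrightarrow> dv v = (\<lambda>x. metric_div C nabla v x - ip C e v x)"
    and "canonical_connection C G nabla dv D"
  shows "gen_scalar C G D x =
           scalar_curvature (atlas C) g nabla x - form_norm2 g H x / 12
           + metric_div C nabla (\<lambda>y. gproj C G 1 e y - gproj C G (-1) e y) x
           - (1 / 2) * G x (e x) (e x)"
proof -
  have lc: "generalised_levi_civita C G D" and div: "\<And>v. sec C v \<Longrightarrow> conn_div C D v = dv v"
    using assms(10) unfolding canonical_connection_def by blast+
  interpret generalised_levi_civita_geometry C G g D nabla H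
  proof unfold_locales
    show "courant_algebroid C" using assms(2) unfolding exact_courant_algebroid_def by blast
    show "generalised_connection C D" using lc unfolding generalised_levi_civita_def by blast
    show "torsion C D u v w x = 0" if "sec C u" "sec C v" "sec C w" for u v w x
      using lc that unfolding generalised_levi_civita_def by blast
    show "act C u (\<lambda>x. G x (v x) (w x)) = (\<lambda>x. G x (D u v x) (w x) + G x (v x) (D u w x))"
      if "sec C u" "sec C v" "sec C w" for u v w
      using lc that unfolding generalised_levi_civita_def by blast
  qed (fact assms(2-6))+
  show ?thesis
    by (rule gen_scalar_formula[OF assms(8)]) (simp add: div assms(9))
qed

end
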